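(* Let $\mathcal W\subset L^2(\mathbb R^k)$ be a finitely generated shift invariant subspace, let $d(x)=\dim J_{\mathcal W}(x)$ for $x\in\mathbb T^k$, and let $\lambda_i,\alpha_i:\mathbb T^k\to\mathbb R_+$, $i\in\mathbb I_n$, be measurable functions satisfying the admissibility conditions: (Ad.1) $\lambda_i(x)=0$ for a.e. $x\in\mathbb T^k$ such that $i\ge\min\{n,d(x)\}+1$; (Ad.2) $(\alpha_i(x))_{i\in\mathbb I_n}\prec(\lambda_i(x))_{i\in\mathbb I_{d(x)}}$ for a.e. $x\in\mathbb T^k$ (with $\lambda_i(x)=0$ for $i>n$). Consider a sequence of eigensteps $((\lambda_{i,j}(\cdot))_{i\in\mathbb I_j})_{j\in\mathbb I_n}$ for $(\lambda,\alpha)$. Then there exists $\mathcal F=\{f_i\}_{i\in\mathbb I_n}\in\mathcal W^n$ such that $E(\mathcal F)$ is a Bessel sequence and $((\lambda_{i,j}(\cdot))_{i\in\mathbb I_j})_{j\in\mathbb I_n}$ is the sequence of eigensteps associated to $\mathcal F$, i.e. $\lambda_{i,j}(x)=\lambda_i([S_{E(\mathcal F_j)}]_x)$ for $i\in\mathbb I_j$, $j\in\mathbb I_n$ and a.e. $x\in\mathbb T^k$, where $\mathcal F_j=\{f_i\}_{i\in\mathbb I_j}$.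
   Context: Notation: $\mathbb R_+=[0,\infty)$; $n\in\mathbb N$; $\mathbb I_m=\{1,\dots,m\}$ and $\mathbb I_0=\emptyset$; $\mathbb T=[-1/2,1/2)$, and $\mathbb T^k$ carries Lebesgue measure. A closed subspace $\mathcal W\subset L^2(\mathbb R^k)$ is shift invariant (SI) if $T_\ell f\in\mathcal W$ for all $f\in\mathcal W$ and $\ell\in\mathbb Z^k$, where $T_yf(x)=f(x-y)$. It is finitely generated (FSI) if there is a finite set $\mathcal A\subset L^2(\mathbb R^k)$ with $\mathcal W=\overline{\mathrm{span}}\{T_\ell f: f\in\mathcal A,\ \ell\in\mathbb Z^k\}$. $\Gamma:L^2(\mathbb R^k)\to L^2(\mathbb T^k,\ell^2(\mathbb Z^k))$ is the isometric isomorphism extending $\Gamma f(x)=(\hat f(x+\ell))_{\ell\in\mathbb Z^k}$ for $f\in L^1\cap L^2$, where $\hat f(x)=\int_{\mathbb R^k}f(y)e^{-2\pi i\langle y,x\rangle}dy$. If $\mathcal W$ is the SI subspace generated by a finite set $\{h_i\}_i$, its range function is $J_{\mathcal W}(x)=\mathrm{span}\{\Gamma h_i(x)\}_i\subset\ell^2(\mathbb Z^k)$ (a.e. $x$). It is independent of the generators up to null sets, and $\mathcal W=\{f: \Gamma f(x)\in J_{\mathcal W}(x)\text{ for a.e. }x\in\mathbb T^k\}$. For a finite sequence $\mathcal F=\{f_i\}_{i\in\mathbb I_n}\in\mathcal W^n$, $E(\mathcal F)=\{T_\ell f_i\}_{(\ell,i)\in\mathbb Z^k\times\mathbb I_n}$.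 It is a Bessel sequence if there is $b>0$ with $\sum_{\ell,i}|\langle f,T_\ell f_i\rangle|^2\le b\|f\|^2$ for all $f\in L^2(\mathbb R^k)$. Its frame operator is $S_{E(\mathcal F)}f=\sum_{\ell,i}\langle f,T_\ell f_i\rangle T_\ell f_i$. It acts fiberwise, $\Gamma(S_{E(\mathcal F)}f)(x)=[S_{E(\mathcal F)}]_x\,\Gamma f(x)$ for a.e. $x$, with $[S_{E(\mathcal F)}]_x\xi=\sum_{i\in\mathbb I_n}\langle\xi,\Gamma f_i(x)\rangle\Gamma f_i(x)$ for $\xi\in\ell^2(\mathbb Z^k)$. For a positive finite rank operator $T$, $(\lambda_j(T))_{j\in\mathbb N}$ denotes its eigenvalues, counting multiplicities, arranged in non-increasing order and completed with zeros. Vector majorization: for $a\in\mathbb R^n$ and $b\in\mathbb R^m$ (possibly $n\ne m$), $a\prec b$ means $\sum_{i=1}^ka_i^\downarrow\le\sum_{i=1}^kb_i^\downarrow$ for $1\le k\le\min\{n,m\}$ and $\sum_{i=1}^na_i=\sum_{i=1}^mb_i$, where $a^\downarrow$ is the non-increasing rearrangement of $a$ (an empty vector has sum $0$). Eigensteps: for measurable $\lambda_i,\alpha_i:\mathbb T^k\to\mathbb R_+$ ($i\in\mathbb I_n$) satisfying (Ad.1) and (Ad.2), a sequence of eigensteps for $(\lambda,\alpha)$ is a doubly indexed family of measurable functions $\lambda_{i,j}:\mathbb T^k\to\mathbb R_+$, $i\in\mathbb I_j$, $j\in\mathbb I_n$, such that: (1) $\lambda_{i,j+1}(x)\ge\lambda_{i,j}(x)\ge\lambda_{i+1,j+1}(x)$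 for $i\in\mathbb I_j$, $j\in\mathbb I_{n-1}$ and a.e. $x\in\mathbb T^k$; (2) $\sum_{i\in\mathbb I_j}\lambda_{i,j}(x)=\sum_{i\in\mathbb I_j}\alpha_i(x)$ for $j\in\mathbb I_n$ and a.e. $x\in\mathbb T^k$; (3) $\lambda_{i,n}(x)=\lambda_i(x)$ for $i\in\mathbb I_n$ and a.e. $x\in\mathbb T^k$.
   Formalization: The formal theorem additionally assumes that the functions λ_i are essentially bounded on T^k; without this the claim fails (k=n=1, Paley–Wiener W, λ_1=α_1=1/|x|), and the Bessel conclusion forces it. *)

theory Defs
  imports
    "HOL-Analysis.Analysis"
    "HOL-Library.Function_Algebras"
    "HOL-Library.Multiset"
begin

text \<open>Complex-valued functions as a vector space over the complex numbers, with the library's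
  span, subspace and dim.  Elements of \<open>L\<^sup>2\<close> are square integrable functions rather than classes;
  closedness (below) makes the subspaces considered invariant under a.e. equality.\<close>

interpretation cfun: vector_space "\<lambda>(c::complex) (f::'a \<Rightarrow> complex) x. c * f x"
  by unfold_locales (auto simp: fun_eq_iff algebra_simps)

definition L2 :: "(real ^ 'k \<Rightarrow> complex) set" where
  "L2 = {f. f \<in> borel_measurable lebesgue \<and> integrable lebesgue (\<lambda>x. (cmod (f x))\<^sup>2)}"

definition L2_norm :: "(real ^ 'k \<Rightarrow> complex) \<Rightarrow> real" where
  "L2_norm f = sqrt (LINT x|lebesgue. (cmod (f x))\<^sup>2)"

definition L2_inner :: "(real ^ 'k \<Rightarrow> complex) \<Rightarrow> (real ^ 'k \<Rightarrow> complex) \<Rightarrow> complex" where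
  "L2_inner f g = (LINT x|lebesgue. f x * cnj (g x))"

definition L2_tendsto :: "(nat \<Rightarrow> real ^ 'k \<Rightarrow> complex) \<Rightarrow> (real ^ 'k \<Rightarrow> complex) \<Rightarrow> bool" where
  "L2_tendsto g f \<longleftrightarrow> (\<lambda>m. L2_norm (\<lambda>x. g m x - f x)) \<longlonglongrightarrow> 0"

definition L2_closure :: "(real ^ 'k \<Rightarrow> complex) set \<Rightarrow> (real ^ 'k \<Rightarrow> complex) set" where
  "L2_closure V = {f \<in> L2. \<exists>g. (\<forall>m. g m \<in> V) \<and> L2_tendsto g f}"

definition int_vec :: "int ^ 'k \<Rightarrow> real ^ 'k" where
  "int_vec l = (\<chi> j. real_of_int (l $ j))"

definition translation :: "real ^ 'k \<Rightarrow> (real ^ 'k \<Rightarrow> complex) \<Rightarrow> (real ^ 'k \<Rightarrow> complex)" where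
  "translation y f = (\<lambda>x. f (x - y))"

definition shift_invariant :: "(real ^ 'k \<Rightarrow> complex) set \<Rightarrow> bool" where
  "shift_invariant W \<longleftrightarrow>
     W \<subseteq> L2 \<and> cfun.subspace W \<and> L2_closure W \<subseteq> W \<and>
     (\<forall>f\<in>W. \<forall>l. translation (int_vec l) f \<in> W)"

definition finite_generators ::
  "(real ^ 'k \<Rightarrow> complex) set \<Rightarrow> (real ^ 'k \<Rightarrow> complex) set \<Rightarrow> bool" where
  "finite_generators A W \<longleftrightarrow>
     finite A \<and> A \<subseteq> L2 \<and>
     W = L2_closure (cfun.span {translation (int_vec l) f | l f. f \<in> A})"

definition FSI :: "(real ^ 'k \<Rightarrow> complex) set \<Rightarrow> bool" where
  "FSI W \<longleftrightarrow> shift_invariant W \<and> (\<exists>A. finite_generators A W)"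

definition torus :: "(real ^ 'k) set" where
  "torus = {x. \<forall>j. - 1/2 \<le> x $ j \<and> x $ j < 1/2}"

definition ell2 :: "(int ^ 'k \<Rightarrow> complex) set" where
  "ell2 = {\<xi>. (\<lambda>l. (cmod (\<xi> l))\<^sup>2) summable_on UNIV}"

definition ell2_inner :: "(int ^ 'k \<Rightarrow> complex) \<Rightarrow> (int ^ 'k \<Rightarrow> complex) \<Rightarrow> complex" where
  "ell2_inner \<xi> \<eta> = (\<Sum>\<^sub>\<infinity>l. \<xi> l * cnj (\<eta> l))"

definition fourier :: "(real ^ 'k \<Rightarrow> complex) \<Rightarrow> real ^ 'k \<Rightarrow> complex" where
  "fourier f x = (LINT y|lebesgue. f y * exp (- 2 * pi * \<i> * (y \<bullet> x)))"

definition fiber_normsq :: "(real ^ 'k \<Rightarrow> int ^ 'k \<Rightarrow> complex) \<Rightarrow> ennreal" where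
  "fiber_normsq G = (\<integral>\<^sup>+x. (\<Sum>\<^sub>\<infinity>l. ennreal ((cmod (G x l))\<^sup>2)) \<partial>lebesgue_on torus)"

text \<open>Since \<open>\<ell>\<^sup>2\<close> is separable, measurability of an \<open>\<ell>\<^sup>2\<close>-valued function is measurability of its
  components.\<close>

definition fiber_L2 :: "(real ^ 'k \<Rightarrow> int ^ 'k \<Rightarrow> complex) set" where
  "fiber_L2 = {G. (\<forall>l. (\<lambda>x. G x l) \<in> borel_measurable (lebesgue_on torus)) \<and>
                  fiber_normsq G < \<infinity>}"

text \<open>The isometry \<open>\<Gamma>\<close> extends the map \<open>f \<mapsto> (fourier f (x + l))\<^sub>l\<close> from the dense subspace
  \<open>L\<^sup>1 \<inter> L\<^sup>2\<close> by continuity. Its value is determined up to null subsets of the torus, and \<open>\<Gamma>\<close> picks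
  one representative.\<close>

definition is_Gamma :: "(real ^ 'k \<Rightarrow> complex) \<Rightarrow> (real ^ 'k \<Rightarrow> int ^ 'k \<Rightarrow> complex) \<Rightarrow> bool" where
  "is_Gamma f G \<longleftrightarrow>
     G \<in> fiber_L2 \<and>
     (\<exists>g. (\<forall>m. g m \<in> L2 \<and> integrable lebesgue (g m)) \<and> L2_tendsto g f \<and>
          (\<lambda>m. fiber_normsq (\<lambda>x l. fourier (g m) (x + int_vec l) - G x l)) \<longlonglongrightarrow> 0)"

definition \<Gamma> :: "(real ^ 'k \<Rightarrow> complex) \<Rightarrow> real ^ 'k \<Rightarrow> int ^ 'k \<Rightarrow> complex" where
  "\<Gamma> f = (SOME G. is_Gamma f G)"

text \<open>Like the notion itself, this determines \<open>J\<close> only up to null sets.\<close>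

definition is_range_function ::
  "(real ^ 'k \<Rightarrow> complex) set \<Rightarrow> (real ^ 'k \<Rightarrow> (int ^ 'k \<Rightarrow> complex) set) \<Rightarrow> bool" where
  "is_range_function W J \<longleftrightarrow>
     (\<exists>A. finite_generators A W \<and>
          (AE x in lebesgue_on torus. J x = cfun.span ((\<lambda>h. \<Gamma> h x) ` A)))"

text \<open>A finite sequence \<open>(f\<^sub>i)\<close>, \<open>i \<in> {1..n}\<close>, is a function \<open>F\<close> on the naturals used on
  \<open>{1..n}\<close> only.\<close>

definition bessel :: "nat \<Rightarrow> (nat \<Rightarrow> real ^ 'k \<Rightarrow> complex) \<Rightarrow> bool" where
  "bessel n F \<longleftrightarrow>
     (\<exists>b>0. \<forall>f\<in>L2.
        (\<lambda>(l, i). (cmod (L2_inner f (translation (int_vec l) (F i))))\<^sup>2)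
          summable_on (UNIV \<times> {1..n}) \<and>
        (\<Sum>\<^sub>\<infinity>(l, i)\<in>UNIV \<times> {1..n}. (cmod (L2_inner f (translation (int_vec l) (F i))))\<^sup>2)
          \<le> b * (L2_norm f)\<^sup>2)"

definition frame_fiber ::
  "nat \<Rightarrow> (nat \<Rightarrow> real ^ 'k \<Rightarrow> complex) \<Rightarrow> real ^ 'k \<Rightarrow>
   (int ^ 'k \<Rightarrow> complex) \<Rightarrow> (int ^ 'k \<Rightarrow> complex)" where
  "frame_fiber n F x \<xi> = (\<lambda>l. \<Sum>i\<in>{1..n}. ell2_inner \<xi> (\<Gamma> (F i) x) * \<Gamma> (F i) x l)"

definition eigenspace ::
  "((int ^ 'k \<Rightarrow> complex) \<Rightarrow> (int ^ 'k \<Rightarrow> complex)) \<Rightarrow> real \<Rightarrow> (int ^ 'k \<Rightarrow> complex) set" where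
  "eigenspace T \<mu> = {\<xi> \<in> ell2. T \<xi> = (\<lambda>l. complex_of_real \<mu> * \<xi> l)}"

text \<open>For a positive finite rank operator these are the finitely many nonzero eigenvalues with
  their multiplicities.\<close>

definition pos_eigenvalues ::
  "((int ^ 'k \<Rightarrow> complex) \<Rightarrow> (int ^ 'k \<Rightarrow> complex)) \<Rightarrow> real multiset" where
  "pos_eigenvalues T =
     (\<Sum>\<mu>\<in>{\<mu>. \<mu> > 0 \<and> eigenspace T \<mu> \<noteq> {\<lambda>_. 0}}.
        replicate_mset (cfun.dim (eigenspace T \<mu>)) \<mu>)"

text \<open>The \<open>j\<close>-th largest eigenvalue, \<open>j \<ge> 1\<close>.\<close>

definition eigval :: "nat \<Rightarrow> ((int ^ 'k \<Rightarrow> complex) \<Rightarrow> (int ^ 'k \<Rightarrow> complex)) \<Rightarrow> real" where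
  "eigval j T =
     (let es = rev (sorted_list_of_multiset (pos_eigenvalues T))
      in if j \<le> length es then es ! (j - 1) else 0)"

definition majorized :: "real list \<Rightarrow> real list \<Rightarrow> bool" (infix "\<prec>\<^sub>m" 50) where
  "a \<prec>\<^sub>m b \<longleftrightarrow>
     (\<forall>k\<in>{1..min (length a) (length b)}.
        sum_list (take k (rev (sort a))) \<le> sum_list (take k (rev (sort b)))) \<and>
     sum_list a = sum_list b"

definition measurable_nonneg :: "(real ^ 'k \<Rightarrow> real) \<Rightarrow> bool" where
  "measurable_nonneg h \<longleftrightarrow>
     h \<in> borel_measurable (lebesgue_on torus) \<and> (\<forall>x\<in>torus. 0 \<le> h x)"

definition admissible ::
  "nat \<Rightarrow> (real ^ 'k \<Rightarrow> nat) \<Rightarrow> (nat \<Rightarrow> real ^ 'k \<Rightarrow> real) \<Rightarrow> (nat \<Rightarrow> real ^ 'k \<Rightarrow> real) \<Rightarrow> bool" where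
  "admissible n d lam \<alpha> \<longleftrightarrow>
     (AE x in lebesgue_on torus. \<forall>i\<in>{1..n}. min n (d x) + 1 \<le> i \<longrightarrow> lam i x = 0) \<and>
     (AE x in lebesgue_on torus.
        map (\<lambda>i. \<alpha> i x) [1..<n+1] \<prec>\<^sub>m map (\<lambda>i. if i \<le> n then lam i x else 0) [1..<d x+1])"

definition eigensteps ::
  "nat \<Rightarrow> (nat \<Rightarrow> real ^ 'k \<Rightarrow> real) \<Rightarrow> (nat \<Rightarrow> real ^ 'k \<Rightarrow> real) \<Rightarrow>
   (nat \<Rightarrow> nat \<Rightarrow> real ^ 'k \<Rightarrow> real) \<Rightarrow> bool" where
  "eigensteps n lam \<alpha> \<Lambda> \<longleftrightarrow>
     (\<forall>j\<in>{1..n}. \<forall>i\<in>{1..j}. measurable_nonneg (\<Lambda> i j)) \<and>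
     (\<forall>j\<in>{1..<n}. \<forall>i\<in>{1..j}. AE x in lebesgue_on torus.
        \<Lambda> i (j+1) x \<ge> \<Lambda> i j x \<and> \<Lambda> i j x \<ge> \<Lambda> (i+1) (j+1) x) \<and>
     (\<forall>j\<in>{1..n}. AE x in lebesgue_on torus. (\<Sum>i\<in>{1..j}. \<Lambda> i j x) = (\<Sum>i\<in>{1..j}. \<alpha> i x)) \<and>
     (\<forall>i\<in>{1..n}. AE x in lebesgue_on torus. \<Lambda> i n x = lam i x)"

end

theory Submission
  imports Defs "HOL-Probability.Probability" "HOL-Real_Asymp.Real_Asymp"
begin

text \<open>Only the interlacing of the eigensteps matters.  Passing from \<open>diag x\<close> to \<open>diag x + c c\<^sup>T\<close> one can
  reach any \<open>y\<close> interlacing with \<open>x\<close>: for strict interlacing \<open>c\<close> and the eigenvectors are read off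
  the secular equation, and compactness gives the general case together with a Borel choice of \<open>c\<close>
  and of the orthogonal diagonalizing matrix.  Iterating and finally rotating to the eigenbasis
  of the last step produces coefficient vectors, depending measurably on \<open>x\<close>, whose coordinate
  \<open>r\<close> vanishes wherever the \<open>r\<close>-th final eigenvalue does.  They are transplanted to the fibers along
  a measurable orthonormal basis of \<open>J x\<close>, obtained by fiberwise Gram-Schmidt.

  The resulting measurable fields lie in the range of \<open>\<Gamma>\<close> on \<open>W\<close> because \<open>\<Gamma>\<close> is isometric
  (Plancherel), so that the multipliers of \<open>\<Gamma> ` W\<close> are closed under bounded pointwise limits;
  translations contribute the trigonometric monomials, hence every bounded measurable function is
  a multiplier.  Boundedness of the final eigenvalues bounds the fibers and gives the Bessel property.\<close>

section \<open>Gaussians and the Plancherel theorem for continuous functions\<close>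

text \<open>All eigenstep lists are padded with zeros to length \<open>n\<close>, so that every step
  is an update of an \<open>n\<close> by \<open>n\<close> diagonal matrix; interlacing survives the
  padding. A fiber may have dimension \<open>d x\<close> smaller than \<open>n\<close>, which is the
  obstacle to transplanting \<open>n\<close> coordinates. In the eigenbasis of the last step the
  squares of the \<open>r\<close>-th coordinates of all vectors sum to the \<open>r\<close>-th final
  eigenvalue, and (Ad.1) makes it vanish beyond position \<open>d x\<close>; hence only the first
  \<open>d x\<close> basis vectors of the fiber are ever used. Eigenvectors cannot be chosen
  continuously where eigenvalues collide, so the pairs \<open>(c, Q)\<close> are selected from a
  closed relation inside one compact set. The same set serves almost every \<open>x\<close>, because
  the final eigenvalues have a common essential bound and interlacing passes it to the earlier
  steps. \<open>\<Gamma> f\<close> is a chosen representative, so statements on fibers hold only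
  almost everywhere. The passage from a measurable field of fibers back to an element of
  \<open>W\<close> is made in one place, \<open>Gamma_synthesis\<close>, which serves both the
  orthonormal basis and the final vectors.\<close>

lemma lborel_prod_Basis:
  fixes g :: "'a::euclidean_space \<Rightarrow> real \<Rightarrow> complex"
  assumes "\<And>b. b \<in> Basis \<Longrightarrow> integrable lborel (g b)"
  shows "integrable lborel (\<lambda>x::'a. \<Prod>b\<in>Basis. g b (x \<bullet> b))"
    and "(LINT x|lborel. (\<Prod>b\<in>Basis. g b (x \<bullet> b))) = (\<Prod>b\<in>(Basis::'a set). LINT t|lborel. g b t)"
proof -
  interpret product_sigma_finite "\<lambda>_::'a. lborel :: real measure" ..
  have m: "(\<lambda>x::'a. \<Prod>b\<in>Basis. g b (x \<bullet> b)) \<in> borel_measurable borel"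
  proof (rule borel_measurable_prod)
    fix b :: 'a assume "b \<in> Basis"
    then have [measurable]: "g b \<in> borel_measurable borel"
      using assms[of b] by auto
    show "(\<lambda>x. g b (x \<bullet> b)) \<in> borel_measurable borel" by measurable
  qed
  have e: "(\<Prod>b\<in>Basis. g b ((\<Sum>c\<in>Basis. f c *\<^sub>R c) \<bullet> b)) = (\<Prod>b\<in>Basis. g b (f b))" for f :: "'a \<Rightarrow> real"
    by (intro prod.cong refl) simp
  have "integrable (Pi\<^sub>M Basis (\<lambda>_. lborel)) (\<lambda>f. \<Prod>b\<in>(Basis::'a set). g b (f b))"
    by (rule product_integrable_prod) (use assms in auto)
  then show "integrable lborel (\<lambda>x::'a. \<Prod>b\<in>Basis. g b (x \<bullet> b))"
    unfolding lborel_eq[where 'a='a] by (subst integrable_distr_eq) (use m e in auto)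
  have "(LINT f|Pi\<^sub>M Basis (\<lambda>_. lborel). (\<Prod>b\<in>(Basis::'a set). g b (f b))) = (\<Prod>b\<in>(Basis::'a set). LINT t|lborel. g b t)"
    by (rule product_integral_prod) (use assms in auto)
  then show "(LINT x|lborel. (\<Prod>b\<in>Basis. g b (x \<bullet> b))) = (\<Prod>b\<in>(Basis::'a set). LINT t|lborel. g b t)"
    unfolding lborel_eq[where 'a='a] by (subst integral_distr) (use m e in auto)
qed

text \<open>The substitution \<open>s = 2 * pi * c * t\<close> turns the integral into the
  characteristic function of the standard normal law at \<open>- z / c\<close>, which is known in
  closed form.\<close>

lemma gaussian_fourier_real:
  fixes c z :: real
  assumes c: "c > 0"
  shows "integrable lborel (\<lambda>t. complex_of_real (exp (- (2*pi*c*t)\<^sup>2 / 2)) * exp (- 2 * pi * \<i> * (t * z)))"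
    and "(LINT t|lborel. complex_of_real (exp (- (2*pi*c*t)\<^sup>2 / 2)) * exp (- 2 * pi * \<i> * (t * z)))
       = complex_of_real (std_normal_density (z / c) / c)"
proof -
  define g where "g s = complex_of_real (exp (- s\<^sup>2 / 2)) * exp (- \<i> * (s * (z/c)))" for s :: real
  have gd: "g s = sqrt (2*pi) *\<^sub>R (std_normal_density s *\<^sub>R iexp ((- z/c) * s))" for s
    by (simp add: g_def std_normal_density_def scaleR_conv_of_real mult_ac)
  have int0: "integrable lborel (\<lambda>s. std_normal_density s *\<^sub>R iexp ((- z/c) * s))"
  proof (rule Bochner_Integration.integrable_bound[of lborel std_normal_density])
    show "integrable lborel std_normal_density" by (rule integrable_normal_density) simp
  qed auto
  then have intg: "integrable lborel g"
    unfolding gd by (rule integrable_scaleR_right)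
  have "(LINT s|lborel. std_normal_density s *\<^sub>R iexp ((- z/c) * s)) = char std_normal_distribution (- z/c)"
    unfolding char_def by (subst integral_density) (auto simp: normal_density_nonneg)
  also have "\<dots> = complex_of_real (exp (- (z/c)\<^sup>2 / 2))"
    by (simp add: char_std_normal_distribution)
  finally have ig: "(LINT s|lborel. g s) = sqrt (2*pi) *\<^sub>R complex_of_real (exp (- (z/c)\<^sup>2 / 2))"
    by (simp only: gd integral_scaleR_right)
  have pc: "2*pi*c \<noteq> 0" using c by simp
  have eq: "complex_of_real (exp (- (2*pi*c*t)\<^sup>2 / 2)) * exp (- 2 * pi * \<i> * (t * z)) = g (0 + (2*pi*c) * t)" for t
    using c by (simp add: g_def field_simps)
  show "integrable lborel (\<lambda>t. complex_of_real (exp (- (2*pi*c*t)\<^sup>2 / 2)) * exp (- 2 * pi * \<i> * (t * z)))"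
    unfolding eq using lborel_integrable_real_affine[OF intg pc, of 0] .
  have "(LINT s|lborel. g s) = \<bar>2*pi*c\<bar> *\<^sub>R (LINT t|lborel. g (0 + (2*pi*c) * t))"
    by (rule lborel_integral_real_affine[OF pc])
  then have "(LINT t|lborel. g (0 + (2*pi*c) * t)) = (1 / (2*pi*c)) *\<^sub>R (sqrt (2*pi) *\<^sub>R complex_of_real (exp (- (z/c)\<^sup>2 / 2)))"
    using c ig by (simp add: field_simps)
  also have "\<dots> = complex_of_real (std_normal_density (z / c) / c)"
  proof -
    have "(2*pi) = sqrt (2*pi) * sqrt (2*pi)" by simp
    then have "1 / (2*pi*c) * sqrt (2*pi) = 1 / sqrt (2*pi) / c"
      using c by (simp add: field_simps)
    then have "1 / (2*pi*c) * sqrt (2*pi) * exp (- (z/c)\<^sup>2 / 2) = 1 / sqrt (2*pi) / c * exp (- (z/c)\<^sup>2 / 2)"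
      by simp
    then have "1 / (2*pi*c) * (sqrt (2*pi) * exp (- (z/c)\<^sup>2 / 2)) = std_normal_density (z / c) / c"
      by (simp add: std_normal_density_def)
    then show ?thesis
      by (simp only: scaleR_conv_of_real flip: of_real_mult)
  qed
  finally show "(LINT t|lborel. complex_of_real (exp (- (2*pi*c*t)\<^sup>2 / 2)) * exp (- 2 * pi * \<i> * (t * z)))
       = complex_of_real (std_normal_density (z / c) / c)"
    unfolding eq .
qed

definition gauss :: "'a::euclidean_space \<Rightarrow> real" where
  "gauss x = (\<Prod>b\<in>Basis. std_normal_density (x \<bullet> b))"

text \<open>A convergence factor rather than a density: it tends to 1 pointwise as \<open>c\<close>
  tends to 0, while its Fourier transform \<open>gauss (z / c) / c ^ DIM('a)\<close> is an
  approximate identity.\<close>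

definition gauss_weight :: "real \<Rightarrow> 'a::euclidean_space \<Rightarrow> real" where
  "gauss_weight c x = exp (- (2*pi*c*norm x)\<^sup>2 / 2)"

lemma gauss_nonneg: "0 \<le> gauss x"
  unfolding gauss_def by (intro prod_nonneg) auto

lemma gauss_measurable [measurable]: "gauss \<in> borel_measurable borel"
  unfolding gauss_def by measurable

lemma gauss_weight_measurable [measurable]: "gauss_weight c \<in> borel_measurable borel"
  unfolding gauss_weight_def by measurable

lemma gauss_integral:
  "integrable lborel (gauss :: 'a::euclidean_space \<Rightarrow> real)" "(LINT x|lborel. gauss (x::'a)) = 1"
proof -
  have i: "integrable lborel (\<lambda>t. complex_of_real (std_normal_density t))"
    by (intro integrable_of_real integrable_normal_density) simp
  have j: "(LINT t|lborel. complex_of_real (std_normal_density t)) = 1"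
    by (simp only: integral_complex_of_real) (simp add: integral_normal_density[of 1 0])
  note P = lborel_prod_Basis[where 'a='a, of "\<lambda>_ t. complex_of_real (std_normal_density t)", OF i]
  have e: "(\<Prod>b\<in>(Basis::'a set). complex_of_real (std_normal_density (x \<bullet> b))) = complex_of_real (gauss x)" for x
    by (simp add: gauss_def)
  have 1: "integrable lborel (\<lambda>x::'a. complex_of_real (gauss x))"
    using P(1) unfolding e .
  then show 2: "integrable lborel (gauss :: 'a \<Rightarrow> real)"
    using integrable_Re[OF 1] by simp
  have "(LINT x|lborel. complex_of_real (gauss (x::'a))) = 1"
    using P(2) unfolding e j by simp
  then show "(LINT x|lborel. gauss (x::'a)) = 1"
    by (simp only: integral_complex_of_real of_real_eq_1_iff)
qed

lemma gauss_weight_fourier: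
  fixes z :: "'a::euclidean_space"
  assumes c: "c > 0"
  shows "integrable lborel (\<lambda>x. complex_of_real (gauss_weight c x) * exp (- 2 * pi * \<i> * (x \<bullet> z)))"
    and "(LINT x|lborel. complex_of_real (gauss_weight c x) * exp (- 2 * pi * \<i> * (x \<bullet> z)))
       = complex_of_real (gauss (z /\<^sub>R c) / c ^ DIM('a))"
proof -
  note P = lborel_prod_Basis[where 'a='a, of "\<lambda>b t. complex_of_real (exp (- (2*pi*c*t)\<^sup>2 / 2)) * exp (- 2 * pi * \<i> * (t * (z \<bullet> b)))",
     OF gaussian_fourier_real(1)[OF c]]
  have e: "(\<Prod>b\<in>Basis. complex_of_real (exp (- (2*pi*c*(x \<bullet> b))\<^sup>2 / 2)) * exp (- 2 * pi * \<i> * ((x \<bullet> b) * (z \<bullet> b))))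
     = complex_of_real (gauss_weight c x) * exp (- 2 * pi * \<i> * (x \<bullet> z))" for x :: 'a
  proof -
    have n: "(norm x)\<^sup>2 = (\<Sum>b\<in>Basis. (x \<bullet> b)\<^sup>2)"
      by (subst power2_norm_eq_inner, subst euclidean_inner) (simp add: power2_eq_square)
    have "(\<Prod>b\<in>(Basis::'a set). exp (- (2*pi*c*(x \<bullet> b))\<^sup>2 / 2)) = gauss_weight c x"
      unfolding gauss_weight_def
      by (subst exp_sum[symmetric], simp)
         (simp add: power_mult_distrib n sum_distrib_left sum_divide_distrib sum_negf)
    moreover have "(\<Prod>b\<in>Basis. exp (- 2 * pi * \<i> * ((x \<bullet> b) * (z \<bullet> b)))) = exp (- 2 * pi * \<i> * (x \<bullet> z))"
      by (subst exp_sum[symmetric], simp) (simp add: euclidean_inner[of x z] sum_distrib_left sum_negf)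
    ultimately show ?thesis by (simp add: prod.distrib flip: of_real_prod)
  qed
  show "integrable lborel (\<lambda>x. complex_of_real (gauss_weight c x) * exp (- 2 * pi * \<i> * (x \<bullet> z)))"
    using P(1) unfolding e .
  have "(\<Prod>b\<in>(Basis::'a set). complex_of_real (std_normal_density ((z \<bullet> b) / c) / c)) = complex_of_real (gauss (z /\<^sub>R c) / c ^ DIM('a))"
    by (simp add: gauss_def prod_dividef divide_inverse mult.commute prod.distrib power_inverse)
  then show "(LINT x|lborel. complex_of_real (gauss_weight c x) * exp (- 2 * pi * \<i> * (x \<bullet> z)))
       = complex_of_real (gauss (z /\<^sub>R c) / c ^ DIM('a))"
    using P(2) unfolding e gaussian_fourier_real(2)[OF c] by simp
qed

definition phase :: "real \<Rightarrow> complex" where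
  "phase t = exp (- 2 * pi * \<i> * complex_of_real t)"

lemma norm_phase [simp]: "cmod (phase t) = 1"
  using norm_exp_i_times[of "- 2 * pi * t"] by (simp add: phase_def mult_ac del: norm_exp_eq_Re)

lemma cnj_phase [simp]: "cnj (phase t) = phase (- t)"
  by (simp add: phase_def exp_cnj)

lemma phase_0 [simp]: "phase 0 = 1"
  by (simp add: phase_def)

lemma phase_add: "phase (s + t) = phase s * phase t"
  by (simp add: phase_def algebra_simps flip: exp_add)

lemma phase_measurable [measurable]: "phase \<in> borel_measurable borel"
  unfolding phase_def by measurable

lemma continuous_phase [continuous_intros]: "continuous_on S f \<Longrightarrow> continuous_on S (\<lambda>x. phase (f x))"
  unfolding phase_def by (intro continuous_intros)

text \<open>The Fourier transform over \<open>lborel\<close>, where Fubini and Borel measurability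
  work directly. It is identified with \<open>fourier\<close>, an integral over
  \<open>lebesgue\<close>, for continuous compactly supported functions.\<close>

definition ftr :: "('a::euclidean_space \<Rightarrow> complex) \<Rightarrow> 'a \<Rightarrow> complex" where
  "ftr f x = (LINT y|lborel. f y * phase (y \<bullet> x))"

lemma ftr_bound:
  assumes "integrable lborel f"
  shows "cmod (ftr f x) \<le> (LINT y|lborel. cmod (f y))"
proof -
  have "cmod (ftr f x) \<le> (LINT y|lborel. cmod (f y * phase (y \<bullet> x)))"
    unfolding ftr_def by (rule integral_norm_bound)
  then show ?thesis by (simp only: norm_mult norm_phase mult_1_right)
qed

lemma ftr_measurable:
  assumes "integrable lborel f"
  shows "ftr f \<in> borel_measurable borel"
proof -
  have [measurable]: "f \<in> borel_measurable borel" using assms by auto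
  show ?thesis unfolding ftr_def by measurable
qed

lemma gauss_weight_integrable:
  assumes "c > 0"
  shows "integrable lborel (gauss_weight c :: 'a::euclidean_space \<Rightarrow> real)"
  using integrable_Re[OF gauss_weight_fourier(1)[OF assms, of "0::'a"]] by simp

lemma borel_measurable_cnj [measurable (raw)]:
  "f \<in> borel_measurable M \<Longrightarrow> (\<lambda>x. cnj (f x)) \<in> borel_measurable M"
  by (rule borel_measurable_continuous_on[OF continuous_on_cnj[OF continuous_on_id]])

text \<open>Fubini is applied twice, unfolding one transform at a time; what remains of the
  \<open>x\<close> integral is the Fourier transform of the weight at \<open>y - z\<close>. The
  weight makes the integrals absolutely convergent, as \<open>ftr f\<close> is only known to be
  bounded.\<close>

lemma gauss_weight_convolution:
  fixes f :: "'a::euclidean_space \<Rightarrow> complex"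
  assumes f: "integrable lborel f" and c: "c > 0"
  shows "(LINT x|lborel. ftr f x * cnj (ftr f x) * gauss_weight c x)
    = (LINT x|lborel. f x * (LINT y|lborel. cnj (f y) * complex_of_real (gauss ((x - y) /\<^sub>R c) / c ^ DIM('a))))"
proof -
  have [measurable]: "f \<in> borel_measurable borel" "ftr f \<in> borel_measurable borel"
    using f ftr_measurable[OF f] by auto
  define w where "w = (\<lambda>x::'a. complex_of_real (gauss_weight c x))"
  have w: "integrable lborel w" unfolding w_def by (intro integrable_of_real gauss_weight_integrable c)
  then have [measurable]: "w \<in> borel_measurable borel" by auto
  let ?e = "\<lambda>y x :: 'a. phase (y \<bullet> x)"
  have wf: "integrable (lborel \<Otimes>\<^sub>M lborel) (\<lambda>z. f (fst z) * w (snd z))"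
    using w f
    by (intro lborel_pair.Fubini_integrable) (auto simp: norm_mult case_prod_beta)
  have "integrable (lborel \<Otimes>\<^sub>M lborel) (\<lambda>(y, x). f y * ?e y x * cnj (ftr f x) * w x)"
  proof (rule Bochner_Integration.integrable_bound[OF integrable_scaleR_right[OF wf, of "LINT y|lborel. cmod (f y)"]])
    show "AE z in lborel \<Otimes>\<^sub>M lborel. norm (case z of (y, x) \<Rightarrow> f y * ?e y x * cnj (ftr f x) * w x)
       \<le> norm ((LINT y|lborel. cmod (f y)) *\<^sub>R (f (fst z) * w (snd z)))"
    proof (intro AE_I2)
      fix z :: "'a \<times> 'a"
      obtain y x where z: "z = (y, x)" by (cases z)
      have "0 \<le> (LINT y|lborel. cmod (f y))" by simp
      then show "norm (case z of (y, x) \<Rightarrow> f y * phase (y \<bullet> x) * cnj (ftr f x) * w x)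
         \<le> norm ((LINT y|lborel. cmod (f y)) *\<^sub>R (f (fst z) * w (snd z)))"
        using mult_left_mono[OF ftr_bound[OF f, of x], of "cmod (f y) * cmod (w x)"]
        by (simp add: z norm_mult mult_ac)
    qed
  qed measurable
  then have "(LINT x|lborel. (LINT y|lborel. f y * ?e y x * cnj (ftr f x) * w x))
     = (LINT y|lborel. (LINT x|lborel. f y * ?e y x * cnj (ftr f x) * w x))"
    by (rule lborel_pair.Fubini_integral)
  moreover have "(LINT y|lborel. f y * ?e y x * cnj (ftr f x) * w x) = ftr f x * cnj (ftr f x) * w x" for x
    unfolding ftr_def[of f] by (simp only: integral_mult_left_zero mult.assoc[symmetric])
  moreover have "(LINT x|lborel. f y * ?e y x * cnj (ftr f x) * w x)
       = f y * (LINT x|lborel. ?e y x * cnj (ftr f x) * w x)" for y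
    by (simp only: integral_mult_right_zero mult.assoc)
  moreover have "(LINT x|lborel. ?e y x * cnj (ftr f x) * w x)
     = (LINT z|lborel. cnj (f z) * complex_of_real (gauss ((y - z) /\<^sub>R c) / c ^ DIM('a)))" for y
  proof -
    have c1: "cnj (ftr f x) = (LINT z|lborel. cnj (f z) * ?e (-z) x)" for x
      unfolding ftr_def by (subst Bochner_Integration.integral_cnj[symmetric]) (simp only: complex_cnj_mult cnj_phase inner_minus_left)
    have "integrable (lborel \<Otimes>\<^sub>M lborel) (\<lambda>(z, x). cnj (f z) * ?e (y - z) x * w x)"
      by (rule Bochner_Integration.integrable_bound[OF wf])
         (auto simp: norm_mult norm_phase)
    from lborel_pair.Fubini_integral[OF this]
    have "(LINT x|lborel. (LINT z|lborel. cnj (f z) * ?e (y - z) x * w x))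
      = (LINT z|lborel. (LINT x|lborel. cnj (f z) * ?e (y - z) x * w x))" .
    moreover have "(LINT z|lborel. cnj (f z) * ?e (y - z) x * w x) = ?e y x * cnj (ftr f x) * w x" for x
    proof -
      have "?e (y - z) x = ?e y x * ?e (-z) x" for z
        by (simp add: inner_diff_left flip: phase_add)
      then have "(\<lambda>z. cnj (f z) * phase ((y - z) \<bullet> x) * w x) = (\<lambda>z. (phase (y \<bullet> x) * w x) * (cnj (f z) * phase ((-z) \<bullet> x)))"
        by (simp only: mult_ac)
      then have "(LINT z|lborel. cnj (f z) * phase ((y - z) \<bullet> x) * w x) = (phase (y \<bullet> x) * w x) * cnj (ftr f x)"
        by (simp only: c1 integral_mult_right_zero)
      then show ?thesis by (simp only: mult_ac)
    qed
    moreover have "(LINT x|lborel. cnj (f z) * ?e (y - z) x * w x)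
        = cnj (f z) * complex_of_real (gauss ((y - z) /\<^sub>R c) / c ^ DIM('a))" for z
    proof -
      have "(\<lambda>x. cnj (f z) * ?e (y - z) x * w x) = (\<lambda>x. cnj (f z) * (complex_of_real (gauss_weight c x) * exp (- 2 * pi * \<i> * complex_of_real (x \<bullet> (y - z)))))"
        by (simp only: phase_def w_def mult_ac inner_commute)
      then show ?thesis by (simp only: integral_mult_right_zero gauss_weight_fourier(2)[OF c])
    qed
    ultimately show ?thesis by (simp only:)
  qed
  ultimately have "(LINT x|lborel. ftr f x * cnj (ftr f x) * w x) = (LINT y|lborel. f y * (LINT z|lborel. cnj (f z) * complex_of_real (gauss ((y - z) /\<^sub>R c) / c ^ DIM('a))))"
    by (simp only:)
  then show ?thesis by (simp only: w_def)
qed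

lemma lborel_integral_affine:
  fixes h :: "'a::euclidean_space \<Rightarrow> complex"
  assumes [measurable]: "h \<in> borel_measurable borel" and c: "c \<noteq> 0"
  shows "(LINT y|lborel. h y) = (LINT u|lborel. \<bar>c\<bar> ^ DIM('a) *\<^sub>R h (t + c *\<^sub>R u))"
  by (subst lborel_affine[OF c, of t], subst integral_density)
     (simp_all add: integral_distr del: integral_scaleR_right)

text \<open>The weighted square integral of \<open>ftr f\<close> is the pairing of \<open>f\<close>
  with its Gaussian mollification at scale \<open>c\<close>. As \<open>c\<close> tends to 0 the
  pairing converges by dominated convergence. The weights increase to 1, so the other side converges
  by monotone convergence, without knowing beforehand that \<open>ftr f\<close> is square
  integrable.\<close>

lemma plancherel_continuous:
  fixes f :: "'a::euclidean_space \<Rightarrow> complex"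
  assumes cont: "continuous_on UNIV f" and supp: "\<And>x. R < norm x \<Longrightarrow> f x = 0"
  shows "(\<integral>\<^sup>+x. ennreal ((cmod (ftr f x))\<^sup>2) \<partial>lborel) = (\<integral>\<^sup>+x. ennreal ((cmod (f x))\<^sup>2) \<partial>lborel)"
proof -
  have [measurable]: "f \<in> borel_measurable borel"
    by (rule borel_measurable_continuous_onI[OF cont])
  have "compact (f ` cball 0 R)"
    by (intro compact_continuous_image continuous_on_subset[OF cont]) auto
  then have "bounded (f ` cball 0 R)" by (rule compact_imp_bounded)
  then obtain M0 where "\<forall>y\<in>f ` cball 0 R. cmod y \<le> M0" using bounded_iff by metis
  then have M0: "\<And>x. norm x \<le> R \<Longrightarrow> cmod (f x) \<le> M0" by auto
  define M where "M = max M0 0"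
  have M: "cmod (f x) \<le> M" "M \<ge> 0" for x
    using M0[of x] supp[of x] unfolding M_def by (cases "norm x \<le> R"; force)+
  have ic: "integrable lborel (\<lambda>x::'a. indicator (cball 0 R) x *\<^sub>R M)"
    by (intro integrable_scaleR_left integrable_real_indicator) (use emeasure_bounded_finite[OF bounded_cball[of "0::'a" R]] in auto)
  have if1: "integrable lborel f"
    by (rule Bochner_Integration.integrable_bound[OF ic])
       (use M supp in \<open>auto simp: indicator_def not_le\<close>)
  have if2: "integrable lborel (\<lambda>x. (cmod (f x))\<^sup>2)"
  proof (rule Bochner_Integration.integrable_bound[OF integrable_mult_right[OF ic, of M]])
    show "AE x in lborel. norm ((cmod (f x))\<^sup>2) \<le> norm (M * (indicator (cball 0 R) x *\<^sub>R M))"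
      using M supp by (auto simp: indicator_def not_le power2_eq_square intro!: mult_mono)
  qed auto
  have ft [measurable]: "ftr f \<in> borel_measurable borel" by (rule ftr_measurable[OF if1])
  define c where "c m = 1 / (real m + 1)" for m
  have c: "c m > 0" for m by (simp add: c_def)
  have c0: "c \<longlonglongrightarrow> 0" unfolding c_def by real_asymp
  define D where "D = (LINT y|lborel. cmod (f y))"
  have D: "cmod (ftr f x) \<le> D" for x using ftr_bound[OF if1] by (simp add: D_def)
  \<comment> \<open>The change of variables \<open>y = x - c m * u\<close> moves the scale from the
    kernel into the argument of \<open>f\<close>, and its Jacobian cancels
    \<open>c m ^ DIM('a)\<close>. Continuity of \<open>f\<close> then gives the pointwise limit
    \<open>H\<close>.\<close>
  define G where "G m z = f (fst z) * cnj (f (fst z - c m *\<^sub>R snd z)) * complex_of_real (gauss (snd z))" for m and z :: "'a \<times> 'a"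
  define H where "H z = f (fst z) * cnj (f (fst z)) * complex_of_real (gauss (snd z))" for z :: "'a \<times> 'a"
  have dom: "integrable (lborel \<Otimes>\<^sub>M lborel) (\<lambda>z. M * (cmod (f (fst z)) * gauss (snd z :: 'a)))"
    using if1 gauss_integral(1) 
    by (intro integrable_mult_right lborel_pair.Fubini_integrable) (auto simp: norm_mult gauss_nonneg)
  have conv: "integrable (lborel \<Otimes>\<^sub>M lborel) H" "\<And>m. integrable (lborel \<Otimes>\<^sub>M lborel) (G m)"
    "(\<lambda>m. integral\<^sup>L (lborel \<Otimes>\<^sub>M lborel) (G m)) \<longlonglongrightarrow> integral\<^sup>L (lborel \<Otimes>\<^sub>M lborel) H"
  proof -
    have 1: "H \<in> borel_measurable (lborel \<Otimes>\<^sub>M lborel)" "\<And>m. G m \<in> borel_measurable (lborel \<Otimes>\<^sub>M lborel)"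
      unfolding H_def[abs_def] G_def[abs_def] by measurable
    have 2: "AE z in lborel \<Otimes>\<^sub>M lborel. (\<lambda>m. G m z) \<longlonglongrightarrow> H z"
    proof (intro AE_I2)
      fix z :: "'a \<times> 'a"
      have "(\<lambda>m. fst z - c m *\<^sub>R snd z) \<longlonglongrightarrow> fst z - 0 *\<^sub>R snd z"
        by (intro tendsto_intros c0)
      then have "(\<lambda>m. f (fst z - c m *\<^sub>R snd z)) \<longlonglongrightarrow> f (fst z)"
        using continuous_on_tendsto_compose[OF cont] by simp
      then show "(\<lambda>m. G m z) \<longlonglongrightarrow> H z"
        unfolding G_def H_def by (intro tendsto_intros)
    qed
    have 3: "AE z in lborel \<Otimes>\<^sub>M lborel. norm (G m z) \<le> M * (cmod (f (fst z)) * gauss (snd z))" for m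
    proof (intro AE_I2)
      fix z :: "'a \<times> 'a"
      show "norm (G m z) \<le> M * (cmod (f (fst z)) * gauss (snd z))"
        using mult_right_mono[OF M(1)[of "fst z - c m *\<^sub>R snd z"], of "cmod (f (fst z)) * gauss (snd z)"]
        by (simp add: G_def norm_mult gauss_nonneg mult_ac)
    qed
    show "integrable (lborel \<Otimes>\<^sub>M lborel) H" by (rule integrable_dominated_convergence[OF 1 dom 2 3])
    show "\<And>m. integrable (lborel \<Otimes>\<^sub>M lborel) (G m)" by (rule integrable_dominated_convergence2[OF 1 dom 2 3])
    show "(\<lambda>m. integral\<^sup>L (lborel \<Otimes>\<^sub>M lborel) (G m)) \<longlonglongrightarrow> integral\<^sup>L (lborel \<Otimes>\<^sub>M lborel) H"
      by (rule integral_dominated_convergence[OF 1 dom 2 3])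
  qed
  have H: "integral\<^sup>L (lborel \<Otimes>\<^sub>M lborel) H = complex_of_real (LINT x|lborel. (cmod (f x))\<^sup>2)"
  proof -
    have "integral\<^sup>L (lborel \<Otimes>\<^sub>M lborel) H = (LINT x|lborel. (LINT u|lborel. H (x, u)))"
      by (rule lborel_pair.integral_fst'[OF conv(1), symmetric])
    moreover have "(LINT u|lborel. H (x, u)) = complex_of_real ((cmod (f x))\<^sup>2)" for x
    proof -
      have "(LINT u|lborel. H (x, u)) = f x * cnj (f x) * complex_of_real (LINT u|lborel. gauss (u::'a))"
        unfolding H_def fst_conv snd_conv by (simp only: integral_mult_right_zero integral_complex_of_real)
      then show ?thesis by (simp only: gauss_integral complex_norm_square of_real_1 mult_1_right)
    qed
    ultimately show ?thesis by (simp only: integral_complex_of_real)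
  qed
  have G: "integral\<^sup>L (lborel \<Otimes>\<^sub>M lborel) (G m) = complex_of_real (LINT x|lborel. (cmod (ftr f x))\<^sup>2 * gauss_weight (c m) x)" for m
  proof -
    have inner: "(LINT y|lborel. cnj (f y) * complex_of_real (gauss ((x - y) /\<^sub>R c m) / c m ^ DIM('a)))
        = (LINT u|lborel. cnj (f (x - c m *\<^sub>R u)) * complex_of_real (gauss u))" for x
    proof -
      have "(LINT y|lborel. cnj (f y) * complex_of_real (gauss ((x - y) /\<^sub>R c m) / c m ^ DIM('a)))
        = (LINT u|lborel. c m ^ DIM('a) *\<^sub>R (cnj (f (x - c m *\<^sub>R u)) * complex_of_real (gauss u / c m ^ DIM('a))))"
        using c[of m] by (subst lborel_integral_affine[of _ "- c m" x]) auto
      also have "\<dots> = (LINT u|lborel. cnj (f (x - c m *\<^sub>R u)) * complex_of_real (gauss u))"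
        using c[of m] by (intro Bochner_Integration.integral_cong refl) (simp add: scaleR_conv_of_real)
      finally show ?thesis .
    qed
    have "integral\<^sup>L (lborel \<Otimes>\<^sub>M lborel) (G m) = (LINT x|lborel. (LINT u|lborel. G m (x, u)))"
      by (rule lborel_pair.integral_fst'[OF conv(2), symmetric])
    also have "\<dots> = (LINT x|lborel. f x * (LINT u|lborel. cnj (f (x - c m *\<^sub>R u)) * complex_of_real (gauss u)))"
      unfolding G_def fst_conv snd_conv by (simp only: integral_mult_right_zero mult.assoc)
    also have "\<dots> = (LINT x|lborel. ftr f x * cnj (ftr f x) * gauss_weight (c m) x)"
      unfolding gauss_weight_convolution[OF if1 c] inner ..
    also have "\<dots> = (LINT x|lborel. complex_of_real ((cmod (ftr f x))\<^sup>2 * gauss_weight (c m) x))"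
      by (simp only: complex_norm_square of_real_mult)
    finally show ?thesis by (simp only: integral_complex_of_real)
  qed
  have iw: "integrable lborel (\<lambda>x. (cmod (ftr f x))\<^sup>2 * gauss_weight (c m) x)" for m
  proof (rule Bochner_Integration.integrable_bound[OF integrable_mult_right[OF gauss_weight_integrable[OF c], of "D\<^sup>2" m]])
    show "AE x in lborel. norm ((cmod (ftr f x))\<^sup>2 * gauss_weight (c m) x) \<le> norm (D\<^sup>2 * gauss_weight (c m) x)"
      using D by (auto simp: gauss_weight_def intro!: mult_right_mono power_mono)
  qed auto
  have "(\<lambda>m. ennreal (LINT x|lborel. (cmod (ftr f x))\<^sup>2 * gauss_weight (c m) x)) \<longlonglongrightarrow> ennreal (LINT x|lborel. (cmod (f x))\<^sup>2)"
    using tendsto_Re[OF conv(3)] unfolding G H by (intro tendsto_ennrealI) simp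
  moreover have "ennreal (LINT x|lborel. (cmod (ftr f x))\<^sup>2 * gauss_weight (c m) x)
      = (\<integral>\<^sup>+x. ennreal ((cmod (ftr f x))\<^sup>2 * gauss_weight (c m) x) \<partial>lborel)" for m
    by (subst nn_integral_eq_integral[OF iw]) (auto simp: gauss_weight_def)
  moreover have "(\<lambda>m. \<integral>\<^sup>+x. ennreal ((cmod (ftr f x))\<^sup>2 * gauss_weight (c m) x) \<partial>lborel)
      \<longlonglongrightarrow> (\<integral>\<^sup>+x. ennreal ((cmod (ftr f x))\<^sup>2) \<partial>lborel)"
  proof (rule nn_integral_LIMSEQ)
    show "incseq (\<lambda>m x. ennreal ((cmod (ftr f x))\<^sup>2 * gauss_weight (c m) x))"
      by (auto simp: incseq_def le_fun_def gauss_weight_def c_def intro!: ennreal_leI mult_left_mono mult_right_mono power_mono divide_left_mono divide_right_mono)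
    show "(\<lambda>m. ennreal ((cmod (ftr f x))\<^sup>2 * gauss_weight (c m) x)) \<longlonglongrightarrow> ennreal ((cmod (ftr f x))\<^sup>2)" for x
    proof -
      have "(\<lambda>m. (cmod (ftr f x))\<^sup>2 * gauss_weight (c m) x) \<longlonglongrightarrow> (cmod (ftr f x))\<^sup>2 * exp (- (2 * pi * 0 * norm x)\<^sup>2 / 2)"
        unfolding gauss_weight_def by (intro tendsto_intros c0) auto
      then show ?thesis by (intro tendsto_ennrealI) simp
    qed
  qed measurable
  ultimately have "(\<integral>\<^sup>+x. ennreal ((cmod (ftr f x))\<^sup>2) \<partial>lborel) = ennreal (LINT x|lborel. (cmod (f x))\<^sup>2)"
    using LIMSEQ_unique by simp
  also have "\<dots> = (\<integral>\<^sup>+x. ennreal ((cmod (f x))\<^sup>2) \<partial>lborel)"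
    by (subst nn_integral_eq_integral[OF if2]) auto
  finally show ?thesis .
qed

section \<open>Square integrable functions over a measure\<close>

text \<open>Stated for an arbitrary measure so that one set of Hilbert space lemmas serves functions
  on the whole space, fields of fibers (\<open>fib\<close>), scalar functions on the torus
  (\<open>tor\<close>) and single fibers (\<open>cnt\<close>).\<close>

definition sqi :: "'a measure \<Rightarrow> ('a \<Rightarrow> complex) set" where
  "sqi M = {f. f \<in> borel_measurable M \<and> integrable M (\<lambda>x. (cmod (f x))\<^sup>2)}"

definition nrm :: "'a measure \<Rightarrow> ('a \<Rightarrow> complex) \<Rightarrow> real" where
  "nrm M f = sqrt (LINT x|M. (cmod (f x))\<^sup>2)"

definition inn :: "'a measure \<Rightarrow> ('a \<Rightarrow> complex) \<Rightarrow> ('a \<Rightarrow> complex) \<Rightarrow> complex" where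
  "inn M f g = (LINT x|M. f x * cnj (g x))"

lemma nrm_nonneg [simp]: "0 \<le> nrm M f"
  by (simp add: nrm_def)

lemma nrm_squared: "(nrm M f)\<^sup>2 = (LINT x|M. (cmod (f x))\<^sup>2)"
  by (simp add: nrm_def)

lemma sqiI:
  assumes "f \<in> borel_measurable M" "(\<integral>\<^sup>+x. ennreal ((cmod (f x))\<^sup>2) \<partial>M) < \<infinity>"
  shows "f \<in> sqi M"
proof -
  have "integrable M (\<lambda>x. (cmod (f x))\<^sup>2)"
    by (rule integrableI_bounded) (use assms in auto)
  then show ?thesis using assms by (simp add: sqi_def)
qed

lemma sqiD:
  assumes "f \<in> sqi M"
  shows "f \<in> borel_measurable M" "integrable M (\<lambda>x. (cmod (f x))\<^sup>2)"
  using assms by (auto simp: sqi_def)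

lemma nn_integral_sqi:
  assumes "f \<in> sqi M"
  shows "(\<integral>\<^sup>+x. ennreal ((cmod (f x))\<^sup>2) \<partial>M) = ennreal ((nrm M f)\<^sup>2)"
  unfolding nrm_squared by (rule nn_integral_eq_integral) (use sqiD[OF assms] in auto)

lemma nrm_leI:
  assumes "f \<in> sqi M" "0 \<le> c" "(\<integral>\<^sup>+x. ennreal ((cmod (f x))\<^sup>2) \<partial>M) \<le> ennreal (c\<^sup>2)"
  shows "nrm M f \<le> c"
proof (rule power2_le_imp_le[OF _ assms(2)])
  show "(nrm M f)\<^sup>2 \<le> c\<^sup>2"
    using assms(3) unfolding nn_integral_sqi[OF assms(1)] by (subst (asm) ennreal_le_iff) auto
qed

lemma sqi_bound:
  assumes "g \<in> sqi M" "f \<in> borel_measurable M" "AE x in M. cmod (f x) \<le> C * cmod (g x)"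
  shows "f \<in> sqi M"
proof -
  have "integrable M (\<lambda>x. (cmod (f x))\<^sup>2)"
  proof (rule Bochner_Integration.integrable_bound[of M "\<lambda>x. C\<^sup>2 * (cmod (g x))\<^sup>2"])
    show "AE x in M. norm ((cmod (f x))\<^sup>2) \<le> norm (C\<^sup>2 * (cmod (g x))\<^sup>2)"
      using assms(3)
    proof eventually_elim
      fix x assume "cmod (f x) \<le> C * cmod (g x)"
      then have "(cmod (f x))\<^sup>2 \<le> (C * cmod (g x))\<^sup>2" by (rule power_mono) simp
      then show "norm ((cmod (f x))\<^sup>2) \<le> norm (C\<^sup>2 * (cmod (g x))\<^sup>2)" by (simp add: power_mult_distrib)
    qed
  qed (use assms sqiD[OF assms(1)] in auto)
  with assms show ?thesis by (simp add: sqi_def)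
qed

lemma nrm_cong:
  assumes "f \<in> borel_measurable M" "g \<in> borel_measurable M" "AE x in M. f x = g x"
  shows "nrm M f = nrm M g"
  unfolding nrm_def by (intro arg_cong[of _ _ sqrt] integral_cong_AE) (use assms in auto)

lemma sqi_scale: "f \<in> sqi M \<Longrightarrow> (\<lambda>x. c * f x) \<in> sqi M"
  by (rule sqi_bound[of f M _ "cmod c"]) (auto simp: norm_mult dest: sqiD)

lemma nrm_scale: "nrm M (\<lambda>x. c * f x) = cmod c * nrm M f"
  by (simp add: nrm_def norm_mult power_mult_distrib real_sqrt_mult)

lemma nrm_minus_commute: "nrm M (\<lambda>x. f x - g x) = nrm M (\<lambda>x. g x - f x)"
  by (simp add: nrm_def norm_minus_commute)

text \<open>The defect is the square \<open>(t * cmod a - cmod b)\<^sup>2 / t\<close>. The weight is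
  kept free because \<open>t = 1\<close> gives closure of \<open>sqi\<close> under sums, while a
  near-optimal \<open>t\<close> gives the triangle inequality.\<close>

lemma cmod_add_squared_le:
  assumes "t > 0"
  shows "(cmod (a + b))\<^sup>2 \<le> (1 + t) * (cmod a)\<^sup>2 + (1 + 1 / t) * (cmod b)\<^sup>2"
proof -
  have "(cmod (a + b))\<^sup>2 \<le> (cmod a + cmod b)\<^sup>2"
    by (intro power_mono norm_triangle_ineq) auto
  also have "\<dots> = (1 + t) * (cmod a)\<^sup>2 + (1 + 1 / t) * (cmod b)\<^sup>2 - (t * cmod a - cmod b)\<^sup>2 / t"
    using assms by (simp add: field_simps power2_eq_square)
  also have "\<dots> \<le> (1 + t) * (cmod a)\<^sup>2 + (1 + 1 / t) * (cmod b)\<^sup>2"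
    using assms by simp
  finally show ?thesis .
qed

lemma sqi_add:
  assumes "f \<in> sqi M" "g \<in> sqi M"
  shows "(\<lambda>x. f x + g x) \<in> sqi M"
proof -
  have "integrable M (\<lambda>x. (cmod (f x + g x))\<^sup>2)"
  proof (rule Bochner_Integration.integrable_bound[of M "\<lambda>x. 2 * (cmod (f x))\<^sup>2 + 2 * (cmod (g x))\<^sup>2"])
    show "AE x in M. norm ((cmod (f x + g x))\<^sup>2) \<le> norm (2 * (cmod (f x))\<^sup>2 + 2 * (cmod (g x))\<^sup>2)"
      using cmod_add_squared_le[of 1 "f x" "g x" for x] by (intro AE_I2) simp
  qed (use sqiD[OF assms(1)] sqiD[OF assms(2)] in auto)
  then show ?thesis using sqiD[OF assms(1)] sqiD[OF assms(2)] by (simp add: sqi_def)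
qed

lemma sqi_diff: "f \<in> sqi M \<Longrightarrow> g \<in> sqi M \<Longrightarrow> (\<lambda>x. f x - g x) \<in> sqi M"
  using sqi_add[OF _ sqi_scale[of g M "-1"]] by simp

lemma sqi_zero [simp]: "(\<lambda>x. 0) \<in> sqi M"
  by (simp add: sqi_def)

lemma nrm_zero [simp]: "nrm M (\<lambda>x. 0) = 0"
  by (simp add: nrm_def)

lemma sqi_sum: "(\<And>i. i \<in> A \<Longrightarrow> f i \<in> sqi M) \<Longrightarrow> (\<lambda>x. \<Sum>i\<in>A. f i x) \<in> sqi M"
  by (induction A rule: infinite_finite_induct) (auto intro: sqi_add)

text \<open>The choice \<open>t = nrm g / nrm f\<close> in the weighted inequality gives Minkowski's inequality; zero
  norms are avoided by adding a small \<open>e\<close>.\<close>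

lemma nrm_triangle:
  assumes f: "f \<in> sqi M" and g: "g \<in> sqi M"
  shows "nrm M (\<lambda>x. f x + g x) \<le> nrm M f + nrm M g"
proof (rule field_le_epsilon)
  fix e :: real assume e: "e > 0"
  define a where "a = nrm M f + e / 2"
  define b where "b = nrm M g + e / 2"
  have ab: "a > 0" "b > 0" using e nrm_nonneg[of M f] nrm_nonneg[of M g] by (simp_all add: a_def b_def del: nrm_nonneg)
  have fa: "(nrm M f)\<^sup>2 \<le> a\<^sup>2" and gb: "(nrm M g)\<^sup>2 \<le> b\<^sup>2"
    using e by (intro power_mono; simp add: a_def b_def)+
  have "(nrm M (\<lambda>x. f x + g x))\<^sup>2 \<le> (LINT x|M. (1 + b/a) * (cmod (f x))\<^sup>2 + (1 + 1/(b/a)) * (cmod (g x))\<^sup>2)"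
    unfolding nrm_squared
  proof (rule integral_mono)
    show "integrable M (\<lambda>x. (cmod (f x + g x))\<^sup>2)" using sqiD[OF sqi_add[OF f g]] by simp
    show "integrable M (\<lambda>x. (1 + b/a) * (cmod (f x))\<^sup>2 + (1 + 1/(b/a)) * (cmod (g x))\<^sup>2)"
      using sqiD[OF f] sqiD[OF g] by simp
  qed (use ab in \<open>intro cmod_add_squared_le, simp\<close>)
  also have "\<dots> = (1 + b/a) * (nrm M f)\<^sup>2 + (1 + 1/(b/a)) * (nrm M g)\<^sup>2"
    unfolding nrm_squared using sqiD[OF f] sqiD[OF g] by simp
  also have "\<dots> \<le> (1 + b/a) * a\<^sup>2 + (1 + 1/(b/a)) * b\<^sup>2"
    using ab fa gb by (intro add_mono mult_left_mono) auto
  also have "\<dots> = (a + b)\<^sup>2" using ab by (simp add: field_simps power2_eq_square)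
  finally have "nrm M (\<lambda>x. f x + g x) \<le> a + b"
    by (rule power2_le_imp_le) (use ab in simp)
  then show "nrm M (\<lambda>x. f x + g x) \<le> nrm M f + nrm M g + e" by (simp add: a_def b_def)
qed

lemma nrm_triangle_diff:
  assumes "f \<in> sqi M" "g \<in> sqi M" "h \<in> sqi M"
  shows "nrm M (\<lambda>x. f x - h x) \<le> nrm M (\<lambda>x. f x - g x) + nrm M (\<lambda>x. g x - h x)"
  using nrm_triangle[OF sqi_diff[OF assms(1,2)] sqi_diff[OF assms(2,3)]] by simp

lemma nrm_diff_le:
  assumes "f \<in> sqi M" "g \<in> sqi M"
  shows "\<bar>nrm M f - nrm M g\<bar> \<le> nrm M (\<lambda>x. f x - g x)"
  using nrm_triangle[OF sqi_diff[OF assms] assms(2)] nrm_triangle[OF sqi_diff[OF assms(2,1)] assms(1)]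
    nrm_minus_commute[of M f g] by simp

lemma nrm_eq_zero_iff:
  assumes "f \<in> sqi M"
  shows "nrm M f = 0 \<longleftrightarrow> (AE x in M. f x = 0)"
  using integral_nonneg_eq_0_iff_AE[of M "\<lambda>x. (cmod (f x))\<^sup>2"] sqiD[OF assms] by (simp add: nrm_def)

lemma nrm_tendsto:
  assumes "\<And>m. g m \<in> sqi M" "f \<in> sqi M" "(\<lambda>m. nrm M (\<lambda>x. g m x - f x)) \<longlonglongrightarrow> 0"
  shows "(\<lambda>m. nrm M (g m)) \<longlonglongrightarrow> nrm M f"
proof (rule LIM_zero_cancel, rule Lim_null_comparison[OF _ assms(3)])
  show "\<forall>\<^sub>F m in sequentially. norm (nrm M (g m) - nrm M f) \<le> nrm M (\<lambda>x. g m x - f x)"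
    using nrm_diff_le[OF assms(1,2)] by simp
qed

lemma nrm_dominated_convergence:
  assumes g: "\<And>m. g m \<in> borel_measurable M" and f: "f \<in> borel_measurable M" and w: "w \<in> sqi M"
    and bd: "\<And>m. AE x in M. cmod (g m x) \<le> cmod (w x)" and lim: "AE x in M. (\<lambda>m. g m x) \<longlonglongrightarrow> f x"
  shows "f \<in> sqi M" "(\<lambda>m. nrm M (\<lambda>x. g m x - f x)) \<longlonglongrightarrow> 0"
proof -
  have fw: "AE x in M. cmod (f x) \<le> cmod (w x)"
  proof -
    have "AE x in M. \<forall>m. cmod (g m x) \<le> cmod (w x)" using bd by (simp add: AE_all_countable)
    with lim show ?thesis
    proof eventually_elim
      case (elim x)
      then show ?case by (intro LIMSEQ_le_const2[OF tendsto_norm]) auto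
    qed
  qed
  then show fs: "f \<in> sqi M" by (intro sqi_bound[OF w f, of 1]) auto
  have "(\<lambda>m. LINT x|M. (cmod (g m x - f x))\<^sup>2) \<longlonglongrightarrow> (LINT x|M. 0)"
  proof (rule integral_dominated_convergence[of _ _ _ "\<lambda>x. 4 * (cmod (w x))\<^sup>2"])
    show "AE x in M. (\<lambda>m. (cmod (g m x - f x))\<^sup>2) \<longlonglongrightarrow> 0"
      using lim
    proof eventually_elim
      case (elim x)
      have "(\<lambda>m. (cmod (g m x - f x))\<^sup>2) \<longlonglongrightarrow> (cmod (f x - f x))\<^sup>2"
        by (intro tendsto_power tendsto_norm tendsto_diff tendsto_const elim)
      then show ?case by simp
    qed
    show "AE x in M. norm ((cmod (g m x - f x))\<^sup>2) \<le> 4 * (cmod (w x))\<^sup>2" for m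
      using fw bd[of m]
    proof eventually_elim
      case (elim x)
      then have "cmod (g m x - f x) \<le> 2 * cmod (w x)"
        using norm_triangle_ineq4[of "g m x" "f x"] by simp
      then have "(cmod (g m x - f x))\<^sup>2 \<le> (2 * cmod (w x))\<^sup>2" by (rule power_mono) simp
      then show ?case by (simp add: power_mult_distrib)
    qed
  qed (use g f sqiD[OF w] in auto)
  then show "(\<lambda>m. nrm M (\<lambda>x. g m x - f x)) \<longlonglongrightarrow> 0"
    unfolding nrm_def using tendsto_real_sqrt by fastforce
qed

text \<open>Riesz-Fischer. Along a fast subsequence the sum of \<open>4 ^ k\<close> times the
  squared increments has finite integral, hence is finite almost everywhere; the increments then
  decay like \<open>(1/2) ^ k\<close> and the subsequence converges pointwise. Fatou's lemma turns
  this into norm convergence of the full sequence.\<close>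

lemma sqi_complete:
  assumes g: "\<And>m. g m \<in> sqi M"
    and cauchy: "\<And>e. e > 0 \<Longrightarrow> \<exists>N. \<forall>m\<ge>N. \<forall>k\<ge>N. nrm M (\<lambda>x. g m x - g k x) < e"
  obtains f where "f \<in> sqi M" "(\<lambda>m. nrm M (\<lambda>x. g m x - f x)) \<longlonglongrightarrow> 0"
proof -
  have [measurable]: "g m \<in> borel_measurable M" for m using sqiD[OF g] by simp
  have "\<exists>N. \<forall>m\<ge>N. \<forall>k\<ge>N. nrm M (\<lambda>x. g m x - g k x) < (1/4) ^ j" for j by (rule cauchy) simp
  then obtain N where N: "\<And>j m k. m \<ge> N j \<Longrightarrow> k \<ge> N j \<Longrightarrow> nrm M (\<lambda>x. g m x - g k x) < (1/4) ^ j"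
    by metis
  \<comment> \<open>Summing all \<open>N j\<close> up to \<open>k\<close> makes \<open>r\<close>
    monotone and at least \<open>N k\<close>; the extra \<open>k\<close> makes \<open>r\<close>
    exceed every given index.\<close>
  define r where "r k = (\<Sum>j\<le>k. N j) + k" for k
  have r: "r (Suc k) \<ge> r k" "r k \<ge> N k" "r k \<ge> k" for k
    by (auto simp: r_def intro: member_le_sum trans_le_add1)
  define h where "h k = g (r k)" for k
  have [measurable]: "h m \<in> borel_measurable M" for m by (simp add: h_def)
  define c where "c k x = cmod (h (Suc k) x - h k x)" for k x
  have [measurable]: "c k \<in> borel_measurable M" for k by (simp add: c_def[abs_def])
  have "(\<integral>\<^sup>+x. (\<Sum>k. ennreal (4^k * (c k x)\<^sup>2)) \<partial>M) = (\<Sum>k. \<integral>\<^sup>+x. ennreal (4^k * (c k x)\<^sup>2) \<partial>M)"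
    by (rule nn_integral_suminf) simp
  also have "\<dots> \<le> (\<Sum>k. ennreal ((1/4)^k))"
  proof (rule suminf_le)
    fix k
    have "(\<integral>\<^sup>+x. ennreal (4^k * (c k x)\<^sup>2) \<partial>M) = ennreal (4^k) * (\<integral>\<^sup>+x. ennreal ((c k x)\<^sup>2) \<partial>M)"
      by (simp add: ennreal_mult nn_integral_cmult)
    also have "\<dots> = ennreal (4^k * (nrm M (\<lambda>x. h (Suc k) x - h k x))\<^sup>2)"
      unfolding c_def h_def by (subst nn_integral_sqi[OF sqi_diff[OF g g]]) (simp add: ennreal_mult)
    also have "\<dots> \<le> ennreal ((1/4)^k)"
    proof (rule ennreal_leI)
      have "nrm M (\<lambda>x. h (Suc k) x - h k x) \<le> (1/4)^k"
        unfolding h_def using N[of k "r (Suc k)" "r k"] r[of k] by simp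
      then have "(nrm M (\<lambda>x. h (Suc k) x - h k x))\<^sup>2 \<le> ((1/4)^k)\<^sup>2" by (rule power_mono) simp
      then have "4^k * (nrm M (\<lambda>x. h (Suc k) x - h k x))\<^sup>2 \<le> 4^k * ((1/4)^k)\<^sup>2" by (rule mult_left_mono) simp
      also have "\<dots> = (1/4::real)^k" by (simp add: power2_eq_square flip: power_mult_distrib)
      finally show "4^k * (nrm M (\<lambda>x. h (Suc k) x - h k x))\<^sup>2 \<le> (1/4)^k" .
    qed
    finally show "(\<integral>\<^sup>+x. ennreal (4^k * (c k x)\<^sup>2) \<partial>M) \<le> ennreal ((1/4)^k)" .
  qed auto
  also have "\<dots> < \<infinity>"
    by (subst suminf_ennreal2) (auto intro: summable_geometric)
  finally have "(\<integral>\<^sup>+x. (\<Sum>k. ennreal (4^k * (c k x)\<^sup>2)) \<partial>M) \<noteq> \<infinity>" by simp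
  then have ae: "AE x in M. (\<Sum>k. ennreal (4^k * (c k x)\<^sup>2)) \<noteq> \<infinity>"
    by (intro nn_integral_PInf_AE) auto
  define f where "f x = lim (\<lambda>k. h k x)" for x
  have [measurable]: "f \<in> borel_measurable M"
    unfolding f_def[abs_def] by (rule borel_measurable_lim_metric) simp
  have lim: "AE x in M. (\<lambda>k. h k x) \<longlonglongrightarrow> f x"
    using ae
  proof eventually_elim
    case (elim x)
    have "summable (\<lambda>k. 4^k * (c k x)\<^sup>2)"
      by (rule summable_suminf_not_top) (use elim in auto)
    then have "(\<lambda>k. 4^k * (c k x)\<^sup>2) \<longlonglongrightarrow> 0" by (rule summable_LIMSEQ_zero)
    then have "Bseq (\<lambda>k. 4^k * (c k x)\<^sup>2)" by (intro convergent_imp_Bseq convergentI)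
    then obtain D where D: "D > 0" "\<And>k. 4^k * (c k x)\<^sup>2 \<le> D"
      unfolding Bseq_def by (auto simp: abs_mult)
    have sum_D: "summable (\<lambda>k. sqrt D * (1/2)^k)" by (intro summable_mult summable_geometric) simp
    have "c k x \<le> sqrt D * (1/2)^k" for k
    proof -
      have "(2^k * c k x)\<^sup>2 \<le> D"
      proof -
        have "(2^k * c k x)\<^sup>2 = (2^k * 2^k) * (c k x)\<^sup>2" by (simp only: power2_eq_square mult_ac)
        also have "(2::real)^k * 2^k = 4^k" by (simp flip: power_mult_distrib)
        finally show ?thesis using D(2)[of k] by (simp only:)
      qed
      then have "2^k * c k x \<le> sqrt D" by (rule real_le_rsqrt)
      then show ?thesis by (simp add: field_simps power_one_over)
    qed
    then have "summable (\<lambda>k. c k x)"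
      by (intro summable_comparison_test'[OF sum_D, of 0]) (auto simp: c_def)
    then have "summable (\<lambda>k. h (Suc k) x - h k x)"
      unfolding c_def by (rule summable_norm_cancel)
    then have "convergent (\<lambda>k. \<Sum>j<k. h (Suc j) x - h j x)"
      by (simp add: summable_iff_convergent)
    then have "convergent (\<lambda>k. h k x - h 0 x)"
      by (simp add: sum_lessThan_telescope[of "\<lambda>k. h k x"])
    from convergent_add[OF this convergent_const[of "h 0 x"]] have "convergent (\<lambda>k. h k x)"
      by simp
    then show ?case unfolding f_def by (simp add: convergent_LIMSEQ_iff)
  qed
  have fatou: "(\<integral>\<^sup>+x. ennreal ((cmod (g m x - f x))\<^sup>2) \<partial>M) \<le> ennreal (((1/4)^j)\<^sup>2)" if m: "m \<ge> N j" for m j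
  proof -
    have "(\<integral>\<^sup>+x. ennreal ((cmod (g m x - f x))\<^sup>2) \<partial>M) = (\<integral>\<^sup>+x. liminf (\<lambda>k. ennreal ((cmod (g m x - h k x))\<^sup>2)) \<partial>M)"
    proof (rule nn_integral_cong_AE)
      show "AE x in M. ennreal ((cmod (g m x - f x))\<^sup>2) = liminf (\<lambda>k. ennreal ((cmod (g m x - h k x))\<^sup>2))"
        using lim
      proof eventually_elim
        case (elim x)
        have "(\<lambda>k. ennreal ((cmod (g m x - h k x))\<^sup>2)) \<longlonglongrightarrow> ennreal ((cmod (g m x - f x))\<^sup>2)"
          by (intro tendsto_ennrealI tendsto_power tendsto_norm tendsto_diff tendsto_const elim)
        then show ?case by (rule lim_imp_Liminf[symmetric, rotated]) simp
      qed
    qed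
    also have "\<dots> \<le> liminf (\<lambda>k. \<integral>\<^sup>+x. ennreal ((cmod (g m x - h k x))\<^sup>2) \<partial>M)"
      by (rule nn_integral_liminf) simp
    also have "\<dots> \<le> ennreal (((1/4)^j)\<^sup>2)"
    proof (rule Liminf_le)
      show "\<forall>\<^sub>F k in sequentially. (\<integral>\<^sup>+x. ennreal ((cmod (g m x - h k x))\<^sup>2) \<partial>M) \<le> ennreal (((1/4)^j)\<^sup>2)"
      proof (rule eventually_sequentiallyI[of "N j"])
        fix k assume "N j \<le> k"
        then have "N j \<le> r k" using r(3)[of k] by simp
        then have "nrm M (\<lambda>x. g m x - h k x) \<le> (1/4)^j" using N[OF m] by (auto simp: h_def less_imp_le)
        then show "(\<integral>\<^sup>+x. ennreal ((cmod (g m x - h k x))\<^sup>2) \<partial>M) \<le> ennreal (((1/4)^j)\<^sup>2)"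
          unfolding h_def by (subst nn_integral_sqi[OF sqi_diff[OF g g]]) (auto intro!: ennreal_leI power_mono)
      qed
    qed simp
    finally show ?thesis .
  qed
  have gf: "(\<lambda>x. g m x - f x) \<in> sqi M" if "m \<ge> N j" for m j
    by (rule sqiI) (use le_less_trans[OF fatou[OF that]] in auto)
  have "(\<lambda>x. g (N 0) x - (g (N 0) x - f x)) \<in> sqi M"
    by (rule sqi_diff[OF g gf[of 0]]) simp
  then have f: "f \<in> sqi M" by simp
  moreover have "(\<lambda>m. nrm M (\<lambda>x. g m x - f x)) \<longlonglongrightarrow> 0"
  proof (rule LIMSEQ_I)
    fix e :: real assume "e > 0"
    then obtain j where j: "(1/4::real)^j < e" using real_arch_pow_inv[of e "1/4"] by auto
    have "norm (nrm M (\<lambda>x. g m x - f x) - 0) < e" if m: "m \<ge> N j" for m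
    proof -
      have "nrm M (\<lambda>x. g m x - f x) \<le> (1/4)^j"
        by (rule nrm_leI[OF sqi_diff[OF g f] _ fatou[OF m]]) simp
      then show ?thesis using j by simp
    qed
    then show "\<exists>no. \<forall>m\<ge>no. norm (nrm M (\<lambda>x. g m x - f x) - 0) < e" by blast
  qed
  ultimately show ?thesis by (rule that)
qed

lemma sqi_mult_integrable:
  assumes f: "f \<in> sqi M" and g: "g \<in> sqi M"
  shows "integrable M (\<lambda>x. f x * cnj (g x))"
proof (rule Bochner_Integration.integrable_bound[of M "\<lambda>x. (cmod (f x))\<^sup>2 + (cmod (g x))\<^sup>2"])
  show "AE x in M. norm (f x * cnj (g x)) \<le> norm ((cmod (f x))\<^sup>2 + (cmod (g x))\<^sup>2)"
  proof (intro AE_I2)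
    fix x
    have "0 \<le> (cmod (f x) - cmod (g x))\<^sup>2 + ((cmod (f x))\<^sup>2 + (cmod (g x))\<^sup>2)" by simp
    then have "cmod (f x) * cmod (g x) \<le> (cmod (f x))\<^sup>2 + (cmod (g x))\<^sup>2"
      by (simp add: power2_diff)
    then show "norm (f x * cnj (g x)) \<le> norm ((cmod (f x))\<^sup>2 + (cmod (g x))\<^sup>2)"
      by (simp add: norm_mult)
  qed
qed (use sqiD[OF f] sqiD[OF g] in auto)

text \<open>Expresses inner products through norms alone. This is how the isometry of
  \<open>\<Gamma>\<close> becomes preservation of inner products in
  \<open>Gamma_inner\<close>.\<close>

lemma polarization:
  assumes f: "f \<in> sqi M" and g: "g \<in> sqi M"
  shows "4 * inn M f g = complex_of_real ((nrm M (\<lambda>x. f x + g x))\<^sup>2) - complex_of_real ((nrm M (\<lambda>x. f x - g x))\<^sup>2)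
    + \<i> * (complex_of_real ((nrm M (\<lambda>x. f x + \<i> * g x))\<^sup>2) - complex_of_real ((nrm M (\<lambda>x. f x - \<i> * g x))\<^sup>2))"
proof -
  have i: "integrable M (\<lambda>x. complex_of_real ((cmod (f x + g x))\<^sup>2))"
    "integrable M (\<lambda>x. complex_of_real ((cmod (f x - g x))\<^sup>2))"
    "integrable M (\<lambda>x. complex_of_real ((cmod (f x + \<i> * g x))\<^sup>2))"
    "integrable M (\<lambda>x. complex_of_real ((cmod (f x - \<i> * g x))\<^sup>2))"
    by (rule integrable_of_real, rule sqiD(2), intro sqi_add sqi_diff sqi_scale f g)+
  have "4 * (a * cnj b) = complex_of_real ((cmod (a + b))\<^sup>2) - complex_of_real ((cmod (a - b))\<^sup>2)
    + \<i> * (complex_of_real ((cmod (a + \<i> * b))\<^sup>2) - complex_of_real ((cmod (a - \<i> * b))\<^sup>2))" for a b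
    unfolding complex_norm_square by (simp add: algebra_simps)
  then have "4 * inn M f g = (LINT x|M. complex_of_real ((cmod (f x + g x))\<^sup>2) - complex_of_real ((cmod (f x - g x))\<^sup>2)
    + \<i> * (complex_of_real ((cmod (f x + \<i> * g x))\<^sup>2) - complex_of_real ((cmod (f x - \<i> * g x))\<^sup>2)))"
    unfolding inn_def by (simp flip: integral_mult_right_zero)
  also have "\<dots> = (LINT x|M. complex_of_real ((cmod (f x + g x))\<^sup>2)) - (LINT x|M. complex_of_real ((cmod (f x - g x))\<^sup>2))
    + \<i> * ((LINT x|M. complex_of_real ((cmod (f x + \<i> * g x))\<^sup>2)) - (LINT x|M. complex_of_real ((cmod (f x - \<i> * g x))\<^sup>2)))"
    using i by (simp only: Bochner_Integration.integral_add Bochner_Integration.integral_diff integral_mult_right_zero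
        Bochner_Integration.integrable_diff integrable_mult_right)
  finally show ?thesis by (simp only: nrm_squared integral_complex_of_real)
qed

section \<open>The Plancherel theorem\<close>

lemma lebesgue_plus:
  fixes a :: "'a::euclidean_space"
  shows lebesgue_measurable_plus: "(+) a \<in> lebesgue \<rightarrow>\<^sub>M lebesgue"
    and lebesgue_distr_plus: "distr lebesgue lebesgue ((+) a) = lebesgue"
proof -
  have e: "(\<lambda>x::'a. a + (\<Sum>j\<in>Basis. (1 * (x \<bullet> j)) *\<^sub>R j)) = (+) a"
    by (simp add: euclidean_representation)
  show "(+) a \<in> lebesgue \<rightarrow>\<^sub>M lebesgue"
    using lebesgue_affine_measurable[of "\<lambda>_::'a. 1" a] unfolding e by simp
  show "distr lebesgue lebesgue ((+) a) = lebesgue"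
    using lebesgue_affine_euclidean[of "\<lambda>_::'a. 1" a] unfolding e by (simp add: density_1)
qed

lemma lebesgue_integral_translate:
  fixes f :: "'a::euclidean_space \<Rightarrow> 'b::{banach,second_countable_topology}"
  shows "f \<in> borel_measurable lebesgue \<Longrightarrow> (\<lambda>x. f (x - a)) \<in> borel_measurable lebesgue"
    and "f \<in> borel_measurable lebesgue \<Longrightarrow> (LINT x|lebesgue. f (x - a)) = (LINT x|lebesgue. f x)"
    and "integrable lebesgue f \<Longrightarrow> integrable lebesgue (\<lambda>x. f (x - a))"
proof -
  have e: "(\<lambda>x. f (x - a)) = (\<lambda>x. f ((+) (- a) x))" by simp
  show "f \<in> borel_measurable lebesgue \<Longrightarrow> (\<lambda>x. f (x - a)) \<in> borel_measurable lebesgue"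
    unfolding e by (rule measurable_compose[OF lebesgue_measurable_plus])
  show "f \<in> borel_measurable lebesgue \<Longrightarrow> (LINT x|lebesgue. f (x - a)) = (LINT x|lebesgue. f x)"
    unfolding e using integral_distr[OF lebesgue_measurable_plus, of f "- a"] by (simp add: lebesgue_distr_plus)
  show "integrable lebesgue f \<Longrightarrow> integrable lebesgue (\<lambda>x. f (x - a))"
    unfolding e using integrable_distr[OF lebesgue_measurable_plus, of "- a" f] by (simp add: lebesgue_distr_plus)
qed

lemma borel_measurable_lebesgueI:
  "f \<in> borel_measurable borel \<Longrightarrow> f \<in> borel_measurable lebesgue"
  by (rule measurable_completion) simp

text \<open>For \<open>R > 0\<close> this is the radial retraction onto the closed disc of radius
  \<open>R\<close>. Being continuous, it bounds approximants without destroying continuity or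
  convergence.\<close>

definition clamp :: "real \<Rightarrow> complex \<Rightarrow> complex" where
  "clamp R z = complex_of_real (R / max R (cmod z)) * z"

lemma clamp:
  assumes "R > 0"
  shows "cmod (clamp R z) \<le> R" "cmod z \<le> R \<Longrightarrow> clamp R z = z" "continuous_on UNIV (clamp R)"
proof -
  show "cmod (clamp R z) \<le> R"
    using assms by (auto simp: clamp_def norm_mult norm_divide max_def divide_simps)
  show "cmod z \<le> R \<Longrightarrow> clamp R z = z" using assms by (auto simp: clamp_def max_def)
  show "continuous_on UNIV (clamp R)"
    unfolding clamp_def using assms by (intro continuous_intros) auto
qed

text \<open>A measurable function is an almost everywhere limit of continuous ones. These are
  clamped to size \<open>R\<close> and multiplied by a continuous cutoff that is 1 on the ball of
  radius \<open>R\<close> and 0 outside radius \<open>R + 1\<close>, so a single bounded function of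
  bounded support dominates in both norms.\<close>

lemma continuous_approx_bounded:
  fixes f :: "'a::euclidean_space \<Rightarrow> complex"
  assumes f: "f \<in> borel_measurable lebesgue" and R: "R > 0"
    and bd: "\<And>x. cmod (f x) \<le> R" and supp: "\<And>x. R < norm x \<Longrightarrow> f x = 0"
  obtains h where "\<And>m. continuous_on UNIV (h m)" "\<And>m x. R + 1 < norm x \<Longrightarrow> h m x = 0"
    "\<And>m. integrable lebesgue (h m)" "\<And>m. h m \<in> sqi lebesgue"
    "(\<lambda>m. LINT x|lebesgue. cmod (h m x - f x)) \<longlonglongrightarrow> 0"
    "(\<lambda>m. nrm lebesgue (\<lambda>x. h m x - f x)) \<longlonglongrightarrow> 0"
proof -
  have "f measurable_on UNIV"
    by (rule lebesgue_measurable_imp_measurable_on[OF f]) simp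
  then obtain N g where N: "negligible N" and g: "\<And>m. continuous_on UNIV (g m)"
    "\<And>x. x \<notin> N \<Longrightarrow> (\<lambda>m. g m x) \<longlonglongrightarrow> f x"
    unfolding measurable_on_def by auto
  define h where "h m x = complex_of_real (max 0 (min 1 (R + 1 - norm x))) * clamp R (g m x)" for m x
  define w where "w = (\<lambda>x::'a. indicator (cball 0 (R + 1)) x *\<^sub>R complex_of_real R)"
  have cont: "continuous_on UNIV (h m)" for m
    unfolding h_def by (intro continuous_intros continuous_on_compose2[OF clamp(3)[OF R]] g) auto
  have meas: "h m \<in> borel_measurable lebesgue" for m
    by (rule borel_measurable_lebesgueI[OF borel_measurable_continuous_onI[OF cont]])
  have w1: "integrable lebesgue w"
    unfolding w_def by (intro integrable_scaleR_left integrable_real_indicator)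
       (use emeasure_bounded_finite[OF bounded_cball[of "0::'a" "R+1"]] in auto)
  have ww: "(cmod (w x))\<^sup>2 = R * cmod (w x)" for x
    using R by (simp add: w_def indicator_def power2_eq_square)
  have w2: "w \<in> sqi lebesgue"
    using w1 by (auto simp: sqi_def ww)
  have hw: "cmod (h m x) \<le> cmod (w x)" for m x
  proof (cases "norm x \<le> R + 1")
    case True
    have "cmod (h m x) = max 0 (min 1 (R + 1 - norm x)) * cmod (clamp R (g m x))"
      by (simp add: h_def norm_mult)
    also have "\<dots> \<le> 1 * R"
      using clamp(1)[OF R] R by (intro mult_mono) auto
    finally show ?thesis using True R by (simp add: w_def indicator_def)
  qed (simp add: h_def)
  have lim: "AE x in lebesgue. (\<lambda>m. h m x) \<longlonglongrightarrow> f x"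
  proof (rule AE_I'[of N])
    show "N \<in> null_sets lebesgue" using N negligible_iff_null_sets by blast
    show "{x \<in> space lebesgue. \<not> (\<lambda>m. h m x) \<longlonglongrightarrow> f x} \<subseteq> N"
    proof (intro subsetI, rule ccontr)
      fix x assume x: "x \<in> {x \<in> space lebesgue. \<not> (\<lambda>m. h m x) \<longlonglongrightarrow> f x}" "x \<notin> N"
      have "(\<lambda>m. clamp R (g m x)) \<longlonglongrightarrow> clamp R (f x)"
        by (rule continuous_on_tendsto_compose[OF clamp(3)[OF R] g(2)[OF x(2)]]) auto
      then have "(\<lambda>m. clamp R (g m x)) \<longlonglongrightarrow> f x" using clamp(2)[OF R bd] by simp
      then have "(\<lambda>m. h m x) \<longlonglongrightarrow> complex_of_real (max 0 (min 1 (R + 1 - norm x))) * f x"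
        unfolding h_def by (rule tendsto_mult_left)
      moreover have "complex_of_real (max 0 (min 1 (R + 1 - norm x))) * f x = f x"
        using supp[of x] by (cases "norm x \<le> R") auto
      ultimately show False using x by simp
    qed
  qed
  show ?thesis
  proof (rule that[of h])
    show "h m x = 0" if "R + 1 < norm x" for m x using that by (simp add: h_def)
    show i: "integrable lebesgue (h m)" for m
      by (rule Bochner_Integration.integrable_bound[OF w1 meas]) (use hw in auto)
    show "h m \<in> sqi lebesgue" for m by (rule sqi_bound[OF w2 meas, where C=1]) (use hw in auto)
    show "(\<lambda>m. nrm lebesgue (\<lambda>x. h m x - f x)) \<longlonglongrightarrow> 0"
      by (rule nrm_dominated_convergence[OF meas f w2 _ lim]) (use hw in auto)
    have "(\<lambda>m. LINT x|lebesgue. cmod (h m x - f x)) \<longlonglongrightarrow> (LINT x|(lebesgue::'a measure). (0::real))"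
    proof (rule integral_dominated_convergence[where w="\<lambda>x. 2 * cmod (w x)"])
      show "AE x in lebesgue. (\<lambda>m. cmod (h m x - f x)) \<longlonglongrightarrow> 0"
        using lim by eventually_elim (use LIM_zero tendsto_norm_zero in blast)
      show "AE x in lebesgue. norm (cmod (h m x - f x)) \<le> 2 * cmod (w x)" for m
      proof (intro AE_I2)
        fix x
        have "cmod (f x) \<le> cmod (w x)"
          using bd[of x] supp[of x] R by (cases "norm x \<le> R") (auto simp: w_def indicator_def)
        then show "norm (cmod (h m x - f x)) \<le> 2 * cmod (w x)"
          using norm_triangle_ineq4[of "h m x" "f x"] hw[of m x] by simp
      qed
    qed (use meas f w1 in auto)
    then show "(\<lambda>m. LINT x|lebesgue. cmod (h m x - f x)) \<longlonglongrightarrow> 0" by simp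
  qed (rule cont)
qed

text \<open>Truncation at level \<open>m + 1\<close> both in the argument and in the value reduces
  to the bounded case. The two norms are controlled by the same approximant: the first gives
  pointwise control of the Fourier transform, the second enters Plancherel.\<close>

lemma continuous_approx:
  fixes f :: "'a::euclidean_space \<Rightarrow> complex"
  assumes f1: "integrable lebesgue f" and f2: "f \<in> sqi lebesgue" and e: "e > 0"
  obtains h R where "continuous_on UNIV h" "\<And>x. R < norm x \<Longrightarrow> h x = 0"
    "integrable lebesgue h" "h \<in> sqi lebesgue"
    "(LINT x|lebesgue. cmod (h x - f x)) < e" "nrm lebesgue (\<lambda>x. h x - f x) < e"
proof -
  have [measurable]: "f \<in> borel_measurable lebesgue" using f1 by auto
  define t where "t m x = (if norm x \<le> real m + 1 \<and> cmod (f x) \<le> real m + 1 then f x else 0)" for m x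
  have normm [measurable]: "norm \<in> borel_measurable lebesgue"
    by (rule borel_measurable_lebesgueI) simp
  have tm [measurable]: "t m \<in> borel_measurable lebesgue" for m
    unfolding t_def[abs_def] by measurable
  have tf: "cmod (t m x) \<le> cmod (f x)" for m x by (simp add: t_def)
  have lim: "(\<lambda>m. t m x) \<longlonglongrightarrow> f x" for x
  proof (rule tendsto_eventually)
    obtain M where "norm x \<le> real M" "cmod (f x) \<le> real M"
      using real_arch_simple[of "max (norm x) (cmod (f x))"] by auto
    then show "\<forall>\<^sub>F m in sequentially. t m x = f x"
      by (intro eventually_sequentiallyI[of M]) (auto simp: t_def)
  qed
  have "(\<lambda>m. nrm lebesgue (\<lambda>x. t m x - f x)) \<longlonglongrightarrow> 0"
    by (rule nrm_dominated_convergence[OF _ _ f2]) (use tf lim in auto)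
  then have l2: "\<forall>\<^sub>F m in sequentially. nrm lebesgue (\<lambda>x. t m x - f x) < e / 2"
    by (rule order_tendstoD) (use e in simp)
  have "(\<lambda>m. LINT x|lebesgue. cmod (t m x - f x)) \<longlonglongrightarrow> (LINT x|(lebesgue::'a measure). (0::real))"
  proof (rule integral_dominated_convergence[where w="\<lambda>x. 2 * cmod (f x)"])
    show "AE x in lebesgue. (\<lambda>m. cmod (t m x - f x)) \<longlonglongrightarrow> 0"
      using lim LIM_zero tendsto_norm_zero by blast
    show "AE x in lebesgue. norm (cmod (t m x - f x)) \<le> 2 * cmod (f x)" for m
      by (intro AE_I2) (simp add: t_def)
  qed (use f1 in auto)
  then have "\<forall>\<^sub>F m in sequentially. (LINT x|lebesgue. cmod (t m x - f x)) < e / 2"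
    by (rule order_tendstoD) (use e in simp)
  with l2 have "\<forall>\<^sub>F m in sequentially. nrm lebesgue (\<lambda>x. t m x - f x) < e / 2 \<and> (LINT x|lebesgue. cmod (t m x - f x)) < e / 2"
    by (rule eventually_conj)
  then obtain m where m: "nrm lebesgue (\<lambda>x. t m x - f x) < e / 2" "(LINT x|lebesgue. cmod (t m x - f x)) < e / 2"
    by (auto simp: eventually_sequentially)
  define R where "R = real m + 1"
  have t1: "integrable lebesgue (t m)"
    by (rule Bochner_Integration.integrable_bound[OF f1 tm]) (use tf in auto)
  have t2: "t m \<in> sqi lebesgue" by (rule sqi_bound[OF f2 tm, where C=1]) (use tf in auto)
  obtain h where h: "\<And>k. continuous_on UNIV (h k)" "\<And>k x. R + 1 < norm x \<Longrightarrow> h k x = 0"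
    "\<And>k. integrable lebesgue (h k)" "\<And>k. h k \<in> sqi lebesgue"
    "(\<lambda>k. LINT x|lebesgue. cmod (h k x - t m x)) \<longlonglongrightarrow> 0"
    "(\<lambda>k. nrm lebesgue (\<lambda>x. h k x - t m x)) \<longlonglongrightarrow> 0"
    by (rule continuous_approx_bounded[OF tm, of R m]) (auto simp: R_def t_def)
  have "\<forall>\<^sub>F k in sequentially. nrm lebesgue (\<lambda>x. h k x - t m x) < e / 2 \<and> (LINT x|lebesgue. cmod (h k x - t m x)) < e / 2"
    by (intro eventually_conj order_tendstoD(2)[OF h(6)] order_tendstoD(2)[OF h(5)]) (use e in auto)
  then obtain k where k: "nrm lebesgue (\<lambda>x. h k x - t m x) < e / 2" "(LINT x|lebesgue. cmod (h k x - t m x)) < e / 2"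
    by (auto simp: eventually_sequentially)
  show ?thesis
  proof (rule that[of "h k" "R + 1"])
    show "nrm lebesgue (\<lambda>x. h k x - f x) < e"
      using nrm_triangle_diff[OF h(4)[of k] t2 f2] k m by simp
    have "(LINT x|lebesgue. cmod (h k x - f x)) \<le> (LINT x|lebesgue. cmod (h k x - t m x) + cmod (t m x - f x))"
      using h(3)[of k] t1 f1 by (intro integral_mono) (auto intro: norm_diff_triangle_le)
    also have "\<dots> = (LINT x|lebesgue. cmod (h k x - t m x)) + (LINT x|lebesgue. cmod (t m x - f x))"
      using h(3)[of k] t1 f1 by (intro Bochner_Integration.integral_add) auto
    finally show "(LINT x|lebesgue. cmod (h k x - f x)) < e" using k m by simp
  qed (use h in auto)
qed

lemma fourier_phase: "fourier f x = (LINT y|lebesgue. f y * phase (y \<bullet> x))"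
  by (simp add: fourier_def phase_def)

lemma phase_lebesgue_measurable [measurable]: "(\<lambda>y. phase (y \<bullet> x)) \<in> borel_measurable lebesgue"
  by (rule borel_measurable_lebesgueI) measurable

lemma fourier_integrand:
  assumes "integrable lebesgue f"
  shows "integrable lebesgue (\<lambda>y. f y * phase (y \<bullet> x))"
  by (rule Bochner_Integration.integrable_bound[OF assms]) (use assms in \<open>auto simp: norm_mult\<close>)

lemma fourier_bound:
  assumes "integrable lebesgue f"
  shows "cmod (fourier f x) \<le> (LINT y|lebesgue. cmod (f y))"
proof -
  have "cmod (fourier f x) \<le> (LINT y|lebesgue. cmod (f y * phase (y \<bullet> x)))"
    unfolding fourier_phase by (rule integral_norm_bound)
  then show ?thesis by (simp add: norm_mult)
qed

lemma fourier_linear: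
  assumes "integrable lebesgue f" "integrable lebesgue g"
  shows "fourier (\<lambda>x. a * f x + b * g x) x = a * fourier f x + b * fourier g x"
  unfolding fourier_phase using fourier_integrand[OF assms(1)] fourier_integrand[OF assms(2)]
  by (simp add: distrib_right mult.assoc)

lemma fourier_diff:
  assumes "integrable lebesgue f" "integrable lebesgue g"
  shows "fourier (\<lambda>x. f x - g x) x = fourier f x - fourier g x"
  using fourier_linear[OF assms, of 1 "-1"] by simp

lemma fourier_borel:
  fixes f :: "real ^ 'k \<Rightarrow> complex"
  assumes f: "integrable lebesgue f"
  shows "fourier f \<in> borel_measurable borel"
proof (rule borel_measurable_continuous_onI, rule continuous_on_sequentiallyI)
  fix u and a :: "real ^ 'k" assume u: "u \<longlonglongrightarrow> a"
  show "(\<lambda>m. fourier f (u m)) \<longlonglongrightarrow> fourier f a"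
    unfolding fourier_phase
  proof (rule integral_dominated_convergence[where w="\<lambda>y. cmod (f y)"])
    show "AE y in lebesgue. (\<lambda>m. f y * phase (y \<bullet> u m)) \<longlonglongrightarrow> f y * phase (y \<bullet> a)"
    proof (intro AE_I2 tendsto_mult_left)
      fix y
      have "continuous_on UNIV phase" using continuous_phase[OF continuous_on_id] .
      then show "(\<lambda>m. phase (y \<bullet> u m)) \<longlonglongrightarrow> phase (y \<bullet> a)"
        by (rule continuous_on_tendsto_compose) (auto intro!: tendsto_intros u)
    qed
  qed (use f fourier_integrand[OF f] in \<open>auto simp: norm_mult\<close>)
qed

lemma fourier_continuous_sqi:
  fixes h :: "real ^ 'k \<Rightarrow> complex"
  assumes "continuous_on UNIV h" "\<And>x. R < norm x \<Longrightarrow> h x = 0" "integrable lebesgue h" "h \<in> sqi lebesgue"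
  shows "fourier h \<in> sqi lborel" "nrm lborel (fourier h) = nrm lebesgue h"
proof -
  have hb: "h \<in> borel_measurable borel" by (rule borel_measurable_continuous_onI[OF assms(1)])
  have "fourier h = ftr h"
    unfolding fourier_phase[abs_def] ftr_def[abs_def]
    by (intro ext integral_completion) (use hb in measurable)
  moreover have "(\<integral>\<^sup>+x. ennreal ((cmod (ftr h x))\<^sup>2) \<partial>lborel) = (\<integral>\<^sup>+x. ennreal ((cmod (h x))\<^sup>2) \<partial>lborel)"
    by (rule plancherel_continuous[OF assms(1,2)])
  ultimately have e: "(\<integral>\<^sup>+x. ennreal ((cmod (fourier h x))\<^sup>2) \<partial>lborel) = ennreal ((nrm lebesgue h)\<^sup>2)"
    using nn_integral_sqi[OF assms(4)] by (simp add: nn_integral_completion)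
  show s: "fourier h \<in> sqi lborel"
    by (rule sqiI) (use fourier_borel[OF assms(3)] e in auto)
  show "nrm lborel (fourier h) = nrm lebesgue h"
    using e unfolding nn_integral_sqi[OF s] by (simp add: power2_eq_iff_nonneg)
qed

text \<open>Convergence of the approximants in the first norm gives pointwise convergence of their
  transforms. Convergence in the second makes the transforms Cauchy, because differences of
  approximants are again continuous with bounded support. Fatou's lemma identifies the norm limit
  with the pointwise one.\<close>

theorem plancherel:
  fixes f :: "real ^ 'k \<Rightarrow> complex"
  assumes f1: "integrable lebesgue f" and f2: "f \<in> sqi lebesgue"
  shows "fourier f \<in> sqi lborel" "nrm lborel (fourier f) = nrm lebesgue f"
proof -
  have "\<exists>h. (\<exists>R. continuous_on UNIV h \<and> (\<forall>x. R < norm x \<longrightarrow> h x = 0)) \<and> integrable lebesgue h \<and> h \<in> sqi lebesgue \<and>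
      (LINT x|lebesgue. cmod (h x - f x)) < e \<and> nrm lebesgue (\<lambda>x. h x - f x) < e" if "e > 0" for e
    by (rule continuous_approx[OF f1 f2 that]) blast
  then have "\<exists>h. \<forall>m::nat. (\<exists>R. continuous_on UNIV (h m) \<and> (\<forall>x. R < norm x \<longrightarrow> h m x = 0)) \<and> integrable lebesgue (h m) \<and> h m \<in> sqi lebesgue \<and>
      (LINT x|lebesgue. cmod (h m x - f x)) < 1 / (real m + 1) \<and> nrm lebesgue (\<lambda>x. h m x - f x) < 1 / (real m + 1)"
    by (intro choice) simp
  then obtain h where H: "\<forall>m::nat. (\<exists>R. continuous_on UNIV (h m) \<and> (\<forall>x. R < norm x \<longrightarrow> h m x = 0)) \<and> integrable lebesgue (h m) \<and> h m \<in> sqi lebesgue \<and>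
      (LINT x|lebesgue. cmod (h m x - f x)) < 1 / (real m + 1) \<and> nrm lebesgue (\<lambda>x. h m x - f x) < 1 / (real m + 1)"
    by (elim exE)
  have h: "\<And>m. \<exists>R. continuous_on UNIV (h m) \<and> (\<forall>x. R < norm x \<longrightarrow> h m x = 0)"
    and h1: "\<And>m. integrable lebesgue (h m)" and h2: "\<And>m. h m \<in> sqi lebesgue"
    and hf1: "\<And>m::nat. (LINT x|lebesgue. cmod (h m x - f x)) < 1 / (real m + 1)"
    and hf2: "\<And>m::nat. nrm lebesgue (\<lambda>x. h m x - f x) < 1 / (real m + 1)"
    using H by blast+
  have z: "(\<lambda>m. 1 / (real m + 1)) \<longlonglongrightarrow> 0" by real_asymp
  have hs: "fourier (h m) \<in> sqi lborel" "nrm lborel (fourier (h m)) = nrm lebesgue (h m)" for m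
  proof -
    obtain R where R: "continuous_on UNIV (h m)" "\<forall>x. R < norm x \<longrightarrow> h m x = 0" using h[of m] by blast
    show "fourier (h m) \<in> sqi lborel" "nrm lborel (fourier (h m)) = nrm lebesgue (h m)"
      by (rule fourier_continuous_sqi[of _ R]; use R h1 h2 in blast)+
  qed
  have hd: "nrm lborel (\<lambda>x. fourier (h m) x - fourier (h k) x) = nrm lebesgue (\<lambda>x. h m x - h k x)" for m k
  proof -
    obtain R1 R2 where R: "continuous_on UNIV (h m)" "\<forall>x. R1 < norm x \<longrightarrow> h m x = 0"
      "continuous_on UNIV (h k)" "\<forall>x. R2 < norm x \<longrightarrow> h k x = 0" using h[of m] h[of k] by blast
    have "nrm lborel (fourier (\<lambda>x. h m x - h k x)) = nrm lebesgue (\<lambda>x. h m x - h k x)"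
      by (rule fourier_continuous_sqi(2)[of _ "max R1 R2"])
        (use R h1 h2 in \<open>auto intro!: continuous_intros sqi_diff\<close>)
    moreover have "fourier (\<lambda>x. h m x - h k x) = (\<lambda>x. fourier (h m) x - fourier (h k) x)"
      by (intro ext fourier_diff h1)
    ultimately show ?thesis by simp
  qed
  have pt: "(\<lambda>m. fourier (h m) x) \<longlonglongrightarrow> fourier f x" for x
  proof (rule LIM_zero_cancel, rule Lim_null_comparison[OF _ z])
    have "norm (fourier (h m) x - fourier f x) \<le> 1 / (real m + 1)" for m
      using fourier_bound[of "\<lambda>x. h m x - f x" x] h1[of m] f1 hf1[of m] fourier_diff[OF h1 f1, of m x] by simp
    then show "\<forall>\<^sub>F m in sequentially. norm (fourier (h m) x - fourier f x) \<le> 1 / (real m + 1)" by simp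
  qed
  have fb [measurable]: "fourier f \<in> borel_measurable borel" "fourier (h m) \<in> borel_measurable borel" for m
    by (intro fourier_borel f1 h1)+
  have fatou: "(\<integral>\<^sup>+x. ennreal ((cmod (fourier (h m) x - fourier f x))\<^sup>2) \<partial>lborel) \<le> ennreal ((2 / (real m + 1))\<^sup>2)" for m
  proof -
    have "(\<integral>\<^sup>+x. ennreal ((cmod (fourier (h m) x - fourier f x))\<^sup>2) \<partial>lborel)
       = (\<integral>\<^sup>+x. liminf (\<lambda>k. ennreal ((cmod (fourier (h m) x - fourier (h k) x))\<^sup>2)) \<partial>lborel)"
    proof (rule nn_integral_cong)
      fix x
      have "(\<lambda>k. ennreal ((cmod (fourier (h m) x - fourier (h k) x))\<^sup>2)) \<longlonglongrightarrow> ennreal ((cmod (fourier (h m) x - fourier f x))\<^sup>2)"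
        by (intro tendsto_ennrealI tendsto_power tendsto_norm tendsto_diff tendsto_const pt)
      then show "ennreal ((cmod (fourier (h m) x - fourier f x))\<^sup>2) = liminf (\<lambda>k. ennreal ((cmod (fourier (h m) x - fourier (h k) x))\<^sup>2))"
        by (rule lim_imp_Liminf[symmetric, rotated]) simp
    qed
    also have "\<dots> \<le> liminf (\<lambda>k. \<integral>\<^sup>+x. ennreal ((cmod (fourier (h m) x - fourier (h k) x))\<^sup>2) \<partial>lborel)"
      by (rule nn_integral_liminf) simp
    also have "\<dots> \<le> ennreal ((2 / (real m + 1))\<^sup>2)"
    proof (rule Liminf_le)
      show "\<forall>\<^sub>F k in sequentially. (\<integral>\<^sup>+x. ennreal ((cmod (fourier (h m) x - fourier (h k) x))\<^sup>2) \<partial>lborel) \<le> ennreal ((2 / (real m + 1))\<^sup>2)"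
      proof (rule eventually_sequentiallyI[of m])
        fix k assume k: "m \<le> k"
        have "nrm lebesgue (\<lambda>x. h m x - h k x) \<le> nrm lebesgue (\<lambda>x. h m x - f x) + nrm lebesgue (\<lambda>x. h k x - f x)"
          using nrm_triangle_diff[OF h2 f2 h2, of m k] nrm_minus_commute[of lebesgue f "h k"] by simp
        also have "\<dots> \<le> 1 / (real m + 1) + 1 / (real k + 1)" using hf2[of m] hf2[of k] by simp
        also have "\<dots> \<le> 2 / (real m + 1)" using k by (simp add: divide_simps)
        finally show "(\<integral>\<^sup>+x. ennreal ((cmod (fourier (h m) x - fourier (h k) x))\<^sup>2) \<partial>lborel) \<le> ennreal ((2 / (real m + 1))\<^sup>2)"
          by (subst nn_integral_sqi[OF sqi_diff[OF hs(1) hs(1)]]) (auto simp: hd intro!: ennreal_leI power_mono)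
      qed
    qed simp
    finally show ?thesis .
  qed
  have "(\<lambda>x. fourier (h 0) x - fourier f x) \<in> sqi lborel"
    by (rule sqiI) (use le_less_trans[OF fatou[of 0]] in auto)
  from sqi_diff[OF hs(1)[of 0] this] show s: "fourier f \<in> sqi lborel" by simp
  have "nrm lborel (\<lambda>x. fourier (h m) x - fourier f x) \<le> 2 / (real m + 1)" for m
    by (rule nrm_leI[OF sqi_diff[OF hs(1) s] _ fatou]) simp
  then have ev: "\<forall>\<^sub>F m in sequentially. norm (nrm lborel (\<lambda>x. fourier (h m) x - fourier f x)) \<le> 2 / (real m + 1)"
    by simp
  have "(\<lambda>m. 2 / (real m + 1)) \<longlonglongrightarrow> 0" by real_asymp
  with ev have "(\<lambda>m. nrm lborel (\<lambda>x. fourier (h m) x - fourier f x)) \<longlonglongrightarrow> 0"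
    by (rule Lim_null_comparison)
  then have "(\<lambda>m. nrm lborel (fourier (h m))) \<longlonglongrightarrow> nrm lborel (fourier f)"
    by (rule nrm_tendsto[OF hs(1) s])
  moreover have "(\<lambda>m. nrm lebesgue (h m)) \<longlonglongrightarrow> nrm lebesgue f"
  proof (rule nrm_tendsto[OF h2 f2])
    show "(\<lambda>m. nrm lebesgue (\<lambda>x. h m x - f x)) \<longlonglongrightarrow> 0"
      by (rule Lim_null_comparison[OF _ z]) (use hf2 in \<open>auto simp: less_imp_le\<close>)
  qed
  ultimately show "nrm lborel (fourier f) = nrm lebesgue f"
    unfolding hs(2) using LIMSEQ_unique by blast
qed

section \<open>Fiberization\<close>

text \<open>Turns the unordered sum in \<open>fiber_normsq\<close> into an integral, so that Tonelli
  applies. Countability gives an increasing exhaustion by finite sets, along which monotone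
  convergence bounds the integral by the supremum of the finite sums.\<close>

lemma infsum_ennreal_nn_integral:
  fixes f :: "'i::countable \<Rightarrow> ennreal"
  shows "(\<Sum>\<^sub>\<infinity>l. f l) = (\<integral>\<^sup>+l. f l \<partial>count_space UNIV)"
proof (rule antisym)
  have S: "(\<Sum>\<^sub>\<infinity>l. f l) = (SUP F\<in>{F. finite F}. sum f F)"
    using nonneg_infsum_complete[of UNIV f] by simp
  have fin: "sum f F = (\<integral>\<^sup>+l. f l * indicator F l \<partial>count_space UNIV)" if "finite F" for F
    using that by (subst nn_integral_count_space'[of F]) (auto simp: indicator_def)
  show "(\<Sum>\<^sub>\<infinity>l. f l) \<le> (\<integral>\<^sup>+l. f l \<partial>count_space UNIV)"
    unfolding S
  proof (rule SUP_least)
    fix F :: "'i set" assume "F \<in> {F. finite F}"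
    then have "sum f F = (\<integral>\<^sup>+l. f l * indicator F l \<partial>count_space UNIV)" by (simp add: fin)
    also have "\<dots> \<le> (\<integral>\<^sup>+l. f l \<partial>count_space UNIV)"
      by (intro nn_integral_mono) (auto simp: indicator_def)
    finally show "sum f F \<le> (\<integral>\<^sup>+l. f l \<partial>count_space UNIV)" .
  qed
  define A where "A n = {l :: 'i. to_nat l < n}" for n
  have A: "finite (A n)" for n
  proof -
    have "A n \<subseteq> from_nat ` {..<n}" by (auto simp: A_def image_iff) (metis from_nat_to_nat lessThan_iff)
    then show ?thesis by (rule finite_subset) simp
  qed
  have "(\<lambda>n. \<integral>\<^sup>+l. f l * indicator (A n) l \<partial>count_space UNIV) \<longlonglongrightarrow> (\<integral>\<^sup>+l. f l \<partial>count_space UNIV)"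
  proof (rule nn_integral_LIMSEQ)
    show "incseq (\<lambda>n l. f l * indicator (A n) l)"
      by (auto simp: incseq_def le_fun_def A_def indicator_def)
    show "(\<lambda>n. f l * indicator (A n) l) \<longlonglongrightarrow> f l" for l
      by (rule tendsto_eventually, rule eventually_sequentiallyI[of "Suc (to_nat l)"]) (auto simp: A_def indicator_def)
  qed auto
  moreover have "(\<integral>\<^sup>+l. f l * indicator (A n) l \<partial>count_space UNIV) \<le> (\<Sum>\<^sub>\<infinity>l. f l)" for n
    unfolding fin[OF A, symmetric] S by (rule SUP_upper) (simp add: A)
  ultimately show "(\<integral>\<^sup>+l. f l \<partial>count_space UNIV) \<le> (\<Sum>\<^sub>\<infinity>l. f l)"
    by (intro LIMSEQ_le_const2) auto
qed

section \<open>The torus as a fundamental domain of the integer lattice\<close>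

abbreviation tor :: "(real ^ 'k) measure" where
  "tor \<equiv> lebesgue_on torus"

lemma torus_borel [measurable]: "(torus :: (real ^ 'k) set) \<in> sets borel"
proof -
  have eq: "torus = (\<Inter>j. {x :: real ^ 'k. - 1/2 \<le> x $ j} \<inter> {x. x $ j < 1/2})"
    by (auto simp: torus_def)
  have cl: "closed {x :: real ^ 'k. - 1/2 \<le> x $ j}" and op: "open {x :: real ^ 'k. x $ j < 1/2}" for j
    by (intro closed_Collect_le open_Collect_less continuous_on_const continuous_on_component continuous_on_id)+
  show ?thesis
    unfolding eq by (intro sets.finite_INT sets.Int borel_closed borel_open cl op) auto
qed

lemma torus_lebesgue [simp]: "(torus :: (real ^ 'k) set) \<in> sets lebesgue"
  using torus_borel by (auto intro: sets_completionI_sets)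

lemma emeasure_torus: "emeasure lborel (torus :: (real ^ 'k) set) < \<infinity>"
proof (rule emeasure_bounded_finite)
  have "torus \<subseteq> cbox (\<chi> j. - 1/2) ((\<chi> j. 1/2) :: real ^ 'k)"
  proof
    fix x :: "real ^ 'k" assume "x \<in> torus"
    then have "- 1/2 \<le> x $ j \<and> x $ j < 1/2" for j by (simp add: torus_def)
    then show "x \<in> cbox (\<chi> j. - 1/2) ((\<chi> j. 1/2) :: real ^ 'k)" by (simp add: mem_box_cart less_imp_le)
  qed
  then show "bounded (torus :: (real ^ 'k) set)" using bounded_cbox bounded_subset by blast
qed

lemma finite_measure_tor: "finite_measure (tor :: (real ^ 'k) measure)"
  by (rule finite_measureI) (use emeasure_torus[where 'k='k] in \<open>auto simp: emeasure_restrict_space space_restrict_space\<close>)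

lemma space_tor [simp]: "space tor = torus"
  by (simp add: space_restrict_space)

lemma AE_tor: "(AE x in tor. P x) \<longleftrightarrow> (AE x in lebesgue. x \<in> torus \<longrightarrow> P x)"
  by (simp add: AE_restrict_space_iff)

lemma nn_integral_tor:
  "(\<integral>\<^sup>+x. f x \<partial>(tor :: (real ^ 'k) measure)) = (\<integral>\<^sup>+x. f x * indicator torus x \<partial>lborel)"
  by (simp add: nn_integral_restrict_space nn_integral_completion)

lemma borel_measurable_torI:
  fixes f :: "real ^ 'k \<Rightarrow> _"
  shows "f \<in> borel_measurable borel \<Longrightarrow> f \<in> borel_measurable tor"
  by (intro measurable_restrict_space1 measurable_completion) simp

lemma nn_integral_lborel_translate:
  fixes f :: "'a::euclidean_space \<Rightarrow> ennreal"
  assumes [measurable]: "f \<in> borel_measurable borel"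
  shows "(\<integral>\<^sup>+x. f (a + x) \<partial>lborel) = (\<integral>\<^sup>+x. f x \<partial>lborel)"
  by (subst (2) lborel_distr_plus[symmetric, of a]) (simp add: nn_integral_distr)

text \<open>The integer translates of the torus partition the space: Tonelli and translation
  invariance leave, for each \<open>x\<close>, the number of translates containing it, which is
  one.\<close>

lemma nn_integral_tiling:
  fixes f :: "real ^ 'k \<Rightarrow> ennreal"
  assumes [measurable]: "f \<in> borel_measurable borel"
  shows "(\<integral>\<^sup>+x. (\<integral>\<^sup>+l. f (x + int_vec l) \<partial>count_space UNIV) \<partial>tor) = (\<integral>\<^sup>+x. f x \<partial>lborel)"
proof -
  let ?c = "count_space (UNIV :: (int ^ 'k) set)"
  have [measurable]: "(\<lambda>x. f (x + a)) \<in> borel_measurable tor" for a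
    by (rule borel_measurable_torI) measurable
  have "(\<integral>\<^sup>+x. (\<integral>\<^sup>+l. f (x + int_vec l) \<partial>?c) \<partial>tor) = (\<integral>\<^sup>+l. (\<integral>\<^sup>+x. f (x + int_vec l) \<partial>tor) \<partial>?c)"
    by (rule nn_integral_count_space_nn_integral) auto
  also have "\<dots> = (\<integral>\<^sup>+l. (\<integral>\<^sup>+x. f x * indicator torus (x - int_vec l) \<partial>lborel) \<partial>?c)"
  proof (rule nn_integral_cong)
    fix l :: "int ^ 'k"
    show "(\<integral>\<^sup>+x. f (x + int_vec l) \<partial>tor) = (\<integral>\<^sup>+x. f x * indicator torus (x - int_vec l) \<partial>lborel)"
      unfolding nn_integral_tor
      by (subst nn_integral_lborel_translate[symmetric, of _ "int_vec l"]) (simp_all add: add.commute)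
  qed
  also have "\<dots> = (\<integral>\<^sup>+x. (\<integral>\<^sup>+l. f x * indicator torus (x - int_vec l) \<partial>?c) \<partial>lborel)"
    by (rule nn_integral_count_space_nn_integral[symmetric]) auto
  also have "\<dots> = (\<integral>\<^sup>+x. f x \<partial>lborel)"
  proof (rule nn_integral_cong)
    fix x :: "real ^ 'k"
    \<comment> \<open>Rounding to the nearest integer, with ties going up. This matches the
      half-open convention of \<open>torus\<close>, which contains \<open>-1/2\<close> but not
      \<open>1/2\<close>.\<close>
    define l0 :: "int ^ 'k" where "l0 = (\<chi> j. \<lfloor>x $ j + 1/2\<rfloor>)"
    have "x - int_vec l \<in> torus \<longleftrightarrow> l = l0" for l
    proof -
      have "- 1/2 \<le> x $ j - real_of_int (l $ j) \<and> x $ j - real_of_int (l $ j) < 1/2 \<longleftrightarrow> \<lfloor>x $ j + 1/2\<rfloor> = l $ j" for j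
        by (subst floor_eq_iff) auto
      then show ?thesis by (auto simp: torus_def int_vec_def l0_def vec_eq_iff)
    qed
    then have "(\<integral>\<^sup>+l. f x * indicator torus (x - int_vec l) \<partial>?c) = (\<integral>\<^sup>+l. f x * indicator {l0} l \<partial>?c)"
      by (intro nn_integral_cong) (simp add: indicator_def)
    also have "\<dots> = f x"
      by (subst nn_integral_count_space'[of "{l0}"]) auto
    finally show "(\<integral>\<^sup>+l. f x * indicator torus (x - int_vec l) \<partial>?c) = f x" .
  qed
  finally show ?thesis .
qed

text \<open>Square integrable functions on the torus with values in square summable sequences are
  treated as scalar functions on this product, so that they form an instance of
  \<open>sqi\<close>.\<close>

definition fib :: "((real ^ 'k) \<times> (int ^ 'k)) measure" where
  "fib = tor \<Otimes>\<^sub>M count_space UNIV"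

lemma sigma_finite_count: "sigma_finite_measure (count_space (UNIV :: (int ^ 'k) set))"
  by (rule sigma_finite_measure_count_space_countable) simp

lemma pair_sigma_finite_fib: "pair_sigma_finite (tor :: (real ^ 'k) measure) (count_space (UNIV :: (int ^ 'k) set))"
  by (intro pair_sigma_finite.intro sigma_finite_count finite_measure.axioms(1) finite_measure_tor)

abbreviation unc :: "('a \<Rightarrow> 'b \<Rightarrow> 'c) \<Rightarrow> 'a \<times> 'b \<Rightarrow> 'c" where
  "unc G \<equiv> (\<lambda>z. G (fst z) (snd z))"

text \<open>The second factor is countable and discrete, so joint measurability is measurability of
  each component, the form used in \<open>fiber_L2\<close>.\<close>

lemma unc_measurable:
  fixes G :: "real ^ 'k \<Rightarrow> int ^ 'k \<Rightarrow> complex"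
  shows "unc G \<in> borel_measurable fib \<longleftrightarrow> (\<forall>l. (\<lambda>x. G x l) \<in> borel_measurable tor)"
proof
  assume G: "unc G \<in> borel_measurable fib"
  show "\<forall>l. (\<lambda>x. G x l) \<in> borel_measurable tor"
  proof
    fix l :: "int ^ 'k"
    have "(\<lambda>x. (x, l)) \<in> tor \<rightarrow>\<^sub>M fib" unfolding fib_def by measurable
    from measurable_compose[OF this G] show "(\<lambda>x. G x l) \<in> borel_measurable tor" by simp
  qed
next
  assume "\<forall>l. (\<lambda>x. G x l) \<in> borel_measurable tor"
  then have "(\<lambda>z. G (fst z) l) \<in> borel_measurable fib" for l
    unfolding fib_def by (intro measurable_compose[OF measurable_fst]) auto
  moreover have "snd \<in> fib \<rightarrow>\<^sub>M count_space (UNIV :: (int ^ 'k) set)"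
    unfolding fib_def by measurable
  ultimately show "unc G \<in> borel_measurable fib"
    by (rule measurable_compose_countable)
qed

lemma fiber_normsq_fib:
  assumes "\<And>l. (\<lambda>x. G x l) \<in> borel_measurable tor"
  shows "fiber_normsq G = (\<integral>\<^sup>+z. ennreal ((cmod (unc G z))\<^sup>2) \<partial>fib)"
proof -
  interpret sigma_finite_measure "count_space (UNIV :: (int ^ 'a) set)" by (rule sigma_finite_count)
  have "unc G \<in> borel_measurable fib" using assms unc_measurable by blast
  then have "(\<lambda>z. ennreal ((cmod (unc G z))\<^sup>2)) \<in> borel_measurable (tor \<Otimes>\<^sub>M count_space UNIV)"
    by (simp add: fib_def)
  from nn_integral_fst[OF this] show ?thesis
    unfolding fiber_normsq_def infsum_ennreal_nn_integral by (simp add: fib_def)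
qed

lemma fiber_L2_iff: "G \<in> fiber_L2 \<longleftrightarrow> unc G \<in> sqi fib"
proof
  assume "G \<in> fiber_L2"
  then show "unc G \<in> sqi fib"
    unfolding fiber_L2_def by (intro sqiI) (auto simp: unc_measurable fiber_normsq_fib)
next
  assume s: "unc G \<in> sqi fib"
  then have m: "(\<lambda>x. G x l) \<in> borel_measurable tor" for l using sqiD(1)[OF s] unc_measurable by blast
  show "G \<in> fiber_L2"
    using nn_integral_sqi[OF s] m by (simp add: fiber_L2_def fiber_normsq_fib)
qed

lemma fiber_normsq_sqi: "unc G \<in> sqi fib \<Longrightarrow> fiber_normsq G = ennreal ((nrm fib (unc G))\<^sup>2)"
  using nn_integral_sqi[of "unc G" fib] unc_measurable[of G] by (subst fiber_normsq_fib) (auto dest: sqiD)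

lemma L2_sqi: "L2 = sqi lebesgue" "L2_norm = nrm lebesgue" "L2_inner = inn lebesgue"
  by (auto simp: L2_def sqi_def L2_norm_def nrm_def L2_inner_def inn_def fun_eq_iff)

section \<open>Existence, uniqueness and isometry of the fiberization map\<close>

definition fourier_fiber :: "(real ^ 'k \<Rightarrow> complex) \<Rightarrow> real ^ 'k \<Rightarrow> int ^ 'k \<Rightarrow> complex" where
  "fourier_fiber f x l = fourier f (x + int_vec l)"

lemma fourier_fiber_sqi:
  assumes f1: "integrable lebesgue f" and f2: "f \<in> sqi lebesgue"
  shows "unc (fourier_fiber f) \<in> sqi fib" "nrm fib (unc (fourier_fiber f)) = nrm lebesgue f"
proof -
  note [measurable] = fourier_borel[OF f1]
  have m: "(\<lambda>x. fourier_fiber f x l) \<in> borel_measurable tor" for l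
    unfolding fourier_fiber_def by (rule borel_measurable_torI) measurable
  have "fiber_normsq (fourier_fiber f) = ennreal ((nrm lebesgue f)\<^sup>2)"
    using nn_integral_tiling[of "\<lambda>x. ennreal ((cmod (fourier f x))\<^sup>2)"]
    unfolding fiber_normsq_def infsum_ennreal_nn_integral fourier_fiber_def
    using nn_integral_sqi[OF plancherel(1)[OF f1 f2]] plancherel(2)[OF f1 f2] by simp
  then have e: "(\<integral>\<^sup>+z. ennreal ((cmod (unc (fourier_fiber f) z))\<^sup>2) \<partial>fib) = ennreal ((nrm lebesgue f)\<^sup>2)"
    by (simp add: fiber_normsq_fib[OF m])
  show s: "unc (fourier_fiber f) \<in> sqi fib"
    by (rule sqiI) (use m e unc_measurable[of "fourier_fiber f"] in auto)
  show "nrm fib (unc (fourier_fiber f)) = nrm lebesgue f"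
    using e unfolding nn_integral_sqi[OF s] by (simp add: power2_eq_iff_nonneg)
qed

text \<open>The extended nonnegative squared norm of the definition and the real norm of
  \<open>sqi fib\<close> tend to zero together. The properties of \<open>is_Gamma\<close> are
  derived from this form, where the triangle inequality is at hand.\<close>

lemma is_Gamma_iff:
  "is_Gamma f G \<longleftrightarrow> unc G \<in> sqi fib \<and>
     (\<exists>g. (\<forall>m. g m \<in> sqi lebesgue \<and> integrable lebesgue (g m)) \<and>
        (\<lambda>m. nrm lebesgue (\<lambda>x. g m x - f x)) \<longlonglongrightarrow> 0 \<and>
        (\<lambda>m. nrm fib (\<lambda>z. unc (fourier_fiber (g m)) z - unc G z)) \<longlonglongrightarrow> 0)"
proof -
  have "(\<lambda>m. fiber_normsq (\<lambda>x l. fourier (g m) (x + int_vec l) - G x l)) \<longlonglongrightarrow> 0 \<longleftrightarrow>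
      (\<lambda>m. nrm fib (\<lambda>z. unc (fourier_fiber (g m)) z - unc G z)) \<longlonglongrightarrow> 0"
    if G: "unc G \<in> sqi fib" and g: "\<And>m. g m \<in> sqi lebesgue \<and> integrable lebesgue (g m)" for g
  proof -
    have s: "unc (\<lambda>x l. fourier_fiber (g m) x l - G x l) \<in> sqi fib" for m
      using g[of m] by (intro sqi_diff fourier_fiber_sqi G) auto
    have "fiber_normsq (\<lambda>x l. fourier (g m) (x + int_vec l) - G x l)
      = ennreal ((nrm fib (\<lambda>z. unc (fourier_fiber (g m)) z - unc G z))\<^sup>2)" for m
      using fiber_normsq_sqi[OF s[of m]] by (simp add: fourier_fiber_def)
    then have "(\<lambda>m. fiber_normsq (\<lambda>x l. fourier (g m) (x + int_vec l) - G x l)) \<longlonglongrightarrow> 0 \<longleftrightarrow>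
       (\<lambda>m. ennreal ((nrm fib (\<lambda>z. unc (fourier_fiber (g m)) z - unc G z))\<^sup>2)) \<longlonglongrightarrow> ennreal 0"
      by simp
    also have "\<dots> \<longleftrightarrow> (\<lambda>m. (nrm fib (\<lambda>z. unc (fourier_fiber (g m)) z - unc G z))\<^sup>2) \<longlonglongrightarrow> 0"
      by (rule tendsto_ennreal_iff) auto
    also have "\<dots> \<longleftrightarrow> (\<lambda>m. nrm fib (\<lambda>z. unc (fourier_fiber (g m)) z - unc G z)) \<longlonglongrightarrow> 0"
    proof
      assume "(\<lambda>m. (nrm fib (\<lambda>z. unc (fourier_fiber (g m)) z - unc G z))\<^sup>2) \<longlonglongrightarrow> 0"
      from tendsto_real_sqrt[OF this] show "(\<lambda>m. nrm fib (\<lambda>z. unc (fourier_fiber (g m)) z - unc G z)) \<longlonglongrightarrow> 0" by simp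
    next
      assume "(\<lambda>m. nrm fib (\<lambda>z. unc (fourier_fiber (g m)) z - unc G z)) \<longlonglongrightarrow> 0"
      from tendsto_power[OF this, of 2] show "(\<lambda>m. (nrm fib (\<lambda>z. unc (fourier_fiber (g m)) z - unc G z))\<^sup>2) \<longlonglongrightarrow> 0" by simp
    qed
    finally show ?thesis .
  qed
  then show ?thesis
    unfolding is_Gamma_def fiber_L2_iff L2_tendsto_def L2_sqi by blast
qed

lemma is_Gamma_isometry:
  assumes f: "f \<in> sqi lebesgue" and G: "is_Gamma f G"
  shows "nrm fib (unc G) = nrm lebesgue f"
proof -
  from G obtain g where s: "unc G \<in> sqi fib" and g: "\<forall>m. g m \<in> sqi lebesgue \<and> integrable lebesgue (g m)"
    and gf: "(\<lambda>m. nrm lebesgue (\<lambda>x. g m x - f x)) \<longlonglongrightarrow> 0"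
    and gG: "(\<lambda>m. nrm fib (\<lambda>z. unc (fourier_fiber (g m)) z - unc G z)) \<longlonglongrightarrow> 0"
    unfolding is_Gamma_iff by blast
  have "(\<lambda>m. nrm lebesgue (g m)) \<longlonglongrightarrow> nrm lebesgue f"
    by (rule nrm_tendsto[OF _ f gf]) (use g in auto)
  moreover have "(\<lambda>m. nrm fib (unc (fourier_fiber (g m)))) \<longlonglongrightarrow> nrm fib (unc G)"
    by (rule nrm_tendsto[OF _ s gG]) (use g fourier_fiber_sqi in auto)
  moreover have "nrm fib (unc (fourier_fiber (g m))) = nrm lebesgue (g m)" for m
    using g fourier_fiber_sqi(2) by auto
  ultimately show ?thesis using LIMSEQ_unique by auto
qed

lemma is_Gamma_linear:
  assumes f: "f \<in> sqi lebesgue" "is_Gamma f G" and h: "h \<in> sqi lebesgue" "is_Gamma h H"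
  shows "is_Gamma (\<lambda>x. a * f x + b * h x) (\<lambda>x l. a * G x l + b * H x l)"
proof -
  from f obtain g where G: "unc G \<in> sqi fib" and g: "\<forall>m. g m \<in> sqi lebesgue \<and> integrable lebesgue (g m)"
    and gf: "(\<lambda>m. nrm lebesgue (\<lambda>x. g m x - f x)) \<longlonglongrightarrow> 0"
    and gG: "(\<lambda>m. nrm fib (\<lambda>z. unc (fourier_fiber (g m)) z - unc G z)) \<longlonglongrightarrow> 0"
    unfolding is_Gamma_iff by blast
  from h obtain k where H: "unc H \<in> sqi fib" and k: "\<forall>m. k m \<in> sqi lebesgue \<and> integrable lebesgue (k m)"
    and kf: "(\<lambda>m. nrm lebesgue (\<lambda>x. k m x - h x)) \<longlonglongrightarrow> 0"
    and kH: "(\<lambda>m. nrm fib (\<lambda>z. unc (fourier_fiber (k m)) z - unc H z)) \<longlonglongrightarrow> 0"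
    unfolding is_Gamma_iff by blast
  \<comment> \<open>Stated for an arbitrary measure because it is applied once to the functions
    themselves and once to their fibers.\<close>
  have comb: "(\<lambda>m. nrm M (\<lambda>x. (a * u m x + b * v m x) - (a * U x + b * V x))) \<longlonglongrightarrow> 0"
    if "\<And>m. u m \<in> sqi M" "\<And>m. v m \<in> sqi M" "U \<in> sqi M" "V \<in> sqi M"
      "(\<lambda>m. nrm M (\<lambda>x. u m x - U x)) \<longlonglongrightarrow> 0" "(\<lambda>m. nrm M (\<lambda>x. v m x - V x)) \<longlonglongrightarrow> 0"
    for M :: "'z measure" and u v U V
  proof (rule Lim_null_comparison)
    have "nrm M (\<lambda>x. (a * u m x + b * v m x) - (a * U x + b * V x))
        \<le> cmod a * nrm M (\<lambda>x. u m x - U x) + cmod b * nrm M (\<lambda>x. v m x - V x)" for m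
    proof -
      have "nrm M (\<lambda>x. a * (u m x - U x) + b * (v m x - V x)) \<le> nrm M (\<lambda>x. a * (u m x - U x)) + nrm M (\<lambda>x. b * (v m x - V x))"
        by (intro nrm_triangle sqi_scale sqi_diff that)
      moreover have "(\<lambda>x. a * (u m x - U x) + b * (v m x - V x)) = (\<lambda>x. (a * u m x + b * v m x) - (a * U x + b * V x))"
        by (simp add: algebra_simps fun_eq_iff)
      ultimately show ?thesis unfolding nrm_scale by (simp only:)
    qed
    then show "\<forall>\<^sub>F m in sequentially. norm (nrm M (\<lambda>x. (a * u m x + b * v m x) - (a * U x + b * V x)))
        \<le> cmod a * nrm M (\<lambda>x. u m x - U x) + cmod b * nrm M (\<lambda>x. v m x - V x)" by simp
    show "(\<lambda>m. cmod a * nrm M (\<lambda>x. u m x - U x) + cmod b * nrm M (\<lambda>x. v m x - V x)) \<longlonglongrightarrow> 0"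
      using tendsto_add[OF tendsto_mult_right_zero[OF that(5)] tendsto_mult_right_zero[OF that(6)]] by simp
  qed
  have ff: "fourier_fiber (\<lambda>x. a * g m x + b * k m x) = (\<lambda>x l. a * fourier_fiber (g m) x l + b * fourier_fiber (k m) x l)" for m
    using g k by (auto simp: fourier_fiber_def fun_eq_iff intro!: fourier_linear)
  show ?thesis
    unfolding is_Gamma_iff
  proof (intro conjI exI[of _ "\<lambda>m x. a * g m x + b * k m x"] allI)
    show "unc (\<lambda>x l. a * G x l + b * H x l) \<in> sqi fib" by (intro sqi_add sqi_scale G H)
    show "(\<lambda>x. a * g m x + b * k m x) \<in> sqi lebesgue" for m using g k by (intro sqi_add sqi_scale) auto
    show "integrable lebesgue (\<lambda>x. a * g m x + b * k m x)" for m using g k by auto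
    show "(\<lambda>m. nrm lebesgue (\<lambda>x. a * g m x + b * k m x - (a * f x + b * h x))) \<longlonglongrightarrow> 0"
      by (rule comb) (use g k f h gf kf in auto)
    show "(\<lambda>m. nrm fib (\<lambda>z. unc (fourier_fiber (\<lambda>x. a * g m x + b * k m x)) z - unc (\<lambda>x l. a * G x l + b * H x l) z)) \<longlonglongrightarrow> 0"
      unfolding ff by (rule comb) (use g k G H gG kH fourier_fiber_sqi in auto)
  qed
qed

text \<open>Restriction to balls makes \<open>f\<close> integrable, since
  \<open>t \<le> 1 + t\<^sup>2\<close> bounds the restriction by an integrable function. By isometry
  the fibers of the restrictions form a Cauchy sequence, and completeness supplies the
  limit.\<close>

lemma is_Gamma_exists:
  fixes f :: "real ^ 'k \<Rightarrow> complex"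
  assumes f: "f \<in> sqi lebesgue"
  shows "\<exists>G. is_Gamma f G"
proof -
  have [measurable]: "f \<in> borel_measurable lebesgue" using sqiD[OF f] by simp
  define g where "g m x = indicator (cball 0 (real m)) x *\<^sub>R f x" for m x
  have [measurable]: "g m \<in> borel_measurable lebesgue" for m
    unfolding g_def[abs_def] by (intro borel_measurable_scaleR borel_measurable_indicator) auto
  have gf: "cmod (g m x) \<le> cmod (f x)" for m x by (simp add: g_def indicator_def)
  have g2: "g m \<in> sqi lebesgue" for m by (rule sqi_bound[OF f, where C=1]) (use gf in auto)
  have g1: "integrable lebesgue (g m)" for m
  proof (rule Bochner_Integration.integrable_bound[of lebesgue "\<lambda>x. indicator (cball (0::real^'k) (real m)) x + (cmod (g m x))\<^sup>2"])
    have "integrable lebesgue (indicator (cball (0::real^'k) (real m)) :: _ \<Rightarrow> real)"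
      using emeasure_bounded_finite[OF bounded_cball[of "0::real^'k" "real m"]] by (intro integrable_real_indicator) auto
    then show "integrable lebesgue (\<lambda>x. indicator (cball (0::real^'k) (real m)) x + (cmod (g m x))\<^sup>2)"
      using sqiD(2)[OF g2] by (rule Bochner_Integration.integrable_add)
    have "t \<le> 1 + t\<^sup>2" for t :: real
      using zero_le_power2[of "t - 1/2"] by (simp add: power2_eq_square algebra_simps)
    then show "AE x in lebesgue. norm (g m x) \<le> norm (indicator (cball (0::real^'k) (real m)) x + (cmod (g m x))\<^sup>2)"
      by (intro AE_I2) (auto simp: g_def indicator_def)
  qed measurable
  have lim: "(\<lambda>m. nrm lebesgue (\<lambda>x. g m x - f x)) \<longlonglongrightarrow> 0"
  proof (rule nrm_dominated_convergence[OF _ _ f])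
    show "AE x in lebesgue. (\<lambda>m. g m x) \<longlonglongrightarrow> f x"
    proof (intro AE_I2 tendsto_eventually)
      fix x :: "real ^ 'k"
      obtain M where "norm x \<le> real M" using real_arch_simple by blast
      then show "\<forall>\<^sub>F m in sequentially. g m x = f x"
        by (intro eventually_sequentiallyI[of M]) (auto simp: g_def)
    qed
  qed (use gf in auto)
  have d: "nrm fib (\<lambda>z. unc (fourier_fiber (g m)) z - unc (fourier_fiber (g k)) z) = nrm lebesgue (\<lambda>x. g m x - g k x)" for m k
  proof -
    have "fourier_fiber (\<lambda>x. g m x - g k x) = (\<lambda>x l. fourier_fiber (g m) x l - fourier_fiber (g k) x l)"
      by (simp add: fourier_fiber_def fun_eq_iff fourier_diff g1)
    then show ?thesis
      using fourier_fiber_sqi(2)[of "\<lambda>x. g m x - g k x"] g1 sqi_diff[OF g2 g2] by simp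
  qed
  obtain G where G: "G \<in> sqi fib" "(\<lambda>m. nrm fib (\<lambda>z. unc (fourier_fiber (g m)) z - G z)) \<longlonglongrightarrow> 0"
  proof (rule sqi_complete)
    show "unc (fourier_fiber (g m)) \<in> sqi fib" for m by (rule fourier_fiber_sqi[OF g1 g2])
    fix e :: real assume e: "e > 0"
    have "\<forall>\<^sub>F m in sequentially. nrm lebesgue (\<lambda>x. g m x - f x) < e / 2"
      by (rule order_tendstoD(2)[OF lim]) (use e in simp)
    then obtain N where N: "\<And>m. m \<ge> N \<Longrightarrow> nrm lebesgue (\<lambda>x. g m x - f x) < e / 2"
      by (auto simp: eventually_sequentially)
    have "nrm lebesgue (\<lambda>x. g m x - g k x) < e" if "m \<ge> N" "k \<ge> N" for m k
      using nrm_triangle_diff[OF g2 f g2, of m k] nrm_minus_commute[of lebesgue f "g k"] N[OF that(1)] N[OF that(2)] by simp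
    then show "\<exists>N. \<forall>m\<ge>N. \<forall>k\<ge>N. nrm fib (\<lambda>z. unc (fourier_fiber (g m)) z - unc (fourier_fiber (g k)) z) < e"
      unfolding d by blast
  qed
  have "is_Gamma f (\<lambda>x l. G (x, l))"
    unfolding is_Gamma_iff using G g1 g2 lim by auto
  then show ?thesis by blast
qed

lemma is_Gamma_Gamma: "f \<in> sqi lebesgue \<Longrightarrow> is_Gamma f (\<Gamma> f)"
  unfolding \<Gamma>_def by (rule someI_ex[OF is_Gamma_exists])

lemma Gamma_sqi: "f \<in> sqi lebesgue \<Longrightarrow> unc (\<Gamma> f) \<in> sqi fib"
  using is_Gamma_Gamma by (auto simp: is_Gamma_iff)

lemma Gamma_isometry: "f \<in> sqi lebesgue \<Longrightarrow> nrm fib (unc (\<Gamma> f)) = nrm lebesgue f"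
  using is_Gamma_isometry is_Gamma_Gamma by blast

lemma AE_fib:
  fixes P :: "real ^ 'k \<Rightarrow> int ^ 'k \<Rightarrow> bool"
  assumes "AE z in fib. P (fst z) (snd z)"
  shows "AE x in tor. \<forall>l. P x l"
proof -
  interpret pair_sigma_finite "tor :: (real ^ 'k) measure" "count_space (UNIV :: (int ^ 'k) set)"
    by (rule pair_sigma_finite_fib)
  show ?thesis
    using AE_pair[OF assms[unfolded fib_def]] by (simp add: AE_count_space)
qed

text \<open>\<open>G - H\<close> is a fiberization of the zero function, so by isometry its norm is
  zero.\<close>

lemma is_Gamma_unique:
  assumes f: "f \<in> sqi lebesgue" and G: "is_Gamma f G" and H: "is_Gamma f H"
  shows "AE x in tor. G x = H x"
proof -
  have "is_Gamma (\<lambda>x. 1 * f x + (-1) * f x) (\<lambda>x l. 1 * G x l + (-1) * H x l)"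
    by (rule is_Gamma_linear[OF f G f H])
  from is_Gamma_isometry[OF _ this] have "nrm fib (unc (\<lambda>x l. G x l - H x l)) = 0"
    by simp
  moreover have "unc (\<lambda>x l. G x l - H x l) \<in> sqi fib"
    using G H by (intro sqi_diff) (auto simp: is_Gamma_iff)
  ultimately have "AE z in fib. G (fst z) (snd z) = H (fst z) (snd z)"
    by (subst (asm) nrm_eq_zero_iff) auto
  from AE_fib[OF this] show ?thesis by (simp add: fun_eq_iff)
qed

lemma Gamma_eqI: "f \<in> sqi lebesgue \<Longrightarrow> is_Gamma f G \<Longrightarrow> AE x in tor. \<Gamma> f x = G x"
  using is_Gamma_unique is_Gamma_Gamma by blast

lemma Gamma_linear:
  assumes "f \<in> sqi lebesgue" "g \<in> sqi lebesgue"
  shows "AE x in tor. \<Gamma> (\<lambda>y. a * f y + b * g y) x = (\<lambda>l. a * \<Gamma> f x l + b * \<Gamma> g x l)"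
  by (rule Gamma_eqI) (auto intro!: sqi_add sqi_scale is_Gamma_linear is_Gamma_Gamma assms)

lemma translation_sqi:
  assumes "f \<in> sqi lebesgue"
  shows "translation y f \<in> sqi lebesgue" "nrm lebesgue (translation y f) = nrm lebesgue f"
  using lebesgue_integral_translate(1)[of f y] lebesgue_integral_translate(2,3)[of "\<lambda>x. (cmod (f x))\<^sup>2" y] sqiD[OF assms]
  by (auto simp: translation_def sqi_def nrm_def)

lemma phase_int: "phase (int_vec l \<bullet> int_vec m) = 1"
proof -
  have "int_vec l \<bullet> int_vec m = real_of_int (\<Sum>j\<in>UNIV. l $ j * m $ j)"
    by (simp add: inner_vec_def int_vec_def)
  then have "phase (int_vec l \<bullet> int_vec m) = exp (2 * of_int (- (\<Sum>j\<in>UNIV. l $ j * m $ j)) * pi * \<i>)"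
    by (simp add: phase_def mult_ac)
  then show ?thesis by (simp only: exp_two_pi_i' exp_integer_2pi[OF Ints_of_int])
qed

lemma fourier_translation:
  assumes "integrable lebesgue f"
  shows "fourier (translation a f) x = phase (a \<bullet> x) * fourier f x"
proof -
  have "fourier (translation a f) x = (LINT y|lebesgue. f (y - a) * phase ((y - a) \<bullet> x) * phase (a \<bullet> x))"
    unfolding fourier_phase translation_def by (simp add: inner_diff_left mult.assoc flip: phase_add)
  also have "\<dots> = (LINT y|lebesgue. f y * phase (y \<bullet> x) * phase (a \<bullet> x))"
    using lebesgue_integral_translate(2)[of "\<lambda>y. f y * phase (y \<bullet> x) * phase (a \<bullet> x)" a] assms by simp
  finally show ?thesis by (simp add: fourier_phase)
qed

text \<open>For an integer vector \<open>a\<close> the phase of \<open>a\<close> against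
  \<open>x + l\<close> does not depend on \<open>l\<close>. Translation by \<open>a\<close>
  therefore acts on each fiber as a single scalar of modulus one.\<close>

lemma is_Gamma_translation:
  assumes f: "f \<in> sqi lebesgue" and G: "is_Gamma f G"
  shows "is_Gamma (translation (int_vec a) f) (\<lambda>x l. phase (int_vec a \<bullet> x) * G x l)"
proof -
  from G obtain g where s: "unc G \<in> sqi fib" and g: "\<forall>m. g m \<in> sqi lebesgue \<and> integrable lebesgue (g m)"
    and gf: "(\<lambda>m. nrm lebesgue (\<lambda>x. g m x - f x)) \<longlonglongrightarrow> 0"
    and gG: "(\<lambda>m. nrm fib (\<lambda>z. unc (fourier_fiber (g m)) z - unc G z)) \<longlonglongrightarrow> 0"
    unfolding is_Gamma_iff by blast
  have ff: "fourier_fiber (translation (int_vec a) (g m)) x l = phase (int_vec a \<bullet> x) * fourier_fiber (g m) x l" for m x l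
    using g by (simp add: fourier_fiber_def fourier_translation inner_add_right phase_add phase_int)
  have pm: "(\<lambda>x. phase (int_vec a \<bullet> x)) \<in> borel_measurable tor"
    by (rule borel_measurable_torI) measurable
  then have [measurable]: "(\<lambda>z. phase (int_vec a \<bullet> fst z)) \<in> borel_measurable fib"
    using measurable_compose[OF measurable_fst, of "\<lambda>x. phase (int_vec a \<bullet> x)" tor borel] by (simp add: fib_def)
  have [measurable]: "unc G \<in> borel_measurable fib" using sqiD[OF s] by simp
  have n: "nrm fib (\<lambda>z. phase (int_vec a \<bullet> fst z) * u z) = nrm fib u" for u
    by (simp add: nrm_def norm_mult)
  show ?thesis
    unfolding is_Gamma_iff
  proof (intro conjI exI[of _ "\<lambda>m. translation (int_vec a) (g m)"] allI)
    show "unc (\<lambda>x l. phase (int_vec a \<bullet> x) * G x l) \<in> sqi fib"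
      by (rule sqi_bound[OF s, where C=1]) (auto simp: norm_mult)
    show "translation (int_vec a) (g m) \<in> sqi lebesgue" for m using g translation_sqi by blast
    show "integrable lebesgue (translation (int_vec a) (g m))" for m
      using g lebesgue_integral_translate(3)[of "g m" "int_vec a"] by (simp add: translation_def)
    have "nrm lebesgue (\<lambda>x. translation (int_vec a) (g m) x - translation (int_vec a) f x) = nrm lebesgue (\<lambda>x. g m x - f x)" for m
      using translation_sqi(2)[OF sqi_diff[of "g m" lebesgue f], of "int_vec a"] g f by (simp add: translation_def)
    then show "(\<lambda>m. nrm lebesgue (\<lambda>x. translation (int_vec a) (g m) x - translation (int_vec a) f x)) \<longlonglongrightarrow> 0"
      using gf by simp
    show "(\<lambda>m. nrm fib (\<lambda>z. unc (fourier_fiber (translation (int_vec a) (g m))) z - unc (\<lambda>x l. phase (int_vec a \<bullet> x) * G x l) z)) \<longlonglongrightarrow> 0"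
      using gG by (simp add: ff n flip: right_diff_distrib)
  qed
qed

lemma Gamma_translation:
  assumes "f \<in> sqi lebesgue"
  shows "AE x in tor. \<Gamma> (translation (int_vec a) f) x = (\<lambda>l. phase (int_vec a \<bullet> x) * \<Gamma> f x l)"
  by (rule Gamma_eqI) (auto intro: translation_sqi is_Gamma_translation is_Gamma_Gamma assms)

lemma Gamma_inner:
  assumes f: "f \<in> sqi lebesgue" and g: "g \<in> sqi lebesgue"
    and G: "is_Gamma f G" and H: "is_Gamma g H"
  shows "inn lebesgue f g = inn fib (unc G) (unc H)"
proof -
  have lin: "nrm lebesgue (\<lambda>x. f x + b * g x) = nrm fib (\<lambda>z. unc G z + b * unc H z)" for b
    using is_Gamma_isometry[OF _ is_Gamma_linear[OF f G g H, of 1 b]] sqi_add[OF f sqi_scale[OF g]] by simp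
  have s: "unc G \<in> sqi fib" "unc H \<in> sqi fib" using G H by (auto simp: is_Gamma_iff)
  have "4 * inn lebesgue f g = 4 * inn fib (unc G) (unc H)"
    unfolding polarization[OF f g] polarization[OF s]
    using lin[of 1] lin[of "-1"] lin[of "\<i>"] lin[of "-\<i>"] by simp
  then show ?thesis by simp
qed

section \<open>Multipliers of shift invariant spaces\<close>

lemma AE_fib_iff:
  fixes P :: "real ^ 'k \<Rightarrow> int ^ 'k \<Rightarrow> bool"
  shows "(AE z in fib. P (fst z) (snd z)) \<longleftrightarrow> (AE x in tor. \<forall>l. P x l)"
proof
  interpret pair_sigma_finite "tor :: (real ^ 'k) measure" "count_space (UNIV :: (int ^ 'k) set)"
    by (rule pair_sigma_finite_fib)
  assume "AE x in tor. \<forall>l. P x l"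
  then obtain N where N: "{x \<in> space tor. \<not> (\<forall>l. P x l)} \<subseteq> N" "N \<in> null_sets tor"
    by (auto elim!: AE_E simp: null_sets_def)
  have "N \<times> UNIV \<in> null_sets (fib :: ((real ^ 'k) \<times> (int ^ 'k)) measure)"
    using N(2) M2.emeasure_pair_measure_Times[of N tor UNIV] by (auto simp: null_sets_def fib_def)
  then show "AE z in fib. P (fst z) (snd z)"
    by (rule AE_I') (use N(1) in \<open>fastforce simp: fib_def space_pair_measure\<close>)
qed (rule AE_fib)

lemma shift_invariant_sqi: "shift_invariant W \<Longrightarrow> f \<in> W \<Longrightarrow> f \<in> sqi lebesgue"
  by (auto simp: shift_invariant_def L2_sqi)

lemma shift_invariant_linear:
  assumes "shift_invariant W" "f \<in> W" "g \<in> W"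
  shows "(\<lambda>x. a * f x + b * g x) \<in> W"
proof -
  have W: "cfun.subspace W" using assms(1) by (simp add: shift_invariant_def)
  have "(\<lambda>x. a * f x) + (\<lambda>x. b * g x) \<in> W"
    by (intro cfun.subspace_add[OF W] cfun.subspace_scale[OF W] assms)
  then show ?thesis by (simp add: plus_fun_def)
qed

lemma shift_invariant_closed:
  assumes "shift_invariant W" "\<And>m. g m \<in> W" "f \<in> sqi lebesgue" "(\<lambda>m. nrm lebesgue (\<lambda>x. g m x - f x)) \<longlonglongrightarrow> 0"
  shows "f \<in> W"
proof -
  have "f \<in> L2_closure W" using assms by (auto simp: L2_closure_def L2_tendsto_def L2_sqi)
  then show ?thesis using assms(1) by (auto simp: shift_invariant_def)
qed

lemma shift_invariant_translation:
  "shift_invariant W \<Longrightarrow> f \<in> W \<Longrightarrow> translation (int_vec l) f \<in> W"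
  by (auto simp: shift_invariant_def)

lemma Gamma_diff_nrm:
  assumes f: "f \<in> sqi lebesgue" and g: "g \<in> sqi lebesgue"
  shows "nrm fib (\<lambda>z. unc (\<Gamma> f) z - unc (\<Gamma> g) z) = nrm lebesgue (\<lambda>x. f x - g x)"
  using is_Gamma_isometry[OF _ is_Gamma_linear[OF f is_Gamma_Gamma[OF f] g is_Gamma_Gamma[OF g], of 1 "-1"]] sqi_diff[OF f g]
  by simp

text \<open>By isometry the preimages \<open>g m\<close> are Cauchy, hence converge to some
  \<open>f\<close>, which lies in \<open>W\<close> because \<open>W\<close> is closed. The fibers of
  \<open>f\<close> and the given limit \<open>G\<close> are both limits of the same
  sequence.\<close>

lemma Gamma_image_closed:
  assumes W: "shift_invariant W" and g: "\<And>m. g m \<in> W" and G: "unc G \<in> sqi fib"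
    and lim: "(\<lambda>m. nrm fib (\<lambda>z. unc (\<Gamma> (g m)) z - unc G z)) \<longlonglongrightarrow> 0"
  shows "\<exists>f\<in>W. AE x in tor. \<Gamma> f x = G x"
proof -
  have gs: "g m \<in> sqi lebesgue" for m using W g shift_invariant_sqi by blast
  have Gs: "unc (\<Gamma> (g m)) \<in> sqi fib" for m by (rule Gamma_sqi[OF gs])
  obtain f where f: "f \<in> sqi lebesgue" "(\<lambda>m. nrm lebesgue (\<lambda>x. g m x - f x)) \<longlonglongrightarrow> 0"
  proof (rule sqi_complete[OF gs])
    fix e :: real assume e: "e > 0"
    have "\<forall>\<^sub>F m in sequentially. nrm fib (\<lambda>z. unc (\<Gamma> (g m)) z - unc G z) < e / 2"
      by (rule order_tendstoD(2)[OF lim]) (use e in simp)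
    then obtain N where N: "\<And>m. m \<ge> N \<Longrightarrow> nrm fib (\<lambda>z. unc (\<Gamma> (g m)) z - unc G z) < e / 2"
      by (auto simp: eventually_sequentially)
    have "nrm lebesgue (\<lambda>x. g m x - g k x) < e" if "m \<ge> N" "k \<ge> N" for m k
      using nrm_triangle_diff[OF Gs G Gs, of m k] nrm_minus_commute[of fib "unc G" "unc (\<Gamma> (g k))"]
        N[OF that(1)] N[OF that(2)] unfolding Gamma_diff_nrm[OF gs gs] by simp
    then show "\<exists>N. \<forall>m\<ge>N. \<forall>k\<ge>N. nrm lebesgue (\<lambda>x. g m x - g k x) < e" by blast
  qed
  have fW: "f \<in> W" by (rule shift_invariant_closed[OF W g f])
  have Gf: "unc (\<Gamma> f) \<in> sqi fib" by (rule Gamma_sqi[OF f(1)])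
  have "nrm fib (\<lambda>z. unc (\<Gamma> f) z - unc G z) \<le> nrm lebesgue (\<lambda>x. g m x - f x) + nrm fib (\<lambda>z. unc (\<Gamma> (g m)) z - unc G z)" for m
    using nrm_triangle_diff[OF Gf Gs G, of m] nrm_minus_commute[of lebesgue f "g m"] unfolding Gamma_diff_nrm[OF f(1) gs] by simp
  moreover have "(\<lambda>m. nrm lebesgue (\<lambda>x. g m x - f x) + nrm fib (\<lambda>z. unc (\<Gamma> (g m)) z - unc G z)) \<longlonglongrightarrow> 0"
    using tendsto_add[OF f(2) lim] by simp
  ultimately have "nrm fib (\<lambda>z. unc (\<Gamma> f) z - unc G z) \<le> 0"
    by (intro LIMSEQ_le_const[where X="\<lambda>m. nrm lebesgue (\<lambda>x. g m x - f x) + nrm fib (\<lambda>z. unc (\<Gamma> (g m)) z - unc G z)"]) auto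
  then have "nrm fib (\<lambda>z. unc (\<Gamma> f) z - unc G z) = 0"
    using nrm_nonneg[of fib "\<lambda>z. unc (\<Gamma> f) z - unc G z"] by linarith
  then have "AE z in fib. unc (\<Gamma> f) z - unc G z = 0"
    by (subst (asm) nrm_eq_zero_iff) (intro sqi_diff Gf G)
  then have "AE z in fib. \<Gamma> f (fst z) (snd z) = G (fst z) (snd z)" by simp
  from AE_fib[OF this] fW show ?thesis by (intro bexI[of _ f]) (auto simp: fun_eq_iff)
qed

text \<open>Scalar fields whose fiberwise action preserves the image of \<open>W\<close> up to null
  sets. The bound is required everywhere on the torus, so that products stay bounded and dominating
  functions are immediate.\<close>

definition multipliers :: "(real ^ 'k \<Rightarrow> complex) set \<Rightarrow> (real ^ 'k \<Rightarrow> complex) set" where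
  "multipliers W = {c. c \<in> borel_measurable tor \<and> (\<exists>B. \<forall>x\<in>torus. cmod (c x) \<le> B) \<and>
     (\<forall>h\<in>W. \<exists>g\<in>W. AE x in tor. \<Gamma> g x = (\<lambda>l. c x * \<Gamma> h x l))}"

lemma multipliersD:
  assumes "c \<in> multipliers W"
  shows "c \<in> borel_measurable tor" "\<exists>B. \<forall>x\<in>torus. cmod (c x) \<le> B"
    "h \<in> W \<Longrightarrow> \<exists>g\<in>W. AE x in tor. \<Gamma> g x = (\<lambda>l. c x * \<Gamma> h x l)"
  using assms by (auto simp: multipliers_def)

context
  fixes W :: "(real ^ 'k \<Rightarrow> complex) set"
  assumes W: "shift_invariant W"
begin

lemma multipliers_linear:
  assumes c: "c \<in> multipliers W" and d: "d \<in> multipliers W"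
  shows "(\<lambda>x. a * c x + b * d x) \<in> multipliers W"
  unfolding multipliers_def
proof (intro CollectI conjI ballI)
  show "(\<lambda>x. a * c x + b * d x) \<in> borel_measurable tor"
    using multipliersD(1)[OF c] multipliersD(1)[OF d] by simp
  obtain B D where BD: "\<forall>x\<in>torus. cmod (c x) \<le> B" "\<forall>x\<in>torus. cmod (d x) \<le> D"
    using multipliersD(2)[OF c] multipliersD(2)[OF d] by blast
  show "\<exists>B. \<forall>x\<in>torus. cmod (a * c x + b * d x) \<le> B"
  proof (intro exI ballI)
    fix x :: "real ^ 'k" assume x: "x \<in> torus"
    have "cmod (a * c x + b * d x) \<le> cmod a * cmod (c x) + cmod b * cmod (d x)"
      using norm_triangle_ineq[of "a * c x" "b * d x"] by (simp add: norm_mult)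
    also have "\<dots> \<le> cmod a * B + cmod b * D"
      using BD x by (intro add_mono mult_left_mono) auto
    finally show "cmod (a * c x + b * d x) \<le> cmod a * B + cmod b * D" .
  qed
  fix h assume h: "h \<in> W"
  obtain g k where gk: "g \<in> W" "AE x in tor. \<Gamma> g x = (\<lambda>l. c x * \<Gamma> h x l)" "k \<in> W" "AE x in tor. \<Gamma> k x = (\<lambda>l. d x * \<Gamma> h x l)"
    using multipliersD(3)[OF c h] multipliersD(3)[OF d h] by blast
  have "AE x in tor. \<Gamma> (\<lambda>y. a * g y + b * k y) x = (\<lambda>l. a * \<Gamma> g x l + b * \<Gamma> k x l)"
    using gk W by (intro Gamma_linear) (auto intro: shift_invariant_sqi)
  then have "AE x in tor. \<Gamma> (\<lambda>y. a * g y + b * k y) x = (\<lambda>l. (a * c x + b * d x) * \<Gamma> h x l)"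
    using gk(2,4) by eventually_elim (simp add: algebra_simps)
  then show "\<exists>g\<in>W. AE x in tor. \<Gamma> g x = (\<lambda>l. (a * c x + b * d x) * \<Gamma> h x l)"
    using shift_invariant_linear[OF W gk(1,3)] by blast
qed

lemma multipliers_mult:
  assumes c: "c \<in> multipliers W" and d: "d \<in> multipliers W"
  shows "(\<lambda>x. c x * d x) \<in> multipliers W"
  unfolding multipliers_def
proof (intro CollectI conjI ballI)
  show "(\<lambda>x. c x * d x) \<in> borel_measurable tor"
    using multipliersD(1)[OF c] multipliersD(1)[OF d] by simp
  obtain B D where BD: "\<forall>x\<in>torus. cmod (c x) \<le> B" "\<forall>x\<in>torus. cmod (d x) \<le> D"
    using multipliersD(2)[OF c] multipliersD(2)[OF d] by blast
  show "\<exists>B. \<forall>x\<in>torus. cmod (c x * d x) \<le> B"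
  proof (intro exI ballI)
    fix x :: "real ^ 'k" assume x: "x \<in> torus"
    show "cmod (c x * d x) \<le> B * D"
      unfolding norm_mult using BD x norm_ge_zero[of "c x"] by (intro mult_mono) (auto intro: order_trans[OF norm_ge_zero])
  qed
  fix h assume h: "h \<in> W"
  obtain g where g: "g \<in> W" "AE x in tor. \<Gamma> g x = (\<lambda>l. d x * \<Gamma> h x l)"
    using multipliersD(3)[OF d h] by blast
  obtain k where k: "k \<in> W" "AE x in tor. \<Gamma> k x = (\<lambda>l. c x * \<Gamma> g x l)"
    using multipliersD(3)[OF c g(1)] by blast
  have "AE x in tor. \<Gamma> k x = (\<lambda>l. (c x * d x) * \<Gamma> h x l)"
    using g(2) k(2)
  proof eventually_elim
    case (elim x)
    then have "\<Gamma> k x l = (c x * d x) * \<Gamma> h x l" for l by (simp only: mult.assoc)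
    then show ?case by (rule ext)
  qed
  then show "\<exists>g\<in>W. AE x in tor. \<Gamma> g x = (\<lambda>l. (c x * d x) * \<Gamma> h x l)" using k(1) by blast
qed

lemma multipliers_phase: "(\<lambda>x. phase (int_vec l \<bullet> x)) \<in> multipliers W"
  unfolding multipliers_def
proof (intro CollectI conjI ballI)
  show "(\<lambda>x. phase (int_vec l \<bullet> x)) \<in> borel_measurable tor"
    by (rule borel_measurable_torI) measurable
  show "\<exists>B. \<forall>x\<in>torus. cmod (phase (int_vec l \<bullet> x)) \<le> B" by auto
  fix h assume "h \<in> W"
  then show "\<exists>g\<in>W. AE x in tor. \<Gamma> g x = (\<lambda>m. phase (int_vec l \<bullet> x) * \<Gamma> h x m)"
    using Gamma_translation[of h l] W by (intro bexI[of _ "translation (int_vec l) h"])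
      (auto intro: shift_invariant_sqi shift_invariant_translation)
qed

lemma multipliers_const: "(\<lambda>x. a) \<in> multipliers W"
proof -
  have "int_vec 0 = (0 :: real ^ 'k)" by (simp add: int_vec_def vec_eq_iff)
  then show ?thesis
    using multipliers_linear[OF multipliers_phase[of 0] multipliers_phase[of 0], of a 0] by simp
qed

lemma multipliers_add:
  "c \<in> multipliers W \<Longrightarrow> d \<in> multipliers W \<Longrightarrow> (\<lambda>x. c x + d x) \<in> multipliers W"
  using multipliers_linear[of c d 1 1] by simp

lemma multipliers_diff:
  "c \<in> multipliers W \<Longrightarrow> d \<in> multipliers W \<Longrightarrow> (\<lambda>x. c x - d x) \<in> multipliers W"
  using multipliers_linear[of c d 1 "-1"] by simp

lemma multipliers_sum:
  "(\<And>i. i \<in> I \<Longrightarrow> c i \<in> multipliers W) \<Longrightarrow> (\<lambda>x. \<Sum>i\<in>I. c i x) \<in> multipliers W"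
  by (induction I rule: infinite_finite_induct) (auto intro: multipliers_add multipliers_const)

lemma multipliers_prod:
  "(\<And>i. i \<in> I \<Longrightarrow> c i \<in> multipliers W) \<Longrightarrow> (\<lambda>x. \<Prod>i\<in>I. c i x) \<in> multipliers W"
  by (induction I rule: infinite_finite_induct) (auto intro: multipliers_mult multipliers_const)

text \<open>The uniform bound gives the dominating field \<open>B\<close> times
  \<open>\<Gamma> h\<close>, so the products converge in norm and \<open>Gamma_image_closed\<close>
  applies. The limit carries its own bound \<open>D\<close>, since convergence holds only almost
  everywhere while \<open>d\<close> is prescribed everywhere.\<close>

lemma multipliers_limit:
  assumes c: "\<And>m. c m \<in> multipliers W" and bd: "\<And>m x. x \<in> torus \<Longrightarrow> cmod (c m x) \<le> B"
    and lim: "AE x in tor. (\<lambda>m. c m x) \<longlonglongrightarrow> d x" and d: "d \<in> borel_measurable tor"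
    and dB: "\<forall>x\<in>torus. cmod (d x) \<le> D"
  shows "d \<in> multipliers W"
  unfolding multipliers_def
proof (intro CollectI conjI ballI d)
  show "\<exists>B. \<forall>x\<in>torus. cmod (d x) \<le> B" using dB by blast
  fix h assume h: "h \<in> W"
  then have hs: "h \<in> sqi lebesgue" using W shift_invariant_sqi by blast
  note Gh = Gamma_sqi[OF hs]
  have "\<forall>m. \<exists>g. g \<in> W \<and> (AE x in tor. \<Gamma> g x = (\<lambda>l. c m x * \<Gamma> h x l))"
    using multipliersD(3)[OF c h] by blast
  from choice[OF this] obtain g where
    "\<forall>m. g m \<in> W \<and> (AE x in tor. \<Gamma> (g m) x = (\<lambda>l. c m x * \<Gamma> h x l))" ..
  then have g: "\<And>m. g m \<in> W" "\<And>m. AE x in tor. \<Gamma> (g m) x = (\<lambda>l. c m x * \<Gamma> h x l)"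
    by blast+
  have gs: "unc (\<Gamma> (g m)) \<in> sqi fib" for m using g(1) W by (intro Gamma_sqi) (auto intro: shift_invariant_sqi)
  have hm: "(\<lambda>x. \<Gamma> h x l) \<in> borel_measurable tor" for l using sqiD(1)[OF Gh] unc_measurable by blast
  have dm: "unc (\<lambda>x l. d x * \<Gamma> h x l) \<in> borel_measurable fib"
    using unc_measurable[of "\<lambda>x l. d x * \<Gamma> h x l"] hm d by simp
  have cm: "unc (\<lambda>x l. c m x * \<Gamma> h x l) \<in> borel_measurable fib" for m
    using unc_measurable[of "\<lambda>x l. c m x * \<Gamma> h x l"] hm multipliersD(1)[OF c] by simp
  have w: "(\<lambda>z. complex_of_real B * unc (\<Gamma> h) z) \<in> sqi fib" by (rule sqi_scale[OF Gh])
  have sp: "fst z \<in> torus" if "z \<in> space fib" for z :: "(real ^ 'k) \<times> (int ^ 'k)"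
    using that by (auto simp: fib_def space_pair_measure)
  have conv: "unc (\<lambda>x l. d x * \<Gamma> h x l) \<in> sqi fib"
    "(\<lambda>m. nrm fib (\<lambda>z. unc (\<lambda>x l. c m x * \<Gamma> h x l) z - unc (\<lambda>x l. d x * \<Gamma> h x l) z)) \<longlonglongrightarrow> 0"
  proof -
    have A: "AE z in fib. cmod (unc (\<lambda>x l. c m x * \<Gamma> h x l) z) \<le> cmod (complex_of_real B * unc (\<Gamma> h) z)" for m
    proof (intro AE_I2)
      fix z :: "(real ^ 'k) \<times> (int ^ 'k)" assume z: "z \<in> space fib"
      have "0 \<le> B" using order_trans[OF norm_ge_zero bd[OF sp[OF z]]] .
      then show "cmod (unc (\<lambda>x l. c m x * \<Gamma> h x l) z) \<le> cmod (complex_of_real B * unc (\<Gamma> h) z)"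
        using bd[OF sp[OF z]] by (auto simp: norm_mult intro!: mult_right_mono)
    qed
    have "AE z in fib. (\<lambda>m. c m (fst z)) \<longlonglongrightarrow> d (fst z)"
      using lim AE_fib_iff[of "\<lambda>x l. (\<lambda>m. c m x) \<longlonglongrightarrow> d x"] by simp
    then have Bl: "AE z in fib. (\<lambda>m. unc (\<lambda>x l. c m x * \<Gamma> h x l) z) \<longlonglongrightarrow> unc (\<lambda>x l. d x * \<Gamma> h x l) z"
      by eventually_elim (rule tendsto_mult_right)
    show "unc (\<lambda>x l. d x * \<Gamma> h x l) \<in> sqi fib"
      by (rule nrm_dominated_convergence(1)[OF cm dm w A Bl])
    show "(\<lambda>m. nrm fib (\<lambda>z. unc (\<lambda>x l. c m x * \<Gamma> h x l) z - unc (\<lambda>x l. d x * \<Gamma> h x l) z)) \<longlonglongrightarrow> 0"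
      by (rule nrm_dominated_convergence(2)[OF cm dm w A Bl])
  qed
  have "nrm fib (\<lambda>z. unc (\<Gamma> (g m)) z - unc (\<lambda>x l. d x * \<Gamma> h x l) z)
      = nrm fib (\<lambda>z. unc (\<lambda>x l. c m x * \<Gamma> h x l) z - unc (\<lambda>x l. d x * \<Gamma> h x l) z)" for m
  proof (rule nrm_cong)
    have "AE x in tor. \<forall>l. \<Gamma> (g m) x l = c m x * \<Gamma> h x l"
      using g(2)[of m] by eventually_elim simp
    then have "AE z in fib. \<Gamma> (g m) (fst z) (snd z) = c m (fst z) * \<Gamma> h (fst z) (snd z)"
      by (subst AE_fib_iff)
    then show "AE z in fib. unc (\<Gamma> (g m)) z - unc (\<lambda>x l. d x * \<Gamma> h x l) z = unc (\<lambda>x l. c m x * \<Gamma> h x l) z - unc (\<lambda>x l. d x * \<Gamma> h x l) z"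
      by eventually_elim simp
  qed (intro borel_measurable_diff sqiD(1)[OF gs] dm cm)+
  then have "(\<lambda>m. nrm fib (\<lambda>z. unc (\<Gamma> (g m)) z - unc (\<lambda>x l. d x * \<Gamma> h x l) z)) \<longlonglongrightarrow> 0"
    using conv(2) by simp
  from Gamma_image_closed[OF W g(1) conv(1) this]
  show "\<exists>g\<in>W. AE x in tor. \<Gamma> g x = (\<lambda>l. d x * \<Gamma> h x l)" .
qed

lemma multipliers_polynomial:
  assumes p: "real_polynomial_function (p :: real \<Rightarrow> real)"
    and u: "(\<lambda>x. complex_of_real (u x)) \<in> multipliers W"
  shows "(\<lambda>x. complex_of_real (p (u x))) \<in> multipliers W"
  using p
proof (induction p rule: real_polynomial_function.induct)
  case (linear f)
  then obtain a where "f = (\<lambda>t. t * a)" using real_bounded_linear by blast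
  then show ?case using multipliers_mult[OF u multipliers_const[of "complex_of_real a"]] by simp
next
  case (const c)
  then show ?case by (rule multipliers_const)
next
  case (add f g)
  then show ?case using multipliers_add by simp
next
  case (mult f g)
  then show ?case using multipliers_mult by simp
qed

text \<open>For positive \<open>k\<close> the ramp \<open>\<phi> k\<close> is 1 up to
  \<open>a\<close> and 0 beyond \<open>a + 1/k\<close>, so the ramps converge to the indicator of
  the sublevel set. Multipliers are closed under polynomials, and Weierstrass approximation on
  \<open>{-1..1}\<close> replaces each ramp by a polynomial with an error tending to zero.\<close>

lemma multipliers_sublevel:
  assumes u: "(\<lambda>x. complex_of_real (u x)) \<in> multipliers W" and ub: "\<And>x. \<bar>u x\<bar> \<le> 1"
  shows "(\<lambda>x. complex_of_real (of_bool (u x \<le> a))) \<in> multipliers W"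
proof -
  have um [measurable]: "u \<in> borel_measurable tor"
    using multipliersD(1)[OF u] by (simp only: borel_measurable_complex_iff Re_complex_of_real)
  define \<phi> where "\<phi> k t = max 0 (min 1 (1 - real k * (t - a)))" for k :: nat and t :: real
  have "\<exists>p. real_polynomial_function p \<and> (\<forall>t\<in>{-1..1}. \<bar>\<phi> k t - p t\<bar> < 1 / (real k + 1))" for k
  proof -
    have "continuous_on {-1..1} (\<phi> k)" unfolding \<phi>_def by (intro continuous_intros)
    then obtain g where "real_polynomial_function g" "\<And>t. t \<in> {-1..1} \<Longrightarrow> \<bar>\<phi> k t - g t\<bar> < 1 / (real k + 1)"
      using Stone_Weierstrass_real_polynomial_function[of "{-1..1::real}" "\<phi> k" "1 / (real k + 1)"] by auto
    then show ?thesis by blast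
  qed
  then have "\<exists>p. \<forall>k. real_polynomial_function (p k) \<and> (\<forall>t\<in>{-1..1}. \<bar>\<phi> k t - p k t\<bar> < 1 / (real k + 1))"
    by (intro choice allI)
  then obtain p where "\<forall>k. real_polynomial_function (p k) \<and> (\<forall>t\<in>{-1..1}. \<bar>\<phi> k t - p k t\<bar> < 1 / (real k + 1))" ..
  then have p: "\<And>k. real_polynomial_function (p k)" "\<And>k t. t \<in> {-1..1} \<Longrightarrow> \<bar>\<phi> k t - p k t\<bar> < 1 / (real k + 1)"
    by blast+
  have u1: "u x \<in> {-1..1}" for x using ub[of x] by auto
  show ?thesis
  proof (rule multipliers_limit[of "\<lambda>k x. complex_of_real (p k (u x))" 2 _ 1])
    show "(\<lambda>x. complex_of_real (p k (u x))) \<in> multipliers W" for k by (rule multipliers_polynomial[OF p(1) u])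
    show "cmod (complex_of_real (p k (u x))) \<le> 2" for k x
    proof -
      have "\<bar>p k (u x)\<bar> \<le> \<bar>\<phi> k (u x)\<bar> + 1 / (real k + 1)" using p(2)[OF u1, of k x] by linarith
      also have "\<dots> \<le> 1 + 1" by (intro add_mono) (auto simp: \<phi>_def)
      finally show ?thesis by simp
    qed
    show "AE x in tor. (\<lambda>k. complex_of_real (p k (u x))) \<longlonglongrightarrow> complex_of_real (of_bool (u x \<le> a))"
    proof (intro AE_I2 tendsto_of_real)
      fix x
      have z: "(\<lambda>k. 1 / (real k + 1)) \<longlonglongrightarrow> 0" by real_asymp
      have \<phi>1: "(\<lambda>k. \<phi> k (u x)) \<longlonglongrightarrow> of_bool (u x \<le> a)"
      proof (rule tendsto_eventually)
        show "\<forall>\<^sub>F k in sequentially. \<phi> k (u x) = of_bool (u x \<le> a)"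
        proof (cases "u x \<le> a")
          case True
          then have "real k * (u x - a) \<le> 0" for k by (intro mult_nonneg_nonpos) auto
          then show ?thesis using True by (auto simp: \<phi>_def)
        next
          case False
          then obtain K where K: "1 \<le> real K * (u x - a)"
            using reals_Archimedean3[of "u x - a"] by (metis diff_gt_0_iff_gt less_imp_le not_le)
          have "1 \<le> real k * (u x - a)" if "k \<ge> K" for k
          proof -
            have "real K * (u x - a) \<le> real k * (u x - a)"
              by (rule mult_right_mono) (use that False in auto)
            with K show ?thesis by linarith
          qed
          then show ?thesis using False by (intro eventually_sequentiallyI[of K]) (auto simp: \<phi>_def)
        qed
      qed
      have "(\<lambda>k. p k (u x) - \<phi> k (u x)) \<longlonglongrightarrow> 0"
        by (rule Lim_null_comparison[OF _ z]) (use p(2)[OF u1] in \<open>auto simp: abs_minus_commute less_imp_le\<close>)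
      from tendsto_add[OF this \<phi>1] show "(\<lambda>k. p k (u x)) \<longlonglongrightarrow> of_bool (u x \<le> a)" by simp
    qed
  qed (auto simp: of_bool_def)
qed

lemma multipliers_AE:
  assumes "c \<in> multipliers W" "AE x in tor. c' x = c x"
    and m: "c' \<in> borel_measurable tor" and b: "\<forall>x\<in>torus. cmod (c' x) \<le> D"
  shows "c' \<in> multipliers W"
proof -
  obtain B where B: "\<forall>x\<in>torus. cmod (c x) \<le> B" using multipliersD(2)[OF assms(1)] by blast
  show ?thesis
    by (rule multipliers_limit[of "\<lambda>_. c" B, OF assms(1) _ _ m b]) (use B assms(2) in auto)
qed

section \<open>From trigonometric monomials to all bounded measurable multipliers\<close>

definition multiplier_sets :: "(real ^ 'k) set set" where
  "multiplier_sets = {E. E \<subseteq> torus \<and> (\<lambda>x. indicator E x) \<in> multipliers W}"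

text \<open>Complements come from \<open>1 - c\<close>. Countable unions are bounded limits of the
  finite ones, whose indicators are \<open>1\<close> minus a product of complementary indicators and
  thus multipliers.\<close>

lemma sigma_algebra_multiplier_sets: "sigma_algebra torus multiplier_sets"
  unfolding sigma_algebra_iff2
proof (intro conjI ballI allI impI)
  show "multiplier_sets \<subseteq> Pow torus" by (auto simp: multiplier_sets_def)
  show "{} \<in> multiplier_sets" using multipliers_const[of 0] by (simp add: multiplier_sets_def indicator_def[abs_def])
  fix E assume E: "E \<in> multiplier_sets"
  have "(\<lambda>x. 1 - indicator E x) \<in> multipliers W"
    using E by (intro multipliers_diff multipliers_const) (auto simp: multiplier_sets_def)
  note c = this
  \<comment> \<open>\<open>multiplier_sets\<close> records the measurability of a set only through
    its multiplier, so the set is recovered as a level set.\<close>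
  have "(\<lambda>x. 1 - indicator E x :: complex) -` {1} \<inter> space tor \<in> sets tor"
    using multipliersD(1)[OF c] by (rule measurable_sets) simp
  also have "(\<lambda>x. 1 - indicator E x :: complex) -` {1} \<inter> space tor = torus - E"
    by (auto simp: indicator_def split: if_splits)
  finally have m: "(\<lambda>x. indicator (torus - E) x :: complex) \<in> borel_measurable tor"
    by (rule borel_measurable_indicator)
  have "(\<lambda>x. indicator (torus - E) x) \<in> multipliers W"
    by (rule multipliers_AE[OF c _ m, where D=1]) (auto simp: indicator_def intro!: AE_I2)
  then show "torus - E \<in> multiplier_sets" by (auto simp: multiplier_sets_def)
next
  fix A :: "nat \<Rightarrow> (real ^ 'k) set" assume "range A \<subseteq> multiplier_sets"
  then have A: "A i \<subseteq> torus" "(\<lambda>x. indicator (A i) x) \<in> multipliers W" for i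
    by (auto simp: multiplier_sets_def)
  have fin: "(\<lambda>x. 1 - (\<Prod>i<m. 1 - indicator (A i) x)) \<in> multipliers W" for m
    by (intro multipliers_diff multipliers_const multipliers_prod A)
  have "(\<Prod>i<m. 1 - indicator (A i) x) = (1 - indicator (\<Union>i<m. A i) x :: complex)" for m x
  proof (induction m)
    case (Suc m)
    then show ?case by (cases "x \<in> A m") (auto simp: lessThan_Suc indicator_def)
  qed simp
  then have e: "1 - (\<Prod>i<m. 1 - indicator (A i) x) = (indicator (\<Union>i<m. A i) x :: complex)" for m x
    by (simp only: diff_diff_eq2 add_diff_cancel_left')
  have "A i \<in> sets tor" for i
  proof -
    have "(\<lambda>x. indicator (A i) x :: complex) -` {1} \<inter> space tor \<in> sets tor"
      using multipliersD(1)[OF A(2)[of i]] by (rule measurable_sets) simp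
    also have "(\<lambda>x. indicator (A i) x :: complex) -` {1} \<inter> space tor = A i"
      using A(1)[of i] by (auto simp: indicator_def split: if_splits)
    finally show ?thesis .
  qed
  then have m: "(\<lambda>x. indicator (\<Union>i. A i) x :: complex) \<in> borel_measurable tor"
    by (intro borel_measurable_indicator) auto
  have "(\<lambda>x. indicator (\<Union>i. A i) x) \<in> multipliers W"
  proof (rule multipliers_limit[of "\<lambda>m x. 1 - (\<Prod>i<m. 1 - indicator (A i) x)" 1 _ 1, OF fin _ _ m])
    show "AE x in tor. (\<lambda>m. 1 - (\<Prod>i<m. 1 - indicator (A i) x)) \<longlonglongrightarrow> (indicator (\<Union>i. A i) x :: complex)"
    proof (intro AE_I2 tendsto_eventually)
      fix x
      show "\<forall>\<^sub>F m in sequentially. 1 - (\<Prod>i<m. 1 - indicator (A i) x) = (indicator (\<Union>i. A i) x :: complex)"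
      proof (cases "\<exists>i. x \<in> A i")
        case True
        then obtain i where "x \<in> A i" by blast
        then show ?thesis unfolding e
          by (intro eventually_sequentiallyI[of "Suc i"]) (auto simp: indicator_def)
      qed (auto simp: e indicator_def)
    qed
    show "cmod (1 - (\<Prod>i<m. 1 - indicator (A i) x)) \<le> 1" for m x
      unfolding e by (simp add: indicator_def)
  qed (auto simp: indicator_def)
  then show "(\<Union>i. A i) \<in> multiplier_sets" unfolding multiplier_sets_def using A(1) by blast
qed

text \<open>On the torus \<open>x $ j\<close> is a Borel function of \<open>cos (2 pi x $ j)\<close> and \<open>sin (2 pi x $ j)\<close>, so the
  sublevel sets of these two functions generate all Borel subsets.\<close>

lemma trig_multipliers:
  "(\<lambda>x. complex_of_real (cos (2 * pi * x $ j))) \<in> multipliers W"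
  "(\<lambda>x. complex_of_real (sin (2 * pi * x $ j))) \<in> multipliers W"
proof -
  have a: "int_vec (axis j b) \<bullet> x = real_of_int b * x $ j" for b and x :: "real ^ 'k"
  proof -
    have "int_vec (axis j b) = axis j (real_of_int b)"
      by (auto simp: int_vec_def axis_def vec_eq_iff)
    then show ?thesis by (simp add: inner_axis' )
  qed
  have pc: "phase t = cis (- (2 * pi * t))" for t
    by (simp add: phase_def cis_conv_exp mult_ac)
  have c: "complex_of_real (cos (2 * pi * t)) = 1/2 * phase t + 1/2 * phase (- t)" for t
    by (simp add: pc complex_eq_iff)
  have s: "complex_of_real (sin (2 * pi * t)) = \<i>/2 * phase t + (- \<i>/2) * phase (- t)" for t
    by (simp add: pc complex_eq_iff)
  have p: "(\<lambda>x. phase (x $ j)) \<in> multipliers W" "(\<lambda>x. phase (- (x $ j))) \<in> multipliers W"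
    using multipliers_phase[of "axis j 1"] multipliers_phase[of "axis j (- 1)"] by (simp_all add: a)
  show "(\<lambda>x. complex_of_real (cos (2 * pi * x $ j))) \<in> multipliers W"
    unfolding c by (rule multipliers_linear[OF p])
  show "(\<lambda>x. complex_of_real (sin (2 * pi * x $ j))) \<in> multipliers W"
    unfolding s by (rule multipliers_linear[OF p])
qed

text \<open>The sigma algebra of multiplier sets is made into a measure space \<open>N\<close>. Once
  the coordinates, and hence the identity map, are measurable from \<open>N\<close>, every Borel set
  is a preimage and its trace on the torus is a multiplier set.\<close>

lemma borel_multiplier_sets:
  assumes E: "E \<in> sets borel"
  shows "E \<inter> torus \<in> multiplier_sets"
proof -
  interpret sigma_algebra torus multiplier_sets by (rule sigma_algebra_multiplier_sets)
  define N where "N = sigma torus multiplier_sets"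
  have N: "space N = torus" "sets N = multiplier_sets"
    unfolding N_def using space_closed by (auto simp: sigma_sets_eq)
  have meas: "u \<in> borel_measurable N" if u: "(\<lambda>x. complex_of_real (u x)) \<in> multipliers W" "\<And>x. \<bar>u x\<bar> \<le> 1" for u
    unfolding borel_measurable_iff_le
  proof
    fix a
    have b: "(\<lambda>x. complex_of_real (of_bool (u x \<le> a))) \<in> multipliers W" by (rule multipliers_sublevel[OF u])
    have "(\<lambda>x. complex_of_real (of_bool (u x \<le> a))) -` {1} \<inter> space tor \<in> sets tor"
      using multipliersD(1)[OF b] by (rule measurable_sets) simp
    also have "(\<lambda>x. complex_of_real (of_bool (u x \<le> a))) -` {1} \<inter> space tor = {x \<in> torus. u x \<le> a}" by auto
    finally have "(\<lambda>x. indicator {x \<in> torus. u x \<le> a} x :: complex) \<in> borel_measurable tor"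
      by (rule borel_measurable_indicator)
    then have "(\<lambda>x. indicator {x \<in> torus. u x \<le> a} x) \<in> multipliers W"
      by (rule multipliers_AE[OF b _ _, where D=1, rotated]) (auto simp: indicator_def intro!: AE_I2)
    then show "{w \<in> space N. u w \<le> a} \<in> sets N"
      by (auto simp: N multiplier_sets_def)
  qed
  have coord: "(\<lambda>x. x $ j) \<in> borel_measurable N" for j
  proof -
    define c where "c x = cos (2 * pi * x $ j)" for x :: "real ^ 'k"
    define s where "s x = sin (2 * pi * x $ j)" for x :: "real ^ 'k"
    have [measurable]: "c \<in> borel_measurable N" "s \<in> borel_measurable N"
      unfolding c_def s_def by (rule meas[OF trig_multipliers(1)], simp) (rule meas[OF trig_multipliers(2)], simp)
    \<comment> \<open>Extended by 0 outside \<open>{-1..1}\<close> so as to be Borel on the whole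
      line; cosines never reach the extension.\<close>
    define acos where "acos t = (if t \<in> {-1..1} then arccos t else 0)" for t :: real
    have [measurable]: "acos \<in> borel_measurable borel"
      unfolding acos_def[abs_def]
      by (rule borel_measurable_continuous_on_if) (auto intro: continuous_on_arccos' continuous_on_const)
    \<comment> \<open>The arc cosine recovers the absolute value of the angle and the sign of the
      sine decides between the two candidates. At \<open>x $ j = -1/2\<close> the sine vanishes, and
      the test \<open>c x = -1\<close> selects the negative sign, the only one belonging to the
      torus.\<close>
    have "(\<lambda>x. if s x < 0 \<or> c x = -1 then - acos (c x) / (2 * pi) else acos (c x) / (2 * pi)) \<in> borel_measurable N"
      by measurable
    moreover have "(if s x < 0 \<or> c x = -1 then - acos (c x) / (2 * pi) else acos (c x) / (2 * pi)) = x $ j"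
      if x: "x \<in> torus" for x
    proof -
      have xj: "- 1/2 \<le> x $ j" "x $ j < 1/2" using x by (auto simp: torus_def)
      have b: "- pi \<le> 2 * pi * x $ j" "2 * pi * x $ j < pi"
        using mult_left_mono[OF xj(1), of "2 * pi"] mult_strict_left_mono[OF xj(2), of "2 * pi"] by auto
      have ac: "acos (c x) = arccos (c x)" by (simp add: acos_def c_def)
      show ?thesis
      proof (cases "x $ j < 0")
        case True
        then have neg: "2 * pi * x $ j < 0" by (simp add: mult_pos_neg)
        have "s x < 0 \<or> c x = -1"
        proof (cases "2 * pi * x $ j = - pi")
          case True
          then show ?thesis by (simp add: c_def)
        next
          case False
          then have "sin (- (2 * pi * x $ j)) > 0" using b neg by (intro sin_gt_zero) auto
          then show ?thesis by (simp add: s_def)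
        qed
        moreover have "arccos (c x) = - (2 * pi * x $ j)"
          unfolding c_def by (rule arccos_cos2) (use neg b in auto)
        ultimately show ?thesis using ac by simp
      next
        case False
        then have pos: "0 \<le> 2 * pi * x $ j" by simp
        have "s x \<ge> 0" unfolding s_def using b pos by (intro sin_ge_zero) auto
        moreover have ar: "arccos (c x) = 2 * pi * x $ j"
          unfolding c_def by (rule arccos_cos) (use pos b in auto)
        moreover have "c x \<noteq> -1" using ar b by auto
        ultimately show ?thesis using ac by simp
      qed
    qed
    ultimately show ?thesis by (subst measurable_cong[of N _ "\<lambda>x. if s x < 0 \<or> c x = -1 then - acos (c x) / (2 * pi) else acos (c x) / (2 * pi)"]) (auto simp: N)
  qed
  have "(\<lambda>x. x) \<in> borel_measurable N"
  proof (rule iffD2[OF borel_measurable_euclidean_space], rule ballI)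
    fix i :: "real ^ 'k" assume "i \<in> Basis"
    then have "\<exists>j. i = axis j 1" unfolding Basis_vec_def Basis_real_def by simp
    then obtain j where i: "i = axis j 1" ..
    show "(\<lambda>x. x \<bullet> i) \<in> borel_measurable N" unfolding i using coord[of j] by (simp only: cart_eq_inner_axis)
  qed
  from measurable_sets[OF this E] show ?thesis by (simp add: N vimage_def)
qed

text \<open>A Lebesgue measurable set agrees with a Borel set up to a null set, obtained as a level
  set of a Borel function equal to the indicator almost everywhere. Indicators give simple functions
  by linearity, and simple functions give bounded functions by limits.\<close>

lemma measurable_multipliers:
  assumes c: "c \<in> borel_measurable tor" and B: "\<forall>x\<in>torus. cmod (c x) \<le> B"
  shows "c \<in> multipliers W"
proof -
  have ind: "(\<lambda>x. indicator E x) \<in> multipliers W" if E: "E \<in> sets tor" for E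
  proof -
    have El: "E \<in> sets lebesgue" "E \<subseteq> torus" using E by (auto simp: sets_restrict_space)
    have "(indicator E :: _ \<Rightarrow> real) \<in> borel_measurable lebesgue" using El by (intro borel_measurable_indicator)
    from completion_ex_borel_measurable_real[OF this] obtain g :: "real ^ 'k \<Rightarrow> real" where
      g: "g \<in> borel_measurable lborel" "AE x in lborel. indicator E x = g x" by blast
    have "g -` {1} \<in> sets borel" using measurable_sets[OF g(1), of "{1}"] by simp
    then have m: "(\<lambda>x. indicator (g -` {1} \<inter> torus) x) \<in> multipliers W"
      using borel_multiplier_sets by (auto simp: multiplier_sets_def)
    have "AE x in lebesgue. indicator E x = g x" using g(2) by (rule AE_completion)
    then have "AE x in tor. indicator E x = g x" by (subst AE_tor) (auto elim: eventually_mono)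
    then have "AE x in tor. (indicator E x :: complex) = indicator (g -` {1} \<inter> torus) x"
      using AE_space
    proof eventually_elim
      case (elim x)
      then show ?case by (auto simp: indicator_def split: if_splits)
    qed
    from m this show ?thesis
      by (rule multipliers_AE[where D=1]) (use E in \<open>auto simp: indicator_def[of E] intro!: borel_measurable_indicator\<close>)
  qed
  \<comment> \<open>The factor 2 in the approximation provides the common bound \<open>2 * B\<close>
    required for passing to the limit.\<close>
  obtain F where F: "\<forall>i. simple_function tor (F i)" "\<forall>x\<in>space tor. (\<lambda>i. F i x) \<longlonglongrightarrow> c x"
    "\<forall>i. \<forall>x\<in>space tor. dist (F i x) 0 \<le> 2 * dist (c x) 0"
    using borel_measurable_implies_sequence_metric[OF c, of 0] by blast
  have simp: "F i \<in> multipliers W" for i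
  proof -
    define Y where "Y = F i ` torus"
    have Y: "finite Y" using F(1) simple_functionD(1)[of tor "F i"] by (auto simp: Y_def)
    have "(\<lambda>x. \<Sum>y\<in>Y. y * indicator (F i -` {y} \<inter> space tor) x) \<in> multipliers W"
      by (intro multipliers_sum multipliers_mult multipliers_const ind simple_functionD(2)) (use F(1) in auto)
    moreover have "AE x in tor. F i x = (\<Sum>y\<in>Y. y * indicator (F i -` {y} \<inter> space tor) x)"
    proof (intro AE_I2)
      fix x :: "real ^ 'k" assume "x \<in> space tor"
      then have x: "x \<in> torus" by simp
      have "(\<Sum>y\<in>Y. y * indicator (F i -` {y} \<inter> space tor) x) = (\<Sum>y\<in>{F i x}. y * indicator (F i -` {y} \<inter> space tor) x)"
        using x Y by (intro sum.mono_neutral_right) (auto simp: Y_def indicator_def)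
      then show "F i x = (\<Sum>y\<in>Y. y * indicator (F i -` {y} \<inter> space tor) x)" using x by simp
    qed
    moreover have "F i \<in> borel_measurable tor" using F(1) borel_measurable_simple_function by blast
    moreover have "\<forall>x\<in>torus. cmod (F i x) \<le> 2 * B"
    proof
      fix x :: "real ^ 'k" assume "x \<in> torus"
      then have "cmod (F i x) \<le> 2 * cmod (c x)" "cmod (c x) \<le> B" using F(3) B by auto
      then show "cmod (F i x) \<le> 2 * B" by linarith
    qed
    ultimately show ?thesis by (rule multipliers_AE)
  qed
  show ?thesis
  proof (rule multipliers_limit[OF simp _ _ c B])
    show "cmod (F m x) \<le> 2 * B" if "x \<in> torus" for m x
    proof -
      have "cmod (F m x) \<le> 2 * cmod (c x)" using F(3) that by simp
      then show ?thesis using B that by force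
    qed
    show "AE x in tor. (\<lambda>m. F m x) \<longlonglongrightarrow> c x" using F(2) by (intro AE_I2) auto
  qed
qed

section \<open>Realizing measurable combinations of fibers by elements of W\<close>

lemma Gamma_sum:
  assumes "finite I" "\<And>i. i \<in> I \<Longrightarrow> g i \<in> W"
  shows "(\<lambda>x. \<Sum>i\<in>I. g i x) \<in> W \<and> (AE x in tor. \<Gamma> (\<lambda>y. \<Sum>i\<in>I. g i y) x = (\<lambda>l. \<Sum>i\<in>I. \<Gamma> (g i) x l))"
  using assms
proof (induction I)
  case empty
  have W0: "(\<lambda>x. 0) \<in> W"
  proof -
    have "cfun.subspace W" using W by (simp add: shift_invariant_def)
    from cfun.subspace_0[OF this] show ?thesis by (simp add: zero_fun_def)
  qed
  have "AE x in tor. \<Gamma> (\<lambda>y. 0 * 0 + 0 * 0) x = (\<lambda>l. 0 * \<Gamma> (\<lambda>y. 0) x l + 0 * \<Gamma> (\<lambda>y. 0) x l)"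
    by (rule Gamma_linear) auto
  then show ?case using W0 by simp
next
  case (insert i I)
  let ?S = "\<lambda>x. \<Sum>i\<in>I. g i x"
  have S: "?S \<in> W" "AE x in tor. \<Gamma> ?S x = (\<lambda>l. \<Sum>i\<in>I. \<Gamma> (g i) x l)" using insert by auto
  have gi: "g i \<in> W" using insert by simp
  have "AE x in tor. \<Gamma> (\<lambda>y. 1 * g i y + 1 * ?S y) x = (\<lambda>l. 1 * \<Gamma> (g i) x l + 1 * \<Gamma> ?S x l)"
    by (rule Gamma_linear) (use gi S W in \<open>auto intro: shift_invariant_sqi\<close>)
  then have "AE x in tor. \<Gamma> (\<lambda>y. g i y + ?S y) x = (\<lambda>l. \<Gamma> (g i) x l + (\<Sum>i\<in>I. \<Gamma> (g i) x l))"
    using S(2) by eventually_elim simp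
  then show ?case
    using shift_invariant_linear[OF W gi S(1), of 1 1] insert.hyps by simp
qed

text \<open>The coefficients may be unbounded; only the combination \<open>V\<close> is assumed
  square integrable. On \<open>E N\<close> all coefficients are bounded by \<open>N\<close>, so the
  truncated combination is obtained from multipliers. The sets \<open>E N\<close> exhaust the torus,
  the truncations converge to \<open>V\<close> under domination by \<open>V\<close>, and the closed
  image contains the limit.\<close>

theorem Gamma_synthesis:
  assumes I: "finite I" and h: "\<And>i. i \<in> I \<Longrightarrow> h i \<in> W" and c: "\<And>i. i \<in> I \<Longrightarrow> c i \<in> borel_measurable tor"
    and V: "unc V \<in> sqi fib" and VE: "AE x in tor. V x = (\<lambda>l. \<Sum>i\<in>I. c i x * \<Gamma> (h i) x l)"
  shows "\<exists>f\<in>W. AE x in tor. \<Gamma> f x = V x"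
proof -
  define E where "E N = {x \<in> torus. \<forall>i\<in>I. cmod (c i x) \<le> real N}" for N
  have E: "E N \<in> sets tor" for N
  proof -
    have "{x \<in> space tor. \<forall>i\<in>I. cmod (c i x) \<le> real N} \<in> sets tor"
    proof (intro sets.sets_Collect_finite_All I)
      fix i assume "i \<in> I"
      from c[OF this] show "{x \<in> space tor. cmod (c i x) \<le> real N} \<in> sets tor"
        by (intro borel_measurable_le) simp_all
    qed
    then show ?thesis by (simp add: E_def)
  qed
  have mult: "(\<lambda>x. indicator (E N) x * c i x) \<in> multipliers W" if "i \<in> I" for i N
  proof (rule measurable_multipliers[where B="real N"])
    show "(\<lambda>x. indicator (E N) x * c i x) \<in> borel_measurable tor"
      by (intro borel_measurable_times borel_measurable_indicator E c that)
  qed (use that in \<open>auto simp: indicator_def E_def\<close>)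
  have "\<exists>f. f \<in> W \<and> (AE x in tor. \<Gamma> f x = (\<lambda>l. indicator (E N) x * V x l))" for N
  proof -
    have "\<forall>i\<in>I. \<exists>g. g \<in> W \<and> (AE x in tor. \<Gamma> g x = (\<lambda>l. indicator (E N) x * c i x * \<Gamma> (h i) x l))"
      using multipliersD(3)[OF mult h] by blast
    from bchoice[OF this] obtain g where
      "\<forall>i\<in>I. g i \<in> W \<and> (AE x in tor. \<Gamma> (g i) x = (\<lambda>l. indicator (E N) x * c i x * \<Gamma> (h i) x l))" ..
    then have g: "\<And>i. i \<in> I \<Longrightarrow> g i \<in> W"
      "\<And>i. i \<in> I \<Longrightarrow> AE x in tor. \<Gamma> (g i) x = (\<lambda>l. indicator (E N) x * c i x * \<Gamma> (h i) x l)" by blast+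
    have gsum: "(\<lambda>x. \<Sum>i\<in>I. g i x) \<in> W"
      "AE x in tor. \<Gamma> (\<lambda>y. \<Sum>i\<in>I. g i y) x = (\<lambda>l. \<Sum>i\<in>I. \<Gamma> (g i) x l)"
      using Gamma_sum[OF I, of g] g(1) by auto
    have "AE x in tor. \<forall>i\<in>I. \<Gamma> (g i) x = (\<lambda>l. indicator (E N) x * c i x * \<Gamma> (h i) x l)"
      using g(2) I by (intro AE_finite_allI)
    then have "AE x in tor. \<Gamma> (\<lambda>y. \<Sum>i\<in>I. g i y) x = (\<lambda>l. indicator (E N) x * V x l)"
      using gsum(2) VE
    proof eventually_elim
      case (elim x)
      have "\<Gamma> (\<lambda>y. \<Sum>i\<in>I. g i y) x l = indicator (E N) x * V x l" for l
      proof -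
        have "\<Gamma> (\<lambda>y. \<Sum>i\<in>I. g i y) x l = (\<Sum>i\<in>I. \<Gamma> (g i) x l)"
          using elim(2) by (rule fun_cong)
        also have "\<dots> = (\<Sum>i\<in>I. indicator (E N) x * c i x * \<Gamma> (h i) x l)"
          by (intro sum.cong refl fun_cong[OF bspec[OF elim(1)]])
        also have "\<dots> = indicator (E N) x * (\<Sum>i\<in>I. c i x * \<Gamma> (h i) x l)"
          by (simp only: sum_distrib_left mult.assoc)
        finally show ?thesis using fun_cong[OF elim(3), of l] by (simp only:)
      qed
      then show ?case by (rule ext)
    qed
    then show ?thesis using gsum(1) by blast
  qed
  then have "\<forall>N. \<exists>f. f \<in> W \<and> (AE x in tor. \<Gamma> f x = (\<lambda>l. indicator (E N) x * V x l))" ..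
  from choice[OF this] obtain f where "\<forall>N. f N \<in> W \<and> (AE x in tor. \<Gamma> (f N) x = (\<lambda>l. indicator (E N) x * V x l))" ..
  then have f: "\<And>N. f N \<in> W" "\<And>N. AE x in tor. \<Gamma> (f N) x = (\<lambda>l. indicator (E N) x * V x l)" by blast+
  have Vm: "unc V \<in> borel_measurable fib" using sqiD[OF V] by simp
  have EVm: "unc (\<lambda>x l. indicator (E N) x * V x l) \<in> borel_measurable fib" for N
    using unc_measurable[of "\<lambda>x l. indicator (E N) x * V x l"] unc_measurable[of V] Vm
    by (auto intro!: borel_measurable_times borel_measurable_indicator E)
  have lim: "(\<lambda>N. nrm fib (\<lambda>z. unc (\<lambda>x l. indicator (E N) x * V x l) z - unc V z)) \<longlonglongrightarrow> 0"
  proof (rule nrm_dominated_convergence(2)[OF EVm Vm V])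
    show "AE z in fib. cmod (unc (\<lambda>x l. indicator (E N) x * V x l) z) \<le> cmod (unc V z)" for N
      by (intro AE_I2) (auto simp: indicator_def)
    show "AE z in fib. (\<lambda>N. unc (\<lambda>x l. indicator (E N) x * V x l) z) \<longlonglongrightarrow> unc V z"
    proof (intro AE_I2 tendsto_eventually)
      fix z :: "(real ^ 'k) \<times> (int ^ 'k)" assume "z \<in> space fib"
      then have z: "fst z \<in> torus" by (auto simp: fib_def space_pair_measure)
      obtain M where M: "(\<Sum>i\<in>I. cmod (c i (fst z))) \<le> real M" using real_arch_simple by blast
      have "fst z \<in> E N" if "N \<ge> M" for N
      proof -
        have "cmod (c i (fst z)) \<le> real N" if i: "i \<in> I" for i
          using member_le_sum[OF i, of "\<lambda>i. cmod (c i (fst z))"] I M \<open>N \<ge> M\<close> by simp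
        then show ?thesis using z by (simp add: E_def)
      qed
      then show "\<forall>\<^sub>F N in sequentially. unc (\<lambda>x l. indicator (E N) x * V x l) z = unc V z"
        by (intro eventually_sequentiallyI[of M]) (simp add: indicator_def)
    qed
  qed
  have gs: "unc (\<Gamma> (f N)) \<in> sqi fib" for N using f(1) W by (intro Gamma_sqi) (auto intro: shift_invariant_sqi)
  have "nrm fib (\<lambda>z. unc (\<Gamma> (f N)) z - unc V z) = nrm fib (\<lambda>z. unc (\<lambda>x l. indicator (E N) x * V x l) z - unc V z)" for N
  proof (rule nrm_cong)
    have "AE x in tor. \<forall>l. \<Gamma> (f N) x l = indicator (E N) x * V x l"
      using f(2)[of N] by eventually_elim simp
    then have "AE z in fib. \<Gamma> (f N) (fst z) (snd z) = indicator (E N) (fst z) * V (fst z) (snd z)"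
      by (subst AE_fib_iff)
    then show "AE z in fib. unc (\<Gamma> (f N)) z - unc V z = unc (\<lambda>x l. indicator (E N) x * V x l) z - unc V z"
      by eventually_elim simp
  qed (intro borel_measurable_diff sqiD(1)[OF gs] Vm EVm)+
  then have "(\<lambda>N. nrm fib (\<lambda>z. unc (\<Gamma> (f N)) z - unc V z)) \<longlonglongrightarrow> 0" using lim by simp
  from Gamma_image_closed[OF W f(1) V this] show ?thesis .
qed

end

section \<open>Rank one updates with prescribed eigenvalues\<close>

text \<open>Witnesses along a convergent sequence of parameters have a convergent subsequence in
  \<open>K\<close>, and its limit is a witness for the limit parameter.\<close>

lemma compact_projection:
  fixes R :: "('a::metric_space \<times> 'b::metric_space) set"
  assumes K: "compact K" and R: "closed R"
  shows "closed {p. \<exists>y\<in>K. (p, y) \<in> R}"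
  unfolding closed_sequential_limits
proof (intro allI impI, elim conjE)
  fix x l assume x: "\<forall>m. x m \<in> {p. \<exists>y\<in>K. (p, y) \<in> R}" and l: "x \<longlonglongrightarrow> l"
  from x obtain y where y: "\<And>m. y m \<in> K" "\<And>m. (x m, y m) \<in> R" by simp metis
  have "seq_compact K" using K compact_imp_seq_compact by blast
  then obtain z r where z: "z \<in> K" "strict_mono (r::nat \<Rightarrow> nat)" "(y \<circ> r) \<longlonglongrightarrow> z"
    using y(1) unfolding seq_compact_def by metis
  have "(\<lambda>m. (x (r m), y (r m))) \<longlonglongrightarrow> (l, z)"
    using LIMSEQ_subseq_LIMSEQ[OF l z(2)] z(3) by (intro tendsto_Pair) (auto simp: o_def)
  then have "(l, z) \<in> R"
    by (rule closed_sequentially[OF R, rotated]) (use y(2) in simp)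
  then show "l \<in> {p. \<exists>y\<in>K. (p, y) \<in> R}" using z(1) by auto
qed

text \<open>The lexicographically smallest point of each section is a Borel function of the parameter,
  because \<open>s k p \<le> a\<close> is a closed condition on \<open>p\<close> and the earlier coordinates.\<close>

lemma borel_selection_prefix:
  fixes R :: "('p::{metric_space,second_countable_topology} \<times> (nat \<Rightarrow> real)) set"
  assumes K: "compact K" and R: "closed R"
  shows "\<exists>s. (\<forall>k. s k \<in> borel_measurable borel) \<and>
     (\<forall>p. (\<exists>y\<in>K. (p, y) \<in> R) \<longrightarrow> (\<forall>m. \<exists>y\<in>K. (p, y) \<in> R \<and> (\<forall>k<m. y k = s k p)))"
proof -
  define P where "P = {p. \<exists>y\<in>K. (p, y) \<in> R}"
  have P: "closed P" unfolding P_def by (rule compact_projection[OF K R])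
  \<comment> \<open>The second component \<open>t\<close> of the parameter carries the coordinates
    already fixed, so that after projecting out \<open>y\<close> the condition on the next
    coordinate is closed jointly in \<open>p\<close> and \<open>t\<close>.\<close>
  define A where "A m a = {((p, t), y). (p, y) \<in> R \<and> (\<forall>k<m. y k = t k) \<and> y m \<le> a}"
    for m and a :: real
  have cc: "continuous_on UNIV (\<lambda>z::('p \<times> (nat \<Rightarrow> real)) \<times> (nat \<Rightarrow> real). snd z k)"
    "continuous_on UNIV (\<lambda>z::('p \<times> (nat \<Rightarrow> real)) \<times> (nat \<Rightarrow> real). snd (fst z) k)" for k
    by (rule continuous_on_product_then_coordinatewise[OF continuous_on_snd[OF continuous_on_id]]
        continuous_on_product_then_coordinatewise[OF continuous_on_snd[OF continuous_on_fst[OF continuous_on_id]]])+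
  have A: "closed (A m a)" for m a
  proof -
    have "A m a = ((\<lambda>z. (fst (fst z), snd z)) -` R) \<inter> (\<Inter>k\<in>{..<m}. {z. snd z k = snd (fst z) k}) \<inter> {z. snd z m \<le> a}"
      by (auto simp: A_def)
    moreover have "closed ((\<lambda>z::('p \<times> (nat \<Rightarrow> real)) \<times> (nat \<Rightarrow> real). (fst (fst z), snd z)) -` R)"
      by (intro closed_vimage R continuous_on_Pair continuous_on_fst continuous_on_snd continuous_on_id continuous_on_const)
    moreover have "closed {z::('p \<times> (nat \<Rightarrow> real)) \<times> (nat \<Rightarrow> real). snd z k = snd (fst z) k}" for k
      by (intro closed_Collect_eq cc)
    moreover have "closed {z::('p \<times> (nat \<Rightarrow> real)) \<times> (nat \<Rightarrow> real). snd z m \<le> a}"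
      by (intro closed_Collect_le cc continuous_on_const)
    ultimately show ?thesis by (auto intro!: closed_Int closed_INT)
  qed
  define C where "C m a = {q. \<exists>y\<in>K. (q, y) \<in> A m a}" for m a
  have C: "closed (C m a)" for m a unfolding C_def by (rule compact_projection[OF K A])
  define S where "S m p t = {y m | y. y \<in> K \<and> (p, y) \<in> R \<and> (\<forall>k<m. y k = t k)}"
    for m p and t :: "nat \<Rightarrow> real"
  have attained: "Inf (S m p t) \<in> S m p t" if "S m p t \<noteq> {}" for m p t
  proof -
    have "compact (S m p t)"
    proof -
      have "S m p t = (\<lambda>y. y m) ` (K \<inter> ((\<lambda>y. (p, y)) -` R \<inter> (\<Inter>k\<in>{..<m}. {y. y k = t k})))"
        by (auto simp: S_def)
      moreover have "closed ((\<lambda>y. (p, y)) -` R)"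
        by (intro closed_vimage R continuous_on_Pair continuous_on_fst continuous_on_snd continuous_on_id continuous_on_const)
      moreover have "closed {y::nat \<Rightarrow> real. y k = t k}" for k
        by (intro closed_Collect_eq continuous_on_product_coordinates continuous_on_const)
      ultimately show ?thesis
        by (auto intro!: compact_continuous_image compact_Int_closed K closed_Int closed_INT
            intro: continuous_on_subset[OF continuous_on_product_coordinates])
    qed
    then show ?thesis
      using that by (intro closed_contains_Inf compact_imp_closed bounded_imp_bdd_below compact_imp_bounded)
  qed
  have Inf_le: "Inf (S m p t) \<le> a \<longleftrightarrow> (p, t) \<in> C m a" if "S m p t \<noteq> {}" for m p t a
  proof
    assume "Inf (S m p t) \<le> a"
    then show "(p, t) \<in> C m a" using attained[OF that] by (force simp: S_def C_def A_def)
  next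
    assume "(p, t) \<in> C m a"
    then obtain y where y: "y \<in> K" "(p, y) \<in> R" "\<forall>k<m. y k = t k" "y m \<le> a"
      by (auto simp: C_def A_def)
    have "bdd_below (S m p t)"
    proof -
      have "compact ((\<lambda>y. y m) ` K)"
        by (intro compact_continuous_image K continuous_on_subset[OF continuous_on_product_coordinates]) auto
      then have "bdd_below ((\<lambda>y. y m) ` K)" by (intro bounded_imp_bdd_below compact_imp_bounded)
      then show ?thesis by (rule bdd_below_mono) (auto simp: S_def)
    qed
    then have "Inf (S m p t) \<le> y m" by (rule cInf_lower[rotated]) (use y in \<open>auto simp: S_def\<close>)
    then show "Inf (S m p t) \<le> a" using y by simp
  qed
  \<comment> \<open>\<open>T m p\<close> holds the first \<open>m\<close> selected coordinates and 0
    elsewhere; each step replaces the default at position \<open>m\<close> by the least admissible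
    value.\<close>
  define T where "T = rec_nat (\<lambda>p _. 0) (\<lambda>m Tm p. (Tm p)(m := Inf (S m p (Tm p))))"
  have T_Suc: "T (Suc m) p = (T m p)(m := Inf (S m p (T m p)))" for m p
    by (simp add: T_def)
  have ne: "\<exists>y\<in>K. (p, y) \<in> R \<and> (\<forall>k<m. y k = T m p k)" if "p \<in> P" for m p
  proof (induction m)
    case 0
    then show ?case using that by (auto simp: P_def)
  next
    case (Suc m)
    then have "S m p (T m p) \<noteq> {}" by (auto simp: S_def)
    from attained[OF this] show ?case
      by (auto simp: S_def T_Suc less_Suc_eq)
  qed
  have T_meas: "T m \<in> borel_measurable borel" for m
  proof (induction m)
    case 0
    then show ?case by (simp add: T_def)
  next
    case (Suc m)
    have pair: "(\<lambda>p. (p, T m p)) \<in> borel_measurable borel"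
      using Suc by (intro borel_measurable_Pair) auto
    have "(\<lambda>p. Inf (S m p (T m p))) \<in> borel_measurable borel"
    proof (rule borel_measurableI_le)
      fix a
      have Sne: "S m p (T m p) \<noteq> {} \<longleftrightarrow> p \<in> P" for p
        using ne[of p m] by (auto simp: S_def P_def)
      \<comment> \<open>Outside \<open>P\<close> the section is empty and its infimum is the
        constant \<open>Inf {}\<close>, so that part of the sublevel set is either all of the
        complement or empty.\<close>
      have "{p. Inf (S m p (T m p)) \<le> a} = (P \<inter> (\<lambda>p. (p, T m p)) -` C m a) \<union> (- P \<inter> {p. Inf {} \<le> a})"
      proof (intro set_eqI)
        fix p
        show "p \<in> {p. Inf (S m p (T m p)) \<le> a} \<longleftrightarrow> p \<in> (P \<inter> (\<lambda>p. (p, T m p)) -` C m a) \<union> (- P \<inter> {p. Inf {} \<le> a})"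
          using Inf_le[of m p "T m p" a] Sne[of p] by (cases "p \<in> P") auto
      qed
      moreover have "(\<lambda>p. (p, T m p)) -` C m a \<in> sets borel"
        using measurable_sets[OF pair borel_closed[OF C, of m a]] by simp
      ultimately show "{p \<in> space borel. Inf (S m p (T m p)) \<le> a} \<in> sets borel"
        using P by auto
    qed
    moreover have "(\<lambda>p. T m p k) \<in> borel_measurable borel" for k
      using measurable_product_then_coordinatewise[OF Suc] .
    ultimately show ?case
      by (intro measurable_coordinatewise_then_product) (auto simp: T_Suc fun_upd_def)
  qed
  have stable: "k < m \<Longrightarrow> T m p k = T (Suc k) p k" for m k p
    by (induction m) (auto simp: T_Suc less_Suc_eq)
  show ?thesis
  proof (intro exI[of _ "\<lambda>k p. T (Suc k) p k"] conjI allI impI)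
    show "(\<lambda>p. T (Suc k) p k) \<in> borel_measurable borel" for k
      using measurable_product_then_coordinatewise[OF T_meas] .
    fix p m assume "\<exists>y\<in>K. (p, y) \<in> R"
    then obtain y where "y \<in> K" "(p, y) \<in> R" "\<forall>k<m. y k = T m p k"
      using ne[of p m] by (auto simp: P_def)
    then show "\<exists>y\<in>K. (p, y) \<in> R \<and> (\<forall>k<m. y k = T (Suc k) p k)"
      using stable[of _ m p] by metis
  qed
qed

section \<open>Orthogonal matrices and the secular equation\<close>

lemma sum_of_bool_mult:
  fixes g :: "nat \<Rightarrow> real"
  shows "i < n \<Longrightarrow> (\<Sum>j<n. of_bool (i = j) * g j) = g i" "i < n \<Longrightarrow> (\<Sum>j<n. of_bool (i = j)) = (1::real)"
proof -
  assume i: "i < n"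
  have "(\<Sum>j<n. of_bool (i = j) * g j) = (\<Sum>j\<in>{i}. of_bool (i = j) * g j)" for g :: "nat \<Rightarrow> real"
    by (rule sum.mono_neutral_right) (use i in auto)
  from this[of g] this[of "\<lambda>_. 1"] show "(\<Sum>j<n. of_bool (i = j) * g j) = g i" "(\<Sum>j<n. of_bool (i = j)) = (1::real)" by auto
qed

definition orthonormal_columns :: "nat \<Rightarrow> (nat \<Rightarrow> nat \<Rightarrow> real) \<Rightarrow> bool" where
  "orthonormal_columns n Q \<longleftrightarrow> (\<forall>l<n. \<forall>m<n. (\<Sum>i<n. Q i l * Q i m) = of_bool (l = m))"

text \<open>\<open>1 - Q Q\<^sup>T\<close> is a symmetric idempotent of trace zero, hence its entries have zero square sum.\<close>

lemma orthogonal_rows: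
  assumes Q: "orthonormal_columns n Q" and i: "i < n" and j: "j < n"
  shows "(\<Sum>l<n. Q i l * Q j l) = of_bool (i = j)"
proof -
  define P where "P i j = (\<Sum>l<n. Q i l * Q j l)" for i j
  have Q': "(\<Sum>i<n. Q i l * Q i m) = of_bool (l = m)" if "l < n" "m < n" for l m
    using Q that by (auto simp: orthonormal_columns_def)
  have PP: "(\<Sum>j<n. P i j * P i j) = P i i" for i
  proof -
    have "(\<Sum>j<n. P i j * P i j) = (\<Sum>j<n. \<Sum>l<n. \<Sum>m<n. (Q i l * Q i m) * (Q j l * Q j m))"
      unfolding P_def by (simp add: sum_product mult_ac)
    also have "\<dots> = (\<Sum>l<n. \<Sum>m<n. \<Sum>j<n. (Q i l * Q i m) * (Q j l * Q j m))"
      by (subst sum.swap, rule sum.cong[OF refl], rule sum.swap)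
    also have "\<dots> = (\<Sum>l<n. \<Sum>m<n. (Q i l * Q i m) * of_bool (l = m))"
      by (intro sum.cong refl) (simp add: Q' flip: sum_distrib_left)
    also have "\<dots> = (\<Sum>l<n. Q i l * Q i l)"
      by (intro sum.cong refl) (simp add: of_bool_def if_distrib sum.delta cong: if_cong)
    finally show ?thesis by (simp add: P_def)
  qed
  have tr: "(\<Sum>i<n. P i i) = real n"
  proof -
    have "(\<Sum>i<n. P i i) = (\<Sum>l<n. \<Sum>i<n. Q i l * Q i l)"
      unfolding P_def by (rule sum.swap)
    also have "\<dots> = (\<Sum>l<n. 1)" by (intro sum.cong refl) (simp add: Q')
    finally show ?thesis by simp
  qed
  have "(\<Sum>i<n. \<Sum>j<n. (of_bool (i = j) - P i j)\<^sup>2) = (\<Sum>i<n. 1 - P i i)"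
  proof (intro sum.cong refl)
    fix i assume i: "i \<in> {..<n}"
    have "(\<Sum>j<n. (of_bool (i = j) - P i j)\<^sup>2) = (\<Sum>j<n. of_bool (i = j) - 2 * (of_bool (i = j) * P i j) + P i j * P i j)"
      by (intro sum.cong refl) (auto simp: power2_eq_square algebra_simps)
    also have "\<dots> = 1 - 2 * P i i + P i i"
      using i by (simp add: sum.distrib sum_subtractf PP sum_of_bool_mult flip: sum_distrib_left)
    finally show "(\<Sum>j<n. (of_bool (i = j) - P i j)\<^sup>2) = 1 - P i i" by simp
  qed
  also have "\<dots> = 0" by (simp add: sum_subtractf tr)
  finally have "(\<Sum>i<n. \<Sum>j<n. (of_bool (i = j) - P i j)\<^sup>2) = 0" .
  then have "(\<Sum>j<n. (of_bool (i = j) - P i j)\<^sup>2) = 0"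
    using i by (subst (asm) sum_nonneg_eq_0_iff) (auto intro: sum_nonneg)
  then have "(of_bool (i = j) - P i j)\<^sup>2 = 0"
    using j by (subst (asm) sum_nonneg_eq_0_iff) auto
  then show ?thesis by (simp add: P_def)
qed

lemma degree_prod_linear:
  "degree (\<Prod>k\<in>A. [:- f k, 1::real:]) = card A" "lead_coeff (\<Prod>k\<in>A. [:- f k, 1::real:]) = 1" if "finite A"
proof -
  show "degree (\<Prod>k\<in>A. [:- f k, 1::real:]) = card A"
    by (subst degree_prod_eq_sum_degree) auto
  show "lead_coeff (\<Prod>k\<in>A. [:- f k, 1::real:]) = 1"
    by (subst lead_coeff_prod) auto
qed

text \<open>With \<open>p\<close> and \<open>q\<close> the monic polynomials having roots
  \<open>y\<close> and \<open>x\<close>, the number \<open>a i\<close> is minus the residue of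
  \<open>p / q\<close> at \<open>x i\<close>, and the claim is the partial fraction expansion of
  \<open>p / q\<close> at its zero \<open>y l\<close>. It is proved as \<open>q - p = r\<close>:
  both sides have degree below \<open>n\<close> and agree at the \<open>n\<close> distinct points
  \<open>x i\<close>.\<close>

lemma secular_equation:
  fixes x y :: "nat \<Rightarrow> real"
  assumes dist: "inj_on x {..<n}" and ne: "\<And>i. i < n \<Longrightarrow> y l \<noteq> x i" and l: "l < n"
  defines "a \<equiv> \<lambda>i. (y i - x i) * (\<Prod>k\<in>{..<n}-{i}. (x i - y k) / (x i - x k))"
  shows "(\<Sum>i<n. a i / (y l - x i)) = 1"
proof -
  define p where "p = (\<Prod>k<n. [:- y k, 1:])"
  define q where "q = (\<Prod>k<n. [:- x k, 1:])"
  define r where "r = (\<Sum>i<n. smult (a i) (\<Prod>k\<in>{..<n}-{i}. [:- x k, 1:]))"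
  have n: "n > 0" using l by simp
  have "degree (q - p) < n"
  proof -
    have "degree p = n" "degree q = n" "coeff p n = 1" "coeff q n = 1"
      using degree_prod_linear[of "{..<n}" y] degree_prod_linear[of "{..<n}" x] by (auto simp: p_def q_def)
    then have "degree (q - p) \<le> n" "coeff (q - p) n = 0"
      using degree_diff_le[of q n p] by auto
    then show ?thesis using n
      by (metis coeff_eq_0 le_neq_implies_less leading_coeff_0_iff degree_0)
  qed
  moreover have "degree r < n"
  proof -
    have "degree r \<le> n - 1"
      unfolding r_def
    proof (rule degree_sum_le)
      fix i assume "i \<in> {..<n}"
      then have "degree (\<Prod>k\<in>{..<n}-{i}. [:- x k, 1:]) = n - 1"
        by (subst degree_prod_linear) auto
      then show "degree (smult (a i) (\<Prod>k\<in>{..<n}-{i}. [:- x k, 1:])) \<le> n - 1"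
        using degree_smult_le[of "a i"] by metis
    qed simp
    then show ?thesis using n by simp
  qed
  moreover have "poly (q - p) t = poly r t" if t: "t \<in> x ` {..<n}" for t
  proof -
    from t obtain i where i: "i < n" "t = x i" by auto
    have "poly q t = 0" using i by (auto simp: q_def poly_prod)
    moreover have "poly r t = a i * (\<Prod>k\<in>{..<n}-{i}. x i - x k)"
    proof -
      have "poly r t = (\<Sum>j<n. a j * (\<Prod>k\<in>{..<n}-{j}. x i - x k))"
        by (simp add: r_def poly_sum poly_prod i)
      also have "\<dots> = (\<Sum>j\<in>{i}. a j * (\<Prod>k\<in>{..<n}-{j}. x i - x k))"
        using i by (intro sum.mono_neutral_right) (auto simp: prod_zero_iff)
      finally show ?thesis by simp
    qed
    moreover have "(\<Prod>k\<in>{..<n}-{i}. (x i - y k) / (x i - x k)) * (\<Prod>k\<in>{..<n}-{i}. x i - x k) = (\<Prod>k\<in>{..<n}-{i}. x i - y k)"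
      unfolding prod.distrib[symmetric]
      using dist i by (intro prod.cong refl) (auto simp: inj_on_def)
    moreover have "poly p t = (x i - y i) * (\<Prod>k\<in>{..<n}-{i}. x i - y k)"
      using i by (simp add: p_def poly_prod prod.remove[of "{..<n}" i] left_diff_distrib)
    ultimately have "poly r t = (y i - x i) * (\<Prod>k\<in>{..<n}-{i}. x i - y k)"
      "poly (q - p) t = - ((x i - y i) * (\<Prod>k\<in>{..<n}-{i}. x i - y k))"
      by (simp_all only: a_def mult.assoc poly_diff diff_0)
    then show ?thesis by (simp only: minus_mult_left minus_diff_eq)
  qed
  moreover have "card (x ` {..<n}) = n" by (simp add: card_image dist)
  ultimately have "q - p = r"
    using poly_eqI_degree[of "x ` {..<n}" "q - p" r] by auto
  then have "poly q (y l) - poly p (y l) = poly r (y l)" by auto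
  moreover have "poly p (y l) = 0" using l by (auto simp: p_def poly_prod)
  moreover have qne: "poly q (y l) \<noteq> 0" using ne by (auto simp: q_def poly_prod)
  moreover have "poly r (y l) = (\<Sum>i<n. a i / (y l - x i)) * poly q (y l)"
  proof -
    have "(\<Prod>k\<in>{..<n}-{i}. y l - x k) = poly q (y l) / (y l - x i)" if "i < n" for i
      using that ne by (simp add: q_def poly_prod prod.remove[of "{..<n}" i] left_diff_distrib[symmetric])
    then show ?thesis by (simp add: r_def poly_sum poly_prod sum_distrib_right)
  qed
  ultimately show ?thesis by simp
qed

text \<open>Interlacing makes every \<open>a i\<close> positive, so \<open>c i = sqrt (a i)\<close>
  exists. By the secular equation the vector with entries \<open>c i / (y l - x i)\<close> is an
  eigenvector of \<open>diag x + c c^T\<close> for \<open>y l\<close>; dividing by its length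
  \<open>N l\<close> gives the columns of \<open>Q\<close>. The matrix identity follows from the
  eigenvector equation and orthonormality of the rows.\<close>

lemma rank_one_strict:
  fixes x y :: "nat \<Rightarrow> real"
  assumes xy: "\<And>i. i < n \<Longrightarrow> x i < y i" and yx: "\<And>i. Suc i < n \<Longrightarrow> y (Suc i) < x i"
  shows "\<exists>c Q. orthonormal_columns n Q \<and>
    (\<forall>i<n. \<forall>j<n. of_bool (i = j) * x i + c i * c j = (\<Sum>l<n. Q i l * y l * Q j l))"
proof -
  have lt: "y j < x i" if "i < j" "j < n" for i j
    using that
  proof (induction rule: less_Suc_induct)
    case (1 i)
    then show ?case using yx by simp
  next
    case (2 i j k)
    then show ?case using xy[of j] by force
  qed
  have xdec: "x j < x i" and ydec: "y j < y i" if "i < j" "j < n" for i j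
    using lt[OF that] xy[of i] xy[of j] that by auto
  have xinj: "inj_on x {..<n}" and yinj: "inj_on y {..<n}"
    using xdec ydec by (auto simp: inj_on_def) (metis nat_neq_iff less_irrefl)+
  have ne: "y l \<noteq> x i" if "i < n" "l < n" for i l
    using lt[of i l] xy[of i] ydec[of l i] that by (metis less_irrefl linorder_neqE_nat less_asym order.strict_trans)
  define a where "a = (\<lambda>i. (y i - x i) * (\<Prod>k\<in>{..<n}-{i}. (x i - y k) / (x i - x k)))"
  have a: "a i > 0" if "i < n" for i
    unfolding a_def
  proof (intro mult_pos_pos prod_pos)
    show "0 < y i - x i" using xy that by simp
    fix k assume k: "k \<in> {..<n}-{i}"
    show "0 < (x i - y k) / (x i - x k)"
    proof (cases "k < i")
      case True
      then show ?thesis using xdec[of k i] xy[of k] that by (intro divide_neg_neg) auto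
    next
      case False
      then show ?thesis using xdec[of i k] lt[of i k] that k by (intro divide_pos_pos) auto
    qed
  qed
  have sec: "(\<Sum>i<n. a i / (y l - x i)) = 1" if "l < n" for l
    unfolding a_def by (rule secular_equation[OF xinj ne that]) (use that in auto)
  define c where "c i = sqrt (a i)" for i
  have cc: "c i * c i = a i" if "i < n" for i using a[OF that] by (simp add: c_def)
  define N where "N l = sqrt (\<Sum>i<n. a i / (y l - x i)\<^sup>2)" for l
  have N: "N l > 0" "N l * N l = (\<Sum>i<n. a i / (y l - x i)\<^sup>2)" if "l < n" for l
  proof -
    have "(\<Sum>i<n. a i / (y l - x i)\<^sup>2) > 0"
      using that a ne by (intro sum_pos) auto
    then show "N l > 0" "N l * N l = (\<Sum>i<n. a i / (y l - x i)\<^sup>2)" by (simp_all add: N_def)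
  qed
  define Q where "Q i l = c i / (y l - x i) / N l" for i l
  have orth: "orthonormal_columns n Q"
    unfolding orthonormal_columns_def
  proof (intro allI impI)
    fix l m assume lm: "l < n" "m < n"
    have "(\<Sum>i<n. Q i l * Q i m) = (\<Sum>i<n. a i / ((y l - x i) * (y m - x i))) / (N l * N m)"
      unfolding sum_divide_distrib
      by (intro sum.cong refl) (simp add: Q_def flip: cc)
    also have "\<dots> = of_bool (l = m)"
    proof (cases "l = m")
      case True
      show ?thesis
        unfolding True power2_eq_square[symmetric] N(2)[OF lm(2), symmetric] using N(1)[OF lm(2)] by simp
    next
      case False
      then have yn: "y l - y m \<noteq> 0" using yinj lm by (auto simp: inj_on_def)
      \<comment> \<open>Partial fractions write the inner product of two columns as a difference of
        two secular sums, both equal to 1.\<close>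
      have "(\<Sum>i<n. a i / ((y l - x i) * (y m - x i))) = (\<Sum>i<n. (a i / (y m - x i) - a i / (y l - x i)) / (y l - y m))"
      proof (intro sum.cong refl)
        fix i assume "i \<in> {..<n}"
        then have "y l - x i \<noteq> 0" "y m - x i \<noteq> 0" using ne lm by auto
        then show "a i / ((y l - x i) * (y m - x i)) = (a i / (y m - x i) - a i / (y l - x i)) / (y l - y m)"
          using yn by (simp add: divide_simps) (simp add: algebra_simps)
      qed
      also have "\<dots> = 0" using sec lm by (simp add: sum_subtractf flip: sum_divide_distrib)
      finally show ?thesis using False by simp
    qed
    finally show "(\<Sum>i<n. Q i l * Q i m) = of_bool (l = m)" .
  qed
  \<comment> \<open>The pairing of \<open>c\<close> with the \<open>l\<close>-th column is the
    secular sum divided by \<open>N l\<close>, that is \<open>1 / N l\<close>; the eigenvector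
    equation is then a rearrangement of the definition of \<open>Q\<close>.\<close>
  have eig: "y l * Q j l = x j * Q j l + c j * (\<Sum>k<n. c k * Q k l)" if "j < n" "l < n" for j l
  proof -
    have "(\<Sum>k<n. c k * Q k l) = (\<Sum>k<n. a k / (y l - x k)) / N l"
      unfolding sum_divide_distrib by (intro sum.cong refl) (simp add: Q_def flip: cc)
    also have "\<dots> = 1 / N l" using sec that by simp
    finally have S: "(\<Sum>k<n. c k * Q k l) = 1 / N l" .
    show ?thesis unfolding S using that ne[of j l] N(1)[of l] by (simp add: Q_def field_simps)
  qed
  have "of_bool (i = j) * x i + c i * c j = (\<Sum>l<n. Q i l * y l * Q j l)" if ij: "i < n" "j < n" for i j
  proof -
    have "(\<Sum>l<n. Q i l * y l * Q j l) = (\<Sum>l<n. x j * (Q i l * Q j l) + c j * (\<Sum>k<n. c k * (Q i l * Q k l)))"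
    proof (intro sum.cong refl)
      fix l assume "l \<in> {..<n}"
      then have "Q i l * (y l * Q j l) = Q i l * (x j * Q j l + c j * (\<Sum>k<n. c k * Q k l))"
        using eig ij by simp
      then show "Q i l * y l * Q j l = x j * (Q i l * Q j l) + c j * (\<Sum>k<n. c k * (Q i l * Q k l))"
        by (simp add: algebra_simps sum_distrib_left)
    qed
    also have "\<dots> = x j * (\<Sum>l<n. Q i l * Q j l) + c j * (\<Sum>k<n. c k * (\<Sum>l<n. Q i l * Q k l))"
      unfolding sum.distrib sum_distrib_left[symmetric]
      by (subst sum.swap) (simp add: sum_distrib_left)
    also have "\<dots> = x j * of_bool (i = j) + c j * (\<Sum>k<n. c k * of_bool (i = k))"
      using orthogonal_rows[OF orth] ij by simp
    also have "(\<Sum>k<n. c k * of_bool (i = k)) = c i"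
      using ij by (simp add: sum_of_bool_mult mult.commute)
    finally show ?thesis by (simp add: mult_ac)
  qed
  with orth show ?thesis by blast
qed

section \<open>Compactness and weak interlacing\<close>

lemma tendsto_coordinatewise:
  fixes X :: "nat \<Rightarrow> 'i \<Rightarrow> 'a::topological_space"
  assumes "\<And>i. (\<lambda>k. X k i) \<longlonglongrightarrow> x i"
  shows "X \<longlonglongrightarrow> x"
proof -
  have "limitin (product_topology (\<lambda>_. euclidean) UNIV) X x sequentially"
    using assms by (simp add: limitin_componentwise)
  then show ?thesis by (simp add: euclidean_product_topology)
qed

text \<open>Tychonoff's theorem for the product topology on real sequences.\<close>

lemma compact_bounded_functions:
  "compact {y :: nat \<Rightarrow> real. \<forall>k. \<bar>y k\<bar> \<le> B}"
proof -
  have "compactin (product_topology (\<lambda>_. euclidean) UNIV) (PiE UNIV (\<lambda>_::nat. {-B..B}))"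
    by (subst compactin_PiE) auto
  moreover have "PiE UNIV (\<lambda>_. {-B..B}) = {y :: nat \<Rightarrow> real. \<forall>k. \<bar>y k\<bar> \<le> B}"
    by (auto simp: PiE_iff abs_le_iff minus_le_iff)
  ultimately show ?thesis
    by (simp add: euclidean_product_topology)
qed

text \<open>The matrix identity \<open>diag x + c c^T = Q diag y Q^T\<close> with \<open>Q\<close>
  orthogonal, written entrywise so that it is visibly a closed condition on all data.\<close>

definition rank_one_update ::
  "nat \<Rightarrow> (nat \<Rightarrow> real) \<Rightarrow> (nat \<Rightarrow> real) \<Rightarrow> (nat \<Rightarrow> real) \<Rightarrow> (nat \<Rightarrow> nat \<Rightarrow> real) \<Rightarrow> bool" where
  "rank_one_update n x y c Q \<longleftrightarrow> orthonormal_columns n Q \<and>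
    (\<forall>i<n. \<forall>j<n. of_bool (i = j) * x i + c i * c j = (\<Sum>l<n. Q i l * y l * Q j l))"

text \<open>Rows of \<open>Q\<close> are unit vectors, so the diagonal entry
  \<open>x i + c i * c i\<close> is an average of the \<open>y l\<close> and hence at most
  \<open>B\<close>. Because \<open>B \<ge> 1\<close>, a bound \<open>B\<close> on the square also
  bounds the entry itself.\<close>

lemma rank_one_update_bounds:
  assumes u: "rank_one_update n x y c Q" and x: "\<And>i. i < n \<Longrightarrow> 0 \<le> x i"
    and y: "\<And>i. i < n \<Longrightarrow> y i \<le> B" and B: "B \<ge> 1" and i: "i < n"
  shows "\<bar>c i\<bar> \<le> B" "j < n \<Longrightarrow> \<bar>Q i j\<bar> \<le> B"
proof -
  have Q: "orthonormal_columns n Q" using u by (simp add: rank_one_update_def)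
  have one: "(\<Sum>l<n. Q i l * Q i l) = 1" using orthogonal_rows[OF Q i i] by simp
  have "x i + c i * c i = (\<Sum>l<n. Q i l * y l * Q i l)"
    using u i unfolding rank_one_update_def by fastforce
  also have "\<dots> \<le> (\<Sum>l<n. B * (Q i l * Q i l))"
  proof (intro sum_mono)
    fix l assume "l \<in> {..<n}"
    then show "Q i l * y l * Q i l \<le> B * (Q i l * Q i l)"
      using mult_right_mono[OF y[of l], of "Q i l * Q i l"] by (simp add: mult_ac)
  qed
  also have "\<dots> = B" by (simp add: one flip: sum_distrib_left)
  finally have "(c i)\<^sup>2 \<le> B" using x[OF i] by (simp add: power2_eq_square)
  also have "B \<le> B\<^sup>2" using B by (simp add: power2_eq_square)
  finally show "\<bar>c i\<bar> \<le> B" using abs_le_square_iff[of "c i" B] B by simp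
  assume j: "j < n"
  have "Q i j * Q i j \<le> (\<Sum>l<n. Q i l * Q i l)"
    by (rule member_le_sum) (use j in auto)
  then have "(Q i j)\<^sup>2 \<le> 1" using one by (simp add: power2_eq_square)
  then have "\<bar>Q i j\<bar> \<le> 1" by (simp add: abs_square_le_1)
  then show "\<bar>Q i j\<bar> \<le> B" using B by simp
qed

text \<open>Nonnegativity and the bound \<open>B\<close> are part of the notion because they confine
  the possible updates to a compact set that does not depend on \<open>x\<close> and
  \<open>y\<close>.\<close>

definition interlaced :: "nat \<Rightarrow> real \<Rightarrow> (nat \<Rightarrow> real) \<Rightarrow> (nat \<Rightarrow> real) \<Rightarrow> bool" where
  "interlaced n B x y \<longleftrightarrow>
     (\<forall>i<n. 0 \<le> x i \<and> x i \<le> y i \<and> y i \<le> B \<and> (Suc i < n \<longrightarrow> y (Suc i) \<le> x i))"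

text \<open>Weakly interlacing sequences are limits of strictly interlacing ones, so existence follows
  from the strict case by compactness; the same compactness yields a Borel choice.\<close>

theorem rank_one_measurable:
  fixes n :: nat and B :: real
  obtains c :: "nat \<Rightarrow> (nat \<Rightarrow> real) \<times> (nat \<Rightarrow> real) \<Rightarrow> real"
    and Q :: "nat \<Rightarrow> nat \<Rightarrow> (nat \<Rightarrow> real) \<times> (nat \<Rightarrow> real) \<Rightarrow> real"
  where "\<And>i. c i \<in> borel_measurable borel" "\<And>i l. Q i l \<in> borel_measurable borel"
    and "\<And>x y. interlaced n B x y \<Longrightarrow> rank_one_update n x y (\<lambda>i. c i (x, y)) (\<lambda>i l. Q i l (x, y))"
proof -
  \<comment> \<open>The strict perturbation below raises eigenvalues by at most 1, and the entry
    bounds require a constant that is at least 1.\<close>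
  define C where "C = max 1 (B + 1)"
  \<comment> \<open>One sequence \<open>w\<close> encodes both unknowns: the code of
    \<open>(i, l)\<close> with \<open>l < n\<close> holds the matrix entry \<open>Q i l\<close>, and
    the extra column \<open>l = n\<close> holds \<open>c i\<close>.\<close>
  define cc where "cc = (\<lambda>(w :: nat \<Rightarrow> real) i. w (prod_encode (i, n)))"
  define QQ where "QQ = (\<lambda>(w :: nat \<Rightarrow> real) i l. w (prod_encode (i, l)))"
  define R where "R = {((x, y), w). rank_one_update n x y (cc w) (QQ w)}"
  define K where "K = {w :: nat \<Rightarrow> real. \<forall>k. \<bar>w k\<bar> \<le> C}"
  have K: "compact K" unfolding K_def by (rule compact_bounded_functions)
  have cQ: "continuous_on UNIV (\<lambda>z::((nat \<Rightarrow> real) \<times> (nat \<Rightarrow> real)) \<times> (nat \<Rightarrow> real). QQ (snd z) i l)" for i l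
    unfolding QQ_def by (rule continuous_on_product_then_coordinatewise) (intro continuous_on_snd continuous_on_id)
  have cC: "continuous_on UNIV (\<lambda>z::((nat \<Rightarrow> real) \<times> (nat \<Rightarrow> real)) \<times> (nat \<Rightarrow> real). cc (snd z) i)" for i
    unfolding cc_def by (rule continuous_on_product_then_coordinatewise) (intro continuous_on_snd continuous_on_id)
  have cx: "continuous_on UNIV (\<lambda>z::((nat \<Rightarrow> real) \<times> (nat \<Rightarrow> real)) \<times> (nat \<Rightarrow> real). fst (fst z) i)" for i
    by (rule continuous_on_product_then_coordinatewise) (intro continuous_on_fst continuous_on_id)
  have cy: "continuous_on UNIV (\<lambda>z::((nat \<Rightarrow> real) \<times> (nat \<Rightarrow> real)) \<times> (nat \<Rightarrow> real). snd (fst z) i)" for i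
    by (rule continuous_on_product_then_coordinatewise) (intro continuous_on_fst continuous_on_snd continuous_on_id)
  have R: "closed R"
  proof -
    have "R = {z. rank_one_update n (fst (fst z)) (snd (fst z)) (cc (snd z)) (QQ (snd z))}"
      by (auto simp: R_def)
    also have "closed \<dots>"
      unfolding rank_one_update_def orthonormal_columns_def
      apply (intro closed_Collect_conj closed_Collect_all closed_Collect_imp open_Collect_const)
      apply (rule closed_Collect_eq)
      apply (rule continuous_on_sum continuous_on_mult cQ continuous_on_const)+
      apply (rule closed_Collect_eq)
      apply (rule continuous_on_sum continuous_on_add continuous_on_mult cQ cC cx cy continuous_on_const)+
      done
    finally show ?thesis .
  qed
  have strict: "\<exists>w\<in>K. ((x, y), w) \<in> R"
    if "\<And>i. i < n \<Longrightarrow> 0 \<le> x i \<and> x i < y i \<and> y i \<le> C" "\<And>i. Suc i < n \<Longrightarrow> y (Suc i) < x i" for x y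
  proof -
    have "\<exists>c Q. rank_one_update n x y c Q"
      unfolding rank_one_update_def by (rule rank_one_strict) (use that in auto)
    then obtain c Q where u: "rank_one_update n x y c Q" by blast
    define w where "w k = (case prod_decode k of (i, l) \<Rightarrow> if i < n \<and> l < n then Q i l else if i < n \<and> l = n then c i else 0)" for k
    have "cc w i = c i" "l < n \<Longrightarrow> QQ w i l = Q i l" if "i < n" for i l
      using that by (auto simp: cc_def QQ_def w_def)
    then have "rank_one_update n x y (cc w) (QQ w)"
      using u by (simp add: rank_one_update_def orthonormal_columns_def)
    moreover have "\<bar>c i\<bar> \<le> C" "l < n \<Longrightarrow> \<bar>Q i l\<bar> \<le> C" if "i < n" for i l
      using rank_one_update_bounds[OF u, of C i] that \<open>\<And>i. i < n \<Longrightarrow> 0 \<le> x i \<and> x i < y i \<and> y i \<le> C\<close>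
      by (auto simp: C_def)
    then have "w \<in> K" by (auto simp: K_def w_def C_def split: prod.split)
    ultimately show ?thesis by (auto simp: R_def)
  qed
  have weak: "\<exists>w\<in>K. ((x, y), w) \<in> R" if xy: "interlaced n B x y" for x y
  proof -
    \<comment> \<open>The shift of \<open>Y\<close> at \<open>i\<close> is
      \<open>2 * (n - i) + 2\<close> units of \<open>e k\<close>, that of \<open>X\<close> at
      \<open>i\<close> is one unit less, and that of \<open>Y\<close> at \<open>Suc i\<close> is one
      unit less again, so weak inequalities become strict. The largest shift is at most
      \<open>2 * n + 2\<close> units, and the denominator keeps it within 1.\<close>
    define e where "e k = inverse (real (Suc k)) / (2 * real n + 2)" for k
    have e: "e k > 0" "e k * (2 * real n + 2) \<le> 1" for k by (auto simp: e_def inverse_le_1_iff)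
    have e0: "e \<longlonglongrightarrow> 0" unfolding e_def divide_inverse by (rule tendsto_mult_left_zero[OF LIMSEQ_inverse_real_of_nat])
    define X where "X k i = x i + e k * (2 * (real n - real i) + 1)" for k i
    define Y where "Y k i = y i + e k * (2 * (real n - real i) + 2)" for k i
    have "\<exists>w\<in>K. ((X k, Y k), w) \<in> R" for k
    proof (rule strict)
      fix i assume i: "i < n"
      have "e k * (2 * (real n - real i) + 1) \<ge> 0"
        using e(1)[of k] i by (intro mult_nonneg_nonneg) auto
      moreover have "e k * (2 * (real n - real i) + 1) < e k * (2 * (real n - real i) + 2)"
        using e(1)[of k] by simp
      moreover have "e k * (2 * (real n - real i) + 2) \<le> e k * (2 * real n + 2)"
        using e(1)[of k] by simp
      ultimately show "0 \<le> X k i \<and> X k i < Y k i \<and> Y k i \<le> C"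
        using spec[OF xy[unfolded interlaced_def], of i] i e(2)[of k] by (simp add: X_def Y_def C_def)
    next
      fix i assume i: "Suc i < n"
      have "e k * (2 * (real n - real (Suc i)) + 2) < e k * (2 * (real n - real i) + 1)"
        using e(1)[of k] by simp
      then show "Y k (Suc i) < X k i"
        using spec[OF xy[unfolded interlaced_def], of i] i by (simp add: X_def Y_def)
    qed
    moreover have "(\<lambda>k. (X k, Y k)) \<longlonglongrightarrow> (x, y)"
    proof (intro tendsto_Pair)
      have *: "(\<lambda>k. a + e k * b) \<longlonglongrightarrow> a" for a b
        using tendsto_add[OF tendsto_const[of a] tendsto_mult[OF e0 tendsto_const[of b]]] by simp
      show "X \<longlonglongrightarrow> x" by (rule tendsto_coordinatewise) (unfold X_def, rule *)
      show "Y \<longlonglongrightarrow> y" by (rule tendsto_coordinatewise) (unfold Y_def, rule *)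
    qed
    ultimately show ?thesis
      using closed_sequentially[OF compact_projection[OF K R], of "\<lambda>k. (X k, Y k)" "(x, y)"] by (simp only: mem_Collect_eq)
  qed
  from borel_selection_prefix[OF K R] obtain s where s: "\<forall>k. s k \<in> borel_measurable borel"
    "\<forall>p. (\<exists>w\<in>K. (p, w) \<in> R) \<longrightarrow> (\<forall>m. \<exists>w\<in>K. (p, w) \<in> R \<and> (\<forall>k<m. w k = s k p))"
    by (elim exE conjE)
  show ?thesis
  proof (rule that[of "\<lambda>i. s (prod_encode (i, n))" "\<lambda>i l. s (prod_encode (i, l))"])
    fix x y assume "interlaced n B x y"
    \<comment> \<open>Larger than every code that \<open>rank_one_update\<close> looks at. The
      selection agrees with a true solution on this finite prefix, and the relation depends on
      nothing else.\<close>
    define m where "m = Suc (Max (prod_encode ` ({..n} \<times> {..n})))"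
    have m: "prod_encode (i, l) < m" if "i \<le> n" "l \<le> n" for i l
      unfolding m_def less_Suc_eq_le using that by (intro Max_ge) auto
    from mp[OF spec[OF s(2)] weak[OF \<open>interlaced n B x y\<close>], THEN spec, of m] obtain w where
      w: "((x, y), w) \<in> R" "\<forall>k<m. w k = s k (x, y)" by auto
    then have "cc w i = s (prod_encode (i, n)) (x, y)" "l < n \<Longrightarrow> QQ w i l = s (prod_encode (i, l)) (x, y)"
      if "i < n" for i l
      using that m by (auto simp: cc_def QQ_def)
    then show "rank_one_update n x y (\<lambda>i. s (prod_encode (i, n)) (x, y)) (\<lambda>i l. s (prod_encode (i, l)) (x, y))"
      using w(1) by (simp add: R_def rank_one_update_def orthonormal_columns_def)
  qed (use s in auto)
qed

section \<open>Bessel sequences\<close>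

lemma inn_add_left:
  assumes "f \<in> sqi M" "g \<in> sqi M" "h \<in> sqi M"
  shows "inn M (\<lambda>x. f x + g x) h = inn M f h + inn M g h"
  unfolding inn_def using sqi_mult_integrable[OF assms(1,3)] sqi_mult_integrable[OF assms(2,3)]
  by (simp add: distrib_right)

lemma inn_scale_left: "inn M (\<lambda>x. c * f x) h = c * inn M f h"
  unfolding inn_def by (simp only: mult.assoc integral_mult_right_zero)

lemma inn_cnj: "cnj (inn M f g) = inn M g f"
  unfolding inn_def by (subst Bochner_Integration.integral_cnj[symmetric]) (simp add: mult.commute)

lemma inn_zero_left [simp]: "inn M (\<lambda>x. 0) h = 0"
  by (simp add: inn_def)

lemma inn_sum_left:
  assumes "\<And>i. i \<in> I \<Longrightarrow> f i \<in> sqi M" "h \<in> sqi M"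
  shows "inn M (\<lambda>x. \<Sum>i\<in>I. c i * f i x) h = (\<Sum>i\<in>I. c i * inn M (f i) h)"
  using assms(1)
proof (induction I rule: infinite_finite_induct)
  case (insert i I)
  then show ?case
    by (simp add: inn_add_left[OF sqi_scale sqi_sum[OF sqi_scale]] assms inn_scale_left)
qed auto

lemma inn_sum_right:
  assumes "\<And>i. i \<in> I \<Longrightarrow> f i \<in> sqi M" "h \<in> sqi M"
  shows "inn M h (\<lambda>x. \<Sum>i\<in>I. c i * f i x) = (\<Sum>i\<in>I. cnj (c i) * inn M h (f i))"
proof -
  have "inn M h (\<lambda>x. \<Sum>i\<in>I. c i * f i x) = cnj (inn M (\<lambda>x. \<Sum>i\<in>I. c i * f i x) h)"
    by (simp only: inn_cnj)
  also have "\<dots> = (\<Sum>i\<in>I. cnj (c i) * cnj (inn M (f i) h))"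
    by (subst inn_sum_left[OF assms]) auto
  finally show ?thesis by (simp only: inn_cnj)
qed

lemma inn_diff_left:
  assumes "f \<in> sqi M" "g \<in> sqi M" "h \<in> sqi M"
  shows "inn M (\<lambda>x. f x - g x) h = inn M f h - inn M g h"
  using inn_add_left[OF assms(1) sqi_scale[OF assms(2), of "-1"] assms(3)] inn_scale_left[of M "-1" g h] by simp

lemma inn_self: "inn M f f = complex_of_real ((nrm M f)\<^sup>2)"
  unfolding inn_def nrm_squared by (simp only: complex_norm_square[symmetric] integral_complex_of_real)

text \<open>The difference of the two sides is the squared norm of \<open>f - S\<close>, with
  \<open>S\<close> the orthogonal projection of \<open>f\<close> onto the span of the
  system.\<close>

lemma bessel_inequality:
  assumes f: "f \<in> sqi M" and I: "finite I" and \<phi>: "\<And>i. i \<in> I \<Longrightarrow> \<phi> i \<in> sqi M"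
    and on: "\<And>i j. i \<in> I \<Longrightarrow> j \<in> I \<Longrightarrow> inn M (\<phi> i) (\<phi> j) = of_bool (i = j)"
  shows "(\<Sum>i\<in>I. (cmod (inn M f (\<phi> i)))\<^sup>2) \<le> (nrm M f)\<^sup>2"
proof -
  define S where "S = (\<lambda>x. \<Sum>i\<in>I. inn M f (\<phi> i) * \<phi> i x)"
  have S: "S \<in> sqi M" unfolding S_def by (intro sqi_sum sqi_scale \<phi>)
  have Sj: "inn M S (\<phi> j) = inn M f (\<phi> j)" if "j \<in> I" for j
  proof -
    have "inn M S (\<phi> j) = (\<Sum>i\<in>I. inn M f (\<phi> i) * of_bool (i = j))"
      unfolding S_def using \<phi> that by (subst inn_sum_left) (auto simp: on)
    also have "\<dots> = inn M f (\<phi> j)"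
      using that I by (simp add: of_bool_def if_distrib sum.delta cong: if_cong)
    finally show ?thesis .
  qed
  have cross: "inn M g S = (\<Sum>i\<in>I. cnj (inn M f (\<phi> i)) * inn M g (\<phi> i))" if "g \<in> sqi M" for g
    unfolding S_def by (rule inn_sum_right[OF \<phi> that])
  have fS: "inn M f S = complex_of_real (\<Sum>i\<in>I. (cmod (inn M f (\<phi> i)))\<^sup>2)"
    unfolding cross[OF f] by (simp only: of_real_sum complex_norm_square mult.commute)
  have SS: "inn M S S = complex_of_real (\<Sum>i\<in>I. (cmod (inn M f (\<phi> i)))\<^sup>2)"
    unfolding cross[OF S] of_real_sum
    by (intro sum.cong refl) (simp only: Sj complex_norm_square mult.commute)
  have d: "(\<lambda>x. f x - S x) \<in> sqi M" by (rule sqi_diff[OF f S])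
  have Sd: "inn M g (\<lambda>x. f x - S x) = inn M g f - inn M g S" if "g \<in> sqi M" for g
    using inn_diff_left[OF f S that] arg_cong[of _ _ cnj] by (metis inn_cnj complex_cnj_diff)
  have Sf: "inn M S f = inn M f S" using inn_cnj[of M f S] fS by simp
  have "inn M (\<lambda>x. f x - S x) (\<lambda>x. f x - S x) = inn M f f - inn M f S"
    unfolding inn_diff_left[OF f S d] Sd[OF f] Sd[OF S] Sf SS fS by simp
  then have "complex_of_real ((nrm M (\<lambda>x. f x - S x))\<^sup>2) = complex_of_real ((nrm M f)\<^sup>2 - (\<Sum>i\<in>I. (cmod (inn M f (\<phi> i)))\<^sup>2))"
    unfolding inn_self fS by simp
  then have "(nrm M f)\<^sup>2 - (\<Sum>i\<in>I. (cmod (inn M f (\<phi> i)))\<^sup>2) = (nrm M (\<lambda>x. f x - S x))\<^sup>2"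
    by (simp only: of_real_eq_iff)
  then show ?thesis using zero_le_power2[of "nrm M (\<lambda>x. f x - S x)"] by linarith
qed

text \<open>Bessel's inequality for the one-element system consisting of the normalized
  \<open>g\<close>; the degenerate case \<open>nrm M g = 0\<close> is treated apart.\<close>

lemma inn_Cauchy_Schwarz:
  assumes f: "f \<in> sqi M" and g: "g \<in> sqi M"
  shows "cmod (inn M f g) \<le> nrm M f * nrm M g"
proof (cases "nrm M g = 0")
  case True
  then have "AE x in M. g x = 0" using nrm_eq_zero_iff[OF g] by simp
  then have "inn M f g = (LINT x|M. 0)"
    unfolding inn_def using sqiD[OF f] sqiD[OF g] by (intro integral_cong_AE) auto
  then show ?thesis using True by simp
next
  case False
  define h where "h x = complex_of_real (1 / nrm M g) * g x" for x
  have h: "h \<in> sqi M" unfolding h_def by (rule sqi_scale[OF g])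
  have "nrm M h = 1" unfolding h_def nrm_scale using False by (simp add: norm_divide)
  then have "inn M h h = 1" by (simp add: inn_self)
  then have b: "(cmod (inn M f h))\<^sup>2 \<le> (nrm M f)\<^sup>2"
    using bessel_inequality[OF f, of "{()}" "\<lambda>_. h"] h by simp
  have "inn M f h = cnj (complex_of_real (1 / nrm M g)) * inn M f g"
    using arg_cong[OF inn_scale_left[of M "complex_of_real (1 / nrm M g)" g f], of cnj]
    unfolding h_def complex_cnj_mult inn_cnj .
  then have "cmod (inn M f h) = cmod (inn M f g) / nrm M g" by (simp add: norm_mult norm_divide)
  moreover have "cmod (inn M f h) \<le> nrm M f" by (rule power2_le_imp_le[OF b]) simp
  ultimately have "cmod (inn M f g) / nrm M g * nrm M g \<le> nrm M f * nrm M g"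
    by (intro mult_right_mono) auto
  then show ?thesis using False by simp
qed

section \<open>Single fibers and their inner products\<close>

abbreviation cnt :: "(int ^ 'k) measure" where
  "cnt \<equiv> count_space UNIV"

lemma ell2_sqi: "\<xi> \<in> ell2 \<longleftrightarrow> \<xi> \<in> sqi cnt"
proof -
  have "(\<lambda>l. (cmod (\<xi> l))\<^sup>2) summable_on UNIV \<longleftrightarrow> integrable cnt (\<lambda>l. (cmod (\<xi> l))\<^sup>2)"
    using abs_summable_equivalent[of "\<lambda>l. (cmod (\<xi> l))\<^sup>2" UNIV] by (simp add: Infinite_Set_Sum.abs_summable_on_def)
  then show ?thesis by (simp add: ell2_def sqi_def)
qed

lemma ell2_inner_inn:
  assumes "\<xi> \<in> sqi cnt" "\<eta> \<in> sqi cnt"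
  shows "ell2_inner \<xi> \<eta> = inn cnt \<xi> \<eta>"
proof -
  have "Infinite_Set_Sum.abs_summable_on (\<lambda>l. \<xi> l * cnj (\<eta> l)) UNIV"
    using sqi_mult_integrable[OF assms] by (simp add: Infinite_Set_Sum.abs_summable_on_def)
  from infsetsum_infsum[OF this] show ?thesis
    by (simp add: ell2_inner_def inn_def infsetsum_def)
qed

lemma sqi_cnt_eq_zero: "\<xi> \<in> sqi cnt \<Longrightarrow> nrm cnt \<xi> = 0 \<Longrightarrow> \<xi> = (\<lambda>l. 0)"
  by (simp add: nrm_eq_zero_iff AE_count_space fun_eq_iff)

lemma fiber_sqi:
  assumes "unc G \<in> sqi fib"
  shows "AE x in tor. G x \<in> sqi cnt"
proof -
  interpret pair_sigma_finite "tor :: (real ^ 'a) measure" "cnt :: (int ^ 'a) measure"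
    by (rule pair_sigma_finite_fib)
  have "AE x in tor. integrable cnt (\<lambda>l. (cmod (unc G (x, l)))\<^sup>2)"
    by (rule AE_integrable_fst') (use sqiD(2)[OF assms] in \<open>simp add: fib_def\<close>)
  then show ?thesis by eventually_elim (simp add: sqi_def)
qed

lemma Gamma_fiber_sqi: "f \<in> sqi lebesgue \<Longrightarrow> AE x in tor. \<Gamma> f x \<in> sqi cnt"
  by (intro fiber_sqi Gamma_sqi)

lemma fiber_inn_measurable:
  assumes G: "unc G \<in> borel_measurable fib" and H: "unc H \<in> borel_measurable fib"
  shows "(\<lambda>x. inn cnt (G x) (H x)) \<in> borel_measurable tor"
proof -
  interpret sigma_finite_measure "cnt :: (int ^ 'a) measure" by (rule sigma_finite_count)
  have "(\<lambda>z. unc G z * cnj (unc H z)) \<in> borel_measurable (tor \<Otimes>\<^sub>M cnt)"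
    using G H by (auto simp: fib_def)
  then have "(\<lambda>(x, l). G x l * cnj (H x l)) \<in> borel_measurable (tor \<Otimes>\<^sub>M cnt)"
    by (simp add: case_prod_unfold)
  then show ?thesis unfolding inn_def by (rule borel_measurable_lebesgue_integral)
qed

lemma fib_inn:
  assumes G: "unc G \<in> sqi fib" and H: "unc H \<in> sqi fib"
  shows "inn fib (unc G) (unc H) = (LINT x|tor. inn cnt (G x) (H x))"
proof -
  interpret pair_sigma_finite "tor :: (real ^ 'a) measure" "cnt :: (int ^ 'a) measure"
    by (rule pair_sigma_finite_fib)
  show ?thesis
    using integral_fst'[of "\<lambda>z. unc G z * cnj (unc H z)"] sqi_mult_integrable[OF G H]
    by (simp add: inn_def fib_def)
qed

lemma nn_integral_fib_fst:
  fixes G :: "real ^ 'k \<Rightarrow> int ^ 'k \<Rightarrow> complex"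
  assumes "unc G \<in> borel_measurable fib"
  shows "(\<integral>\<^sup>+z. ennreal ((cmod (unc G z))\<^sup>2) \<partial>fib) = (\<integral>\<^sup>+x. (\<integral>\<^sup>+l. ennreal ((cmod (G x l))\<^sup>2) \<partial>cnt) \<partial>tor)"
proof -
  interpret sigma_finite_measure "cnt :: (int ^ 'k) measure" by (rule sigma_finite_count)
  have "(\<lambda>z. ennreal ((cmod (unc G z))\<^sup>2)) \<in> borel_measurable (tor \<Otimes>\<^sub>M cnt)"
    using assms by (simp add: fib_def)
  from nn_integral_fst[OF this] show ?thesis by (simp add: fib_def)
qed

text \<open>The torus has finite measure, so a constant bound on the fiber norms is square
  integrable.\<close>

lemma bounded_fiber_sqi:
  fixes G :: "real ^ 'k \<Rightarrow> int ^ 'k \<Rightarrow> complex"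
  assumes m: "\<And>l. (\<lambda>x. G x l) \<in> borel_measurable tor"
    and b: "AE x in tor. G x \<in> sqi cnt \<and> nrm cnt (G x) \<le> C"
  shows "unc G \<in> sqi fib"
proof (rule sqiI)
  interpret finite_measure "tor :: (real ^ 'k) measure" by (rule finite_measure_tor)
  show um: "unc G \<in> borel_measurable fib" using m by (simp add: unc_measurable)
  have "(\<integral>\<^sup>+x. (\<integral>\<^sup>+l. ennreal ((cmod (G x l))\<^sup>2) \<partial>cnt) \<partial>tor) \<le> (\<integral>\<^sup>+x. ennreal (C\<^sup>2) \<partial>(tor :: (real ^ 'k) measure))"
  proof (rule nn_integral_mono_AE)
    show "AE x in tor. (\<integral>\<^sup>+l. ennreal ((cmod (G x l))\<^sup>2) \<partial>cnt) \<le> ennreal (C\<^sup>2)"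
      using b
    proof eventually_elim
      case (elim x)
      then have "(nrm cnt (G x))\<^sup>2 \<le> C\<^sup>2" by (intro power_mono) auto
      then show ?case using nn_integral_sqi[of "G x" cnt] elim by (simp add: ennreal_leI)
    qed
  qed
  also have "\<dots> < \<infinity>"
    by (simp add: ennreal_mult_eq_top_iff less_top[symmetric] emeasure_eq_measure)
  finally show "(\<integral>\<^sup>+z. ennreal ((cmod (unc G z))\<^sup>2) \<partial>fib) < \<infinity>"
    by (simp only: nn_integral_fib_fst[OF um])
qed

section \<open>Orthonormality of the exponentials on the torus\<close>

lemma phase_integral_unit_interval:
  "integrable lborel (\<lambda>t. indicator {-1/2..<1/2} t *\<^sub>R phase (real_of_int n * t))"
  "(LINT t|lborel. indicator {-1/2..<1/2} t *\<^sub>R phase (real_of_int n * t)) = of_bool (n = 0)"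
proof -
  have cont: "continuous_on {-1/2..1/2} (\<lambda>t. phase (real_of_int n * t))"
    by (intro continuous_intros)
  have i: "integrable lborel (\<lambda>t. indicator {-1/2..1/2} t *\<^sub>R phase (real_of_int n * t))"
    by (rule borel_integrable_compact[OF compact_Icc cont])
  have ae: "AE t in lborel. indicator {-1/2..1/2} t *\<^sub>R phase (real_of_int n * t) = indicator {-1/2..<1/2} t *\<^sub>R phase (real_of_int n * t)"
    using AE_lborel_singleton[of "1/2::real"] by eventually_elim (auto simp: indicator_def)
  have m: "(\<lambda>t. indicator {-1/2..<1/2} t *\<^sub>R phase (real_of_int n * t)) \<in> borel_measurable lborel"
    by measurable
  show "integrable lborel (\<lambda>t. indicator {-1/2..<1/2} t *\<^sub>R phase (real_of_int n * t))"
    using integrable_cong_AE[OF _ m ae] i by auto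
  have "(LINT t|lborel. indicator {-1/2..<1/2} t *\<^sub>R phase (real_of_int n * t))
     = (LINT t|lborel. indicator {-1/2..1/2} t *\<^sub>R phase (real_of_int n * t))"
    by (intro integral_cong_AE m) (use ae i in auto)
  also have "\<dots> = of_bool (n = 0)"
  proof (cases "n = 0")
    case True
    have "(LINT t|lborel. indicator {-1/2..1/2::real} t *\<^sub>R (1::complex)) = 1"
      by (subst integral_scaleR_left) auto
    then show ?thesis using True by simp
  next
    case False
    define k where "k = - 2 * pi * \<i> * of_int n"
    have k: "k \<noteq> 0" using False by (simp add: k_def)
    have pk: "phase (real_of_int n * t) = exp (k * of_real t)" for t
      by (simp add: phase_def k_def mult_ac)
    define F where "F t = exp (k * complex_of_real t) / k" for t
    have "(LINT t|lborel. indicator {-1/2..1/2} t *\<^sub>R phase (real_of_int n * t)) = F (1/2) - F (-1/2)"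
    proof (rule integral_FTC_Icc)
      fix t :: real
      have "((\<lambda>z. exp (k * z) / k) has_field_derivative exp (k * of_real t)) (at (complex_of_real t))"
        by (rule derivative_eq_intros refl | use k in simp)+
      then have "((\<lambda>t. exp (k * complex_of_real t) / k) has_vector_derivative exp (k * of_real t)) (at t within {-1/2..1/2})"
        by (rule has_vector_derivative_real_field)
      then show "(F has_vector_derivative phase (real_of_int n * t)) (at t within {-1/2..1/2})"
        by (simp only: F_def[abs_def] pk)
    qed (use cont in auto)
    also have "\<dots> = 0"
    \<comment> \<open>The ends of the interval differ by 1 and \<open>exp k = 1\<close>, so the
      antiderivative takes equal values there.\<close>
    proof -
      have "exp (k * complex_of_real (1/2)) = exp (k * complex_of_real (-1/2)) * exp k"
        by (simp add: field_simps flip: exp_add)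
      moreover have "exp k = 1"
      proof -
        have "k = 2 * of_int (- n) * pi * \<i>" by (simp add: k_def mult_ac)
        then show ?thesis by (simp only: exp_integer_2pi[OF Ints_of_int])
      qed
      ultimately show ?thesis by (simp add: F_def)
    qed
    finally show ?thesis using False by simp
  qed
  finally show "(LINT t|lborel. indicator {-1/2..<1/2} t *\<^sub>R phase (real_of_int n * t)) = of_bool (n = 0)" .
qed

text \<open>The indicator of the torus and the exponential both factor over the coordinates, so the
  integral is a product of one-dimensional ones.\<close>

lemma phase_torus_integral:
  fixes l :: "int ^ 'k"
  shows "(LINT x|tor. phase (int_vec l \<bullet> x)) = of_bool (l = 0)"
proof -
  \<comment> \<open>The product formula runs over \<open>Basis\<close>; \<open>idx\<close> recovers
    the coordinate belonging to a basis vector.\<close>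
  define idx :: "real ^ 'k \<Rightarrow> 'k" where "idx b = (THE j. b = axis j 1)" for b
  have idx: "idx (axis j 1) = j" for j
    unfolding idx_def by (rule the_equality) (auto simp: axis_eq_axis)
  have B: "(Basis :: (real ^ 'k) set) = (\<lambda>j. axis j 1) ` UNIV"
    by (auto simp: Basis_vec_def)
  have inj: "inj (\<lambda>j. axis j 1 :: real ^ 'k)" by (auto simp: inj_on_def axis_eq_axis)
  define g where "g b t = indicator {-1/2..<1/2} t *\<^sub>R phase (real_of_int (l $ idx b) * t)" for b :: "real ^ 'k" and t
  have "(LINT x|tor. phase (int_vec l \<bullet> x)) = (LINT x|lebesgue. indicator torus x *\<^sub>R phase (int_vec l \<bullet> x))"
    by (simp add: integral_restrict_space)
  also have "\<dots> = (LINT x|lborel. indicator torus x *\<^sub>R phase (int_vec l \<bullet> x))"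
    by (rule integral_completion) (auto intro!: borel_measurable_scaleR borel_measurable_indicator)
  also have "\<dots> = (LINT x|lborel. (\<Prod>b\<in>Basis. g b (x \<bullet> b)))"
  proof (rule Bochner_Integration.integral_cong[OF refl])
    fix x :: "real ^ 'k"
    have "(\<Prod>b\<in>Basis. g b (x \<bullet> b)) = (\<Prod>j\<in>UNIV. g (axis j 1) (x $ j))"
      unfolding B by (subst prod.reindex[OF inj]) (simp add: cart_eq_inner_axis)
    also have "\<dots> = (\<Prod>j\<in>UNIV. complex_of_real (indicator {-1/2..<1/2} (x $ j))) * (\<Prod>j\<in>UNIV. phase (real_of_int (l $ j) * x $ j))"
      by (simp add: g_def idx prod.distrib scaleR_conv_of_real)
    also have "(\<Prod>j\<in>UNIV. phase (real_of_int (l $ j) * x $ j)) = phase (int_vec l \<bullet> x)"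
    proof -
      have "(\<Prod>j\<in>A. phase (s j)) = phase (\<Sum>j\<in>A. s j)" for A :: "'k set" and s
        by (induction A rule: infinite_finite_induct) (auto simp: phase_add)
      then show ?thesis by (simp add: inner_vec_def int_vec_def)
    qed
    also have "(\<Prod>j\<in>UNIV. complex_of_real (indicator {-1/2..<1/2} (x $ j))) = complex_of_real (indicator torus x)"
    proof (cases "x \<in> torus")
      case True
      then show ?thesis by (simp add: torus_def indicator_def)
    next
      case False
      then obtain j where "x $ j \<notin> {-1/2..<1/2}" by (auto simp: torus_def)
      then have "(\<Prod>j\<in>UNIV. complex_of_real (indicator {-1/2..<1/2} (x $ j))) = 0"
        by (intro prod_zero) (auto simp: indicator_def intro!: bexI[of _ j])
      then show ?thesis using False by simp
    qed
    finally show "indicator torus x *\<^sub>R phase (int_vec l \<bullet> x) = (\<Prod>b\<in>Basis. g b (x \<bullet> b))"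
      by (simp add: scaleR_conv_of_real)
  qed
  also have "\<dots> = (\<Prod>b\<in>(Basis :: (real ^ 'k) set). LINT t|lborel. g b t)"
    by (rule lborel_prod_Basis(2)) (unfold g_def, rule phase_integral_unit_interval)
  also have "\<dots> = (\<Prod>j\<in>UNIV. of_bool (l $ j = 0))"
  proof -
    have "(LINT t|lborel. g (axis j 1) t) = of_bool (l $ j = 0)" for j
      by (simp only: g_def idx phase_integral_unit_interval)
    then show ?thesis unfolding B by (subst prod.reindex[OF inj]) simp
  qed
  also have "\<dots> = of_bool (l = 0)"
    by (cases "l = 0") (auto simp: vec_eq_iff intro!: prod_zero)
  finally show ?thesis .
qed

lemma phase_sqi_tor: "(\<lambda>x. phase (int_vec l \<bullet> x)) \<in> sqi (tor :: (real ^ 'k) measure)"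
proof -
  interpret finite_measure "tor :: (real ^ 'k) measure" by (rule finite_measure_tor)
  have "(\<lambda>x. phase (int_vec l \<bullet> x)) \<in> borel_measurable tor"
    by (rule borel_measurable_torI) measurable
  then show ?thesis by (simp add: sqi_def)
qed

lemma phase_orthonormal:
  "inn tor (\<lambda>x. phase (int_vec l \<bullet> x)) (\<lambda>x. phase (int_vec m \<bullet> x)) = of_bool (l = m)"
proof -
  have "int_vec (l - m) = int_vec l - int_vec m" by (simp add: int_vec_def vec_eq_iff)
  then have "phase (int_vec l \<bullet> x) * cnj (phase (int_vec m \<bullet> x)) = phase (int_vec (l - m) \<bullet> x)" for x
    by (simp add: inner_diff_left flip: phase_add)
  then show ?thesis using phase_torus_integral[of "l - m"] by (simp add: inn_def)
qed

text \<open>The coefficients of \<open>f\<close> against the integer translates of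
  \<open>F i\<close> are the Fourier coefficients on the torus of the fiberwise inner product of
  \<open>\<Gamma> f\<close> and \<open>\<Gamma> (F i)\<close>. Bessel's inequality for the
  exponentials bounds their square sum by the squared norm of that function, and Cauchy-Schwarz on
  each fiber bounds this by \<open>C\<^sup>2\<close> times the squared norm of
  \<open>f\<close>.\<close>

lemma bessel_bounded_fibers:
  fixes F :: "nat \<Rightarrow> real ^ 'k \<Rightarrow> complex"
  assumes F: "\<And>i. i \<in> {1..n} \<Longrightarrow> F i \<in> sqi lebesgue" and C: "C \<ge> 0"
    and b: "\<And>i. i \<in> {1..n} \<Longrightarrow> AE x in tor. nrm cnt (\<Gamma> (F i) x) \<le> C"
  shows "bessel n F"
proof -
  have main: "(\<Sum>l\<in>A. (cmod (L2_inner f (translation (int_vec l) (F i))))\<^sup>2) \<le> C\<^sup>2 * (nrm lebesgue f)\<^sup>2"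
    if f: "f \<in> sqi lebesgue" and i: "i \<in> {1..n}" and A: "finite A" for f i A
  proof -
    define \<psi> where "\<psi> x = inn cnt (\<Gamma> f x) (\<Gamma> (F i) x)" for x
    note Gf = Gamma_sqi[OF f] and GF = Gamma_sqi[OF F[OF i]]
    have \<psi>m: "\<psi> \<in> borel_measurable tor"
      unfolding \<psi>_def by (rule fiber_inn_measurable[OF sqiD(1)[OF Gf] sqiD(1)[OF GF]])
    have \<psi>b: "AE x in tor. ennreal ((cmod (\<psi> x))\<^sup>2) \<le> ennreal (C\<^sup>2) * (\<integral>\<^sup>+l. ennreal ((cmod (\<Gamma> f x l))\<^sup>2) \<partial>cnt)"
      using b[OF i] Gamma_fiber_sqi[OF f] Gamma_fiber_sqi[OF F[OF i]]
    proof eventually_elim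
      case (elim x)
      have "cmod (\<psi> x) \<le> nrm cnt (\<Gamma> f x) * nrm cnt (\<Gamma> (F i) x)"
        unfolding \<psi>_def by (rule inn_Cauchy_Schwarz) (use elim in auto)
      also have "\<dots> \<le> nrm cnt (\<Gamma> f x) * C" by (intro mult_left_mono elim) auto
      finally have "(cmod (\<psi> x))\<^sup>2 \<le> (nrm cnt (\<Gamma> f x) * C)\<^sup>2" by (rule power_mono) simp
      then have "ennreal ((cmod (\<psi> x))\<^sup>2) \<le> ennreal (C\<^sup>2) * ennreal ((nrm cnt (\<Gamma> f x))\<^sup>2)"
        by (subst ennreal_mult[symmetric]) (auto simp: power_mult_distrib mult.commute intro!: ennreal_leI)
      then show ?case using nn_integral_sqi[of "\<Gamma> f x" cnt] elim by simp
    qed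
    have inn_meas: "(\<lambda>x. \<integral>\<^sup>+l. ennreal ((cmod (\<Gamma> f x l))\<^sup>2) \<partial>cnt) \<in> borel_measurable tor"
    proof -
      interpret sigma_finite_measure "cnt :: (int ^ 'k) measure" by (rule sigma_finite_count)
      have "(\<lambda>(x, l). ennreal ((cmod (\<Gamma> f x l))\<^sup>2)) \<in> borel_measurable (tor \<Otimes>\<^sub>M cnt)"
        using sqiD(1)[OF Gf] by (simp add: fib_def case_prod_unfold)
      then show ?thesis by (rule borel_measurable_nn_integral)
    qed
    have \<psi>n: "(\<integral>\<^sup>+x. ennreal ((cmod (\<psi> x))\<^sup>2) \<partial>tor) \<le> ennreal ((C * nrm lebesgue f)\<^sup>2)"
    proof -
      have "(\<integral>\<^sup>+x. ennreal ((cmod (\<psi> x))\<^sup>2) \<partial>tor) \<le> (\<integral>\<^sup>+x. ennreal (C\<^sup>2) * (\<integral>\<^sup>+l. ennreal ((cmod (\<Gamma> f x l))\<^sup>2) \<partial>cnt) \<partial>tor)"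
        by (rule nn_integral_mono_AE[OF \<psi>b])
      also have "\<dots> = ennreal (C\<^sup>2) * (\<integral>\<^sup>+x. (\<integral>\<^sup>+l. ennreal ((cmod (\<Gamma> f x l))\<^sup>2) \<partial>cnt) \<partial>tor)"
        by (rule nn_integral_cmult[OF inn_meas])
      also have "(\<integral>\<^sup>+x. (\<integral>\<^sup>+l. ennreal ((cmod (\<Gamma> f x l))\<^sup>2) \<partial>cnt) \<partial>tor) = ennreal ((nrm lebesgue f)\<^sup>2)"
        unfolding nn_integral_fib_fst[OF sqiD(1)[OF Gf], symmetric] nn_integral_sqi[OF Gf] Gamma_isometry[OF f] ..
      finally show ?thesis by (simp add: power_mult_distrib ennreal_mult)
    qed
    have \<psi>: "\<psi> \<in> sqi tor" by (rule sqiI[OF \<psi>m le_less_trans[OF \<psi>n]]) simp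
    have "L2_inner f (translation (int_vec l) (F i)) = inn tor \<psi> (\<lambda>x. phase (int_vec l \<bullet> x))" for l
    proof -
      have T: "translation (int_vec l) (F i) \<in> sqi lebesgue" by (rule translation_sqi(1)[OF F[OF i]])
      have TG: "is_Gamma (translation (int_vec l) (F i)) (\<lambda>x m. phase (int_vec l \<bullet> x) * \<Gamma> (F i) x m)"
        by (rule is_Gamma_translation[OF F[OF i] is_Gamma_Gamma[OF F[OF i]]])
      then have Ts: "unc (\<lambda>x m. phase (int_vec l \<bullet> x) * \<Gamma> (F i) x m) \<in> sqi fib" by (simp add: is_Gamma_iff)
      have "L2_inner f (translation (int_vec l) (F i)) = inn fib (unc (\<Gamma> f)) (unc (\<lambda>x m. phase (int_vec l \<bullet> x) * \<Gamma> (F i) x m))"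
        unfolding L2_sqi by (rule Gamma_inner[OF f T is_Gamma_Gamma[OF f] TG])
      also have "\<dots> = (LINT x|tor. inn cnt (\<Gamma> f x) (\<lambda>m. phase (int_vec l \<bullet> x) * \<Gamma> (F i) x m))"
        by (rule fib_inn[OF Gf Ts])
      also have "\<dots> = (LINT x|tor. \<psi> x * cnj (phase (int_vec l \<bullet> x)))"
      proof (rule Bochner_Integration.integral_cong[OF refl])
        fix x :: "real ^ 'k"
        show "inn cnt (\<Gamma> f x) (\<lambda>m. phase (int_vec l \<bullet> x) * \<Gamma> (F i) x m) = \<psi> x * cnj (phase (int_vec l \<bullet> x))"
          unfolding \<psi>_def inn_cnj[of cnt "\<Gamma> (F i) x", symmetric] inn_cnj[of cnt "\<lambda>m. phase (int_vec l \<bullet> x) * \<Gamma> (F i) x m", symmetric] inn_scale_left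
          by (simp only: complex_cnj_mult mult.commute)
      qed
      finally show ?thesis by (simp add: inn_def)
    qed
    then have "(\<Sum>l\<in>A. (cmod (L2_inner f (translation (int_vec l) (F i))))\<^sup>2) = (\<Sum>l\<in>A. (cmod (inn tor \<psi> (\<lambda>x. phase (int_vec l \<bullet> x))))\<^sup>2)"
      by simp
    also have "\<dots> \<le> (nrm tor \<psi>)\<^sup>2"
      by (rule bessel_inequality[OF \<psi> A phase_sqi_tor phase_orthonormal])
    also have "\<dots> \<le> (C * nrm lebesgue f)\<^sup>2"
      by (intro power_mono nrm_leI[OF \<psi> _ \<psi>n]) (use C in auto)
    finally show ?thesis by (simp add: power_mult_distrib)
  qed
  \<comment> \<open>One contribution \<open>C\<^sup>2\<close> for each of the \<open>n\<close>
    generators; adding 1 makes the Bessel bound positive even when \<open>C = 0\<close>.\<close>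
  define b where "b = real n * C\<^sup>2 + 1"
  have fin: "(\<Sum>(l, i)\<in>S. (cmod (L2_inner f (translation (int_vec l) (F i))))\<^sup>2) \<le> b * (L2_norm f)\<^sup>2"
    if f: "f \<in> L2" and S: "finite S" "S \<subseteq> UNIV \<times> {1..n}" for f S
  proof -
    have "(\<Sum>(l, i)\<in>S. (cmod (L2_inner f (translation (int_vec l) (F i))))\<^sup>2)
       \<le> (\<Sum>(l, i)\<in>fst ` S \<times> {1..n}. (cmod (L2_inner f (translation (int_vec l) (F i))))\<^sup>2)"
    proof (rule sum_mono2)
      show "S \<subseteq> fst ` S \<times> {1..n}" using S by force
    qed (use S in auto)
    also have "\<dots> = (\<Sum>i\<in>{1..n}. \<Sum>l\<in>fst ` S. (cmod (L2_inner f (translation (int_vec l) (F i))))\<^sup>2)"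
      by (subst sum.swap) (simp add: sum.cartesian_product)
    also have "\<dots> \<le> (\<Sum>i\<in>{1..n}. C\<^sup>2 * (nrm lebesgue f)\<^sup>2)"
      by (rule sum_mono) (rule main, use f S in \<open>auto simp: L2_sqi\<close>)
    also have "\<dots> = real n * C\<^sup>2 * (L2_norm f)\<^sup>2" by (simp add: L2_sqi)
    also have "\<dots> \<le> b * (L2_norm f)\<^sup>2" unfolding b_def by (rule mult_right_mono) auto
    finally show ?thesis .
  qed
  show ?thesis
    unfolding bessel_def
  proof (intro exI[of _ b] conjI ballI)
    show "0 < b" unfolding b_def by (intro add_nonneg_pos mult_nonneg_nonneg) auto
    fix f :: "real ^ 'k \<Rightarrow> complex" assume f: "f \<in> L2"
    show s: "(\<lambda>(l, i). (cmod (L2_inner f (translation (int_vec l) (F i))))\<^sup>2) summable_on UNIV \<times> {1..n}"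
    proof (rule nonneg_bdd_above_summable_on)
      show "bdd_above (sum (\<lambda>(l, i). (cmod (L2_inner f (translation (int_vec l) (F i))))\<^sup>2) ` {S. S \<subseteq> UNIV \<times> {1..n} \<and> finite S})"
        by (rule bdd_aboveI2[of _ _ "b * (L2_norm f)\<^sup>2"]) (use fin[OF f] in blast)
    qed auto
    show "(\<Sum>\<^sub>\<infinity>(l, i)\<in>UNIV \<times> {1..n}. (cmod (L2_inner f (translation (int_vec l) (F i))))\<^sup>2) \<le> b * (L2_norm f)\<^sup>2"
      by (rule infsum_le_finite_sums[OF s]) (use fin[OF f] in blast)
  qed
qed

section \<open>Orthonormal fibers and eigenvalues\<close>

lemma sum_fun_apply: "(\<Sum>i\<in>I. f i) x = (\<Sum>i\<in>I. f i x)"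
  by (induction I rule: infinite_finite_induct) auto

lemma cfun_span_sum:
  "(\<And>i. i \<in> I \<Longrightarrow> v i \<in> cfun.span B) \<Longrightarrow> (\<lambda>x. \<Sum>i\<in>I. c i * v i x) \<in> cfun.span B"
proof -
  assume v: "\<And>i. i \<in> I \<Longrightarrow> v i \<in> cfun.span B"
  have "(\<Sum>i\<in>I. (\<lambda>x. c i * v i x)) \<in> cfun.span B"
    by (intro cfun.span_sum cfun.span_scale v)
  moreover have "(\<Sum>i\<in>I. (\<lambda>x. c i * v i x)) = (\<lambda>x. \<Sum>i\<in>I. c i * v i x)"
    by (simp add: fun_eq_iff sum_fun_apply)
  ultimately show ?thesis by (simp only:)
qed

lemma orthonormal_independent:
  assumes R: "finite R" and v: "\<And>r. r \<in> R \<Longrightarrow> v r \<in> sqi M"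
    and on: "\<And>r s. r \<in> R \<Longrightarrow> s \<in> R \<Longrightarrow> inn M (v r) (v s) = of_bool (r = s)"
  shows "inj_on v R" "cfun.independent (v ` R)"
proof -
  show inj: "inj_on v R"
  proof (rule inj_onI, rule ccontr)
    fix r s assume rs: "r \<in> R" "s \<in> R" "v r = v s" "r \<noteq> s"
    then show False using on[of r s] on[of s s] by simp
  qed
  show "cfun.independent (v ` R)"
  proof
    assume "cfun.dependent (v ` R)"
    then obtain c where c: "\<exists>f\<in>v ` R. c f \<noteq> 0" "(\<Sum>f\<in>v ` R. (\<lambda>x. c f * f x)) = 0"
      using cfun.dependent_finite[of "v ` R"] R by auto
    have z: "(\<lambda>x. \<Sum>r\<in>R. c (v r) * v r x) = (\<lambda>x. 0)"
    proof
      fix x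
      have "(\<Sum>f\<in>v ` R. (\<lambda>x. c f * f x)) x = 0" using c(2) by simp
      then show "(\<Sum>r\<in>R. c (v r) * v r x) = 0"
        by (simp add: sum_fun_apply sum.reindex[OF inj])
    qed
    have "c (v s) = 0" if s: "s \<in> R" for s
    proof -
      have "0 = inn M (\<lambda>x. \<Sum>r\<in>R. c (v r) * v r x) (v s)" unfolding z by simp
      also have "\<dots> = (\<Sum>r\<in>R. c (v r) * inn M (v r) (v s))" by (rule inn_sum_left[OF v v[OF s]])
      also have "\<dots> = (\<Sum>r\<in>R. if r = s then c (v r) else 0)"
        by (intro sum.cong refl) (simp add: on s)
      also have "\<dots> = c (v s)" using R s by simp
      finally show ?thesis by simp
    qed
    then show False using c(1) by auto
  qed
qed

lemma sort_mset_unique: "sorted (rev xs) \<Longrightarrow> rev (sorted_list_of_multiset (mset xs)) = (xs :: real list)"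
  by (metis mset_rev rev_rev_ident sorted_list_of_multiset_mset sorted_sort_id)

text \<open>The operator is diagonal in the system \<open>w\<close> with positive entries
  \<open>L\<close>. For \<open>\<mu> > 0\<close> its eigenspace is spanned by the \<open>w r\<close>
  with \<open>L r = \<mu>\<close>, so dimensions count the repetitions of \<open>\<mu>\<close> in
  \<open>L\<close>, and the list of positive eigenvalues is \<open>L\<close> itself, already in
  order.\<close>

lemma eigval_orthonormal:
  fixes w :: "nat \<Rightarrow> int ^ 'k \<Rightarrow> complex" and L :: "nat \<Rightarrow> real"
  assumes w: "\<And>r. r < m \<Longrightarrow> w r \<in> sqi cnt"
    and on: "\<And>r s. r < m \<Longrightarrow> s < m \<Longrightarrow> inn cnt (w r) (w s) = of_bool (r = s)"
    and pos: "\<And>r. r < m \<Longrightarrow> L r > 0" and dec: "\<And>r s. r \<le> s \<Longrightarrow> s < m \<Longrightarrow> L s \<le> L r"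
    and T: "\<And>\<xi>. \<xi> \<in> sqi cnt \<Longrightarrow> T \<xi> = (\<lambda>l. \<Sum>r<m. complex_of_real (L r) * inn cnt \<xi> (w r) * w r l)"
    and i: "1 \<le> i"
  shows "eigval i T = (if i \<le> m then L (i - 1) else 0)"
proof -
  define R where "R \<mu> = {r. r < m \<and> L r = \<mu>}" for \<mu>
  have Rm: "R \<mu> \<subseteq> {..<m}" for \<mu> by (auto simp: R_def)
  have Rfin: "finite (R \<mu>)" for \<mu> by (rule finite_subset[OF Rm]) simp
  have es: "eigenspace T \<mu> = cfun.span (w ` R \<mu>)" if \<mu>: "\<mu> > 0" for \<mu>
  proof
    show "eigenspace T \<mu> \<subseteq> cfun.span (w ` R \<mu>)"
    proof
      fix \<xi> assume "\<xi> \<in> eigenspace T \<mu>"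
      then have \<xi>: "\<xi> \<in> sqi cnt" and eq: "T \<xi> = (\<lambda>l. complex_of_real \<mu> * \<xi> l)"
        by (auto simp: eigenspace_def ell2_sqi)
      have coeff: "complex_of_real (L s) * inn cnt \<xi> (w s) = complex_of_real \<mu> * inn cnt \<xi> (w s)" if s: "s < m" for s
      proof -
        have "complex_of_real \<mu> * inn cnt \<xi> (w s) = inn cnt (T \<xi>) (w s)"
          unfolding eq inn_scale_left ..
        also have "\<dots> = (\<Sum>r<m. (complex_of_real (L r) * inn cnt \<xi> (w r)) * inn cnt (w r) (w s))"
          unfolding T[OF \<xi>] by (rule inn_sum_left) (use w s in auto)
        also have "\<dots> = (\<Sum>r<m. if r = s then complex_of_real (L r) * inn cnt \<xi> (w r) else 0)"
          by (intro sum.cong refl) (simp add: on s)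
        also have "\<dots> = complex_of_real (L s) * inn cnt \<xi> (w s)" using s by simp
        finally show ?thesis by (rule sym)
      qed
      have zero: "inn cnt \<xi> (w s) = 0" if "s < m" "s \<notin> R \<mu>" for s
        using coeff[OF that(1)] that by (auto simp: R_def)
      \<comment> \<open>As \<open>\<mu>\<close> is not zero, an eigenvector lies in the range of
        \<open>T\<close> and is recovered from its coefficients; those with \<open>L r\<close>
        different from \<open>\<mu>\<close> vanish.\<close>
      have "\<xi> = (\<lambda>l. \<Sum>r\<in>R \<mu>. inn cnt \<xi> (w r) * w r l)"
      proof
        fix l
        have "complex_of_real \<mu> * \<xi> l = (\<Sum>r<m. complex_of_real (L r) * inn cnt \<xi> (w r) * w r l)"
          using fun_cong[OF eq, of l] unfolding T[OF \<xi>] by simp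
        also have "\<dots> = (\<Sum>r\<in>R \<mu>. complex_of_real (L r) * inn cnt \<xi> (w r) * w r l)"
          using zero by (intro sum.mono_neutral_right Rm) auto
        also have "\<dots> = complex_of_real \<mu> * (\<Sum>r\<in>R \<mu>. inn cnt \<xi> (w r) * w r l)"
          unfolding sum_distrib_left by (intro sum.cong refl) (simp add: R_def)
        finally show "\<xi> l = (\<Sum>r\<in>R \<mu>. inn cnt \<xi> (w r) * w r l)" using \<mu> by simp
      qed
      moreover have "(\<lambda>l. \<Sum>r\<in>R \<mu>. inn cnt \<xi> (w r) * w r l) \<in> cfun.span (w ` R \<mu>)"
        by (intro cfun_span_sum cfun.span_base imageI)
      ultimately show "\<xi> \<in> cfun.span (w ` R \<mu>)" by simp
    qed
    have sub: "cfun.subspace (eigenspace T \<mu>)"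
    proof (rule cfun.subspaceI)
      have lin: "(\<lambda>x. a * \<xi> x + b * \<eta> x) \<in> eigenspace T \<mu>"
        if "\<xi> \<in> eigenspace T \<mu>" "\<eta> \<in> eigenspace T \<mu>" for \<xi> \<eta> a b
      proof -
        have s: "\<xi> \<in> sqi cnt" "\<eta> \<in> sqi cnt" and e: "T \<xi> = (\<lambda>l. complex_of_real \<mu> * \<xi> l)" "T \<eta> = (\<lambda>l. complex_of_real \<mu> * \<eta> l)"
          using that by (auto simp: eigenspace_def ell2_sqi)
        have c: "(\<lambda>x. a * \<xi> x + b * \<eta> x) \<in> sqi cnt" by (intro sqi_add sqi_scale s)
        have "T (\<lambda>x. a * \<xi> x + b * \<eta> x) l = complex_of_real \<mu> * (a * \<xi> l + b * \<eta> l)" for l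
        proof -
          have "T (\<lambda>x. a * \<xi> x + b * \<eta> x) l = (\<Sum>r<m. complex_of_real (L r) * (a * inn cnt \<xi> (w r) + b * inn cnt \<eta> (w r)) * w r l)"
            unfolding T[OF c] using w by (intro sum.cong refl) (simp add: inn_add_left[OF sqi_scale sqi_scale] s inn_scale_left)
          also have "\<dots> = a * T \<xi> l + b * T \<eta> l"
            unfolding T[OF s(1)] T[OF s(2)] by (simp add: sum_distrib_left sum.distrib algebra_simps)
          finally show ?thesis by (simp add: e algebra_simps)
        qed
        then show ?thesis using c by (auto simp: eigenspace_def ell2_sqi)
      qed
      show "0 \<in> eigenspace T \<mu>"
        by (auto simp: eigenspace_def ell2_sqi zero_fun_def T)
      show "x + y \<in> eigenspace T \<mu>" if "x \<in> eigenspace T \<mu>" "y \<in> eigenspace T \<mu>" for x y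
        using lin[OF that, of 1 1] by (simp add: plus_fun_def)
      show "(\<lambda>l. c * x l) \<in> eigenspace T \<mu>" if "x \<in> eigenspace T \<mu>" for c x
        using lin[OF that that, of c 0] by simp
    qed
    show "cfun.span (w ` R \<mu>) \<subseteq> eigenspace T \<mu>"
    proof (rule cfun.span_minimal[OF _ sub], rule image_subsetI)
      fix s assume s: "s \<in> R \<mu>"
      then have sm: "s < m" "L s = \<mu>" by (auto simp: R_def)
      have "T (w s) l = complex_of_real \<mu> * w s l" for l
      proof -
        have "T (w s) l = (\<Sum>r<m. if r = s then complex_of_real (L r) * w r l else 0)"
          unfolding T[OF w[OF sm(1)]] by (intro sum.cong refl) (use sm in \<open>auto simp: on\<close>)
        then show ?thesis using sm by simp
      qed
      then show "w s \<in> eigenspace T \<mu>" using w[OF sm(1)] by (auto simp: eigenspace_def ell2_sqi)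
    qed
  qed
  have ind: "inj_on w (R \<mu>)" "cfun.independent (w ` R \<mu>)" for \<mu>
  proof -
    have wR: "\<And>r. r \<in> R \<mu> \<Longrightarrow> w r \<in> sqi cnt" using w by (simp add: R_def)
    have onR: "\<And>r s. r \<in> R \<mu> \<Longrightarrow> s \<in> R \<mu> \<Longrightarrow> inn cnt (w r) (w s) = of_bool (r = s)"
      using on by (simp add: R_def)
    show "inj_on w (R \<mu>)" "cfun.independent (w ` R \<mu>)"
      by (rule orthonormal_independent[OF Rfin wR onR]; assumption)+
  qed
  have dim: "cfun.dim (eigenspace T \<mu>) = card (R \<mu>)" if "\<mu> > 0" for \<mu>
    unfolding es[OF that] cfun.dim_span_eq_card_independent[OF ind(2)] by (rule card_image[OF ind(1)])
  have index: "{\<mu>. \<mu> > 0 \<and> eigenspace T \<mu> \<noteq> {\<lambda>_. 0}} = L ` {..<m}"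
  proof (intro equalityI subsetI)
    fix \<mu> assume "\<mu> \<in> {\<mu>. \<mu> > 0 \<and> eigenspace T \<mu> \<noteq> {\<lambda>_. 0}}"
    then have "cfun.span (w ` R \<mu>) \<noteq> {\<lambda>_. 0}" using es[of \<mu>] by auto
    then have "R \<mu> \<noteq> {}" by (auto simp: zero_fun_def)
    then show "\<mu> \<in> L ` {..<m}" by (auto simp: R_def)
  next
    fix \<mu> assume "\<mu> \<in> L ` {..<m}"
    then obtain r where r: "r < m" "\<mu> = L r" by auto
    then have "w r \<in> eigenspace T \<mu>" using es pos cfun.span_base[of "w r" "w ` R \<mu>"] by (auto simp: R_def)
    moreover have "w r \<noteq> (\<lambda>_. 0)" using on[of r r] r by auto
    ultimately show "\<mu> \<in> {\<mu>. \<mu> > 0 \<and> eigenspace T \<mu> \<noteq> {\<lambda>_. 0}}" using pos r by auto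
  qed
  have "pos_eigenvalues T = (\<Sum>\<mu>\<in>L ` {..<m}. replicate_mset (card (R \<mu>)) \<mu>)"
    unfolding pos_eigenvalues_def index by (intro sum.cong refl) (use dim pos in auto)
  also have "\<dots> = image_mset L (mset_set {..<m})"
  proof (rule multiset_eqI)
    fix \<nu>
    have "count (\<Sum>\<mu>\<in>L ` {..<m}. replicate_mset (card (R \<mu>)) \<mu>) \<nu> = (\<Sum>\<mu>\<in>L ` {..<m}. if \<mu> = \<nu> then card (R \<nu>) else 0)"
      unfolding count_sum by (intro sum.cong refl) auto
    also have "\<dots> = card (R \<nu>)"
    proof (cases "\<nu> \<in> L ` {..<m}")
      case False
      then have "R \<nu> = {}" by (auto simp: R_def)
      then show ?thesis using False by simp
    qed simp
    also have "\<dots> = count (image_mset L (mset_set {..<m})) \<nu>"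
      by (simp add: count_image_mset' R_def vimage_def Collect_conj_eq lessThan_def Int_commute eq_commute[of \<nu>])
    finally show "count (\<Sum>\<mu>\<in>L ` {..<m}. replicate_mset (card (R \<mu>)) \<mu>) \<nu> = count (image_mset L (mset_set {..<m})) \<nu>" .
  qed
  also have "\<dots> = mset (map L [0..<m])" by (simp add: atLeast0LessThan flip: mset_set_upto_eq_mset_upto)
  finally have pe: "pos_eigenvalues T = mset (map L [0..<m])" .
  have "sorted (rev (map L [0..<m]))"
    unfolding sorted_rev_iff_nth_mono by (auto intro: dec)
  then have "rev (sorted_list_of_multiset (pos_eigenvalues T)) = map L [0..<m]"
    unfolding pe by (rule sort_mset_unique)
  then show ?thesis using i by (auto simp: eigval_def Let_def)
qed

context
  fixes W :: "(real ^ 'k \<Rightarrow> complex) set"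
  assumes W: "shift_invariant W"
begin

text \<open>The new unit vector is put at the first unused position \<open>D x\<close>,
  so the nonzero vectors always form an initial segment.\<close>

lemma orthonormal_generators:
  assumes "finite A" "A \<subseteq> W"
  shows "\<exists>e. (\<forall>r. e r \<in> W) \<and> (AE x in tor. \<exists>D\<le>card A.
      (\<forall>r<D. \<forall>s<D. inn cnt (\<Gamma> (e r) x) (\<Gamma> (e s) x) = of_bool (r = s)) \<and>
      (\<forall>r\<ge>D. \<Gamma> (e r) x = (\<lambda>_. 0)) \<and>
      cfun.span ((\<lambda>r. \<Gamma> (e r) x) ` {..<D}) = cfun.span ((\<lambda>h. \<Gamma> h x) ` A))"
  using assms
proof (induction A)
  case empty
  have z: "(\<lambda>x. 0) \<in> W" "AE x in tor. \<Gamma> (\<lambda>x :: real ^ 'k. 0) x = (\<lambda>l. 0)"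
    using Gamma_sum[OF W, of "{}"] by auto
  show ?case
    using z by (intro exI[of _ "\<lambda>r x. 0"]) (auto elim: eventually_mono)
next
  case (insert h A)
  then obtain e where e: "\<forall>r. e r \<in> W" and ae: "AE x in tor. \<exists>D\<le>card A.
      (\<forall>r<D. \<forall>s<D. inn cnt (\<Gamma> (e r) x) (\<Gamma> (e s) x) = of_bool (r = s)) \<and>
      (\<forall>r\<ge>D. \<Gamma> (e r) x = (\<lambda>_. 0)) \<and>
      cfun.span ((\<lambda>r. \<Gamma> (e r) x) ` {..<D}) = cfun.span ((\<lambda>h. \<Gamma> h x) ` A)"
    by auto
  define N where "N = card A"
  have h: "h \<in> W" using insert by simp
  have es: "e r \<in> sqi lebesgue" for r using e W shift_invariant_sqi by blast
  have hs: "h \<in> sqi lebesgue" using h W shift_invariant_sqi by blast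
  have em: "unc (\<Gamma> (e r)) \<in> borel_measurable fib" for r using sqiD(1)[OF Gamma_sqi[OF es]] .
  have hm: "unc (\<Gamma> h) \<in> borel_measurable fib" using sqiD(1)[OF Gamma_sqi[OF hs]] .
  define a where "a r x = inn cnt (\<Gamma> h x) (\<Gamma> (e r) x)" for r x
  have am: "a r \<in> borel_measurable tor" for r
    unfolding a_def by (rule fiber_inn_measurable[OF hm em])
  \<comment> \<open>The sum runs over all \<open>r < N\<close>, a range independent of
    \<open>x\<close>; positions from \<open>D x\<close> on contribute nothing because their vectors
    vanish.\<close>
  define w where "w x l = \<Gamma> h x l - (\<Sum>r<N. a r x * \<Gamma> (e r) x l)" for x l
  have wm: "unc w \<in> borel_measurable fib"
    unfolding unc_measurable
  proof
    fix l
    have "(\<lambda>x. \<Gamma> (e r) x l) \<in> borel_measurable tor" "(\<lambda>x. \<Gamma> h x l) \<in> borel_measurable tor" for r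
      using em hm unc_measurable by blast+
    then show "(\<lambda>x. w x l) \<in> borel_measurable tor"
      unfolding w_def by (intro borel_measurable_diff borel_measurable_sum borel_measurable_times am)
  qed
  define \<nu> where "\<nu> x = sqrt (cmod (inn cnt (w x) (w x)))" for x
  have \<nu>m: "\<nu> \<in> borel_measurable tor"
    using fiber_inn_measurable[OF wm wm] unfolding \<nu>_def[abs_def] by measurable
  have \<nu>c: "(\<lambda>x. complex_of_real (1 / \<nu> x)) \<in> borel_measurable tor"
    using \<nu>m by measurable
  have \<nu>n: "\<nu> x = nrm cnt (w x)" for x by (simp add: \<nu>_def inn_self norm_power)
  \<comment> \<open>Where \<open>w x\<close> has norm zero, division by zero returns 0 and so does
    \<open>u\<close>: a dependent generator adds no vector.\<close>
  define u where "u x l = complex_of_real (1 / \<nu> x) * w x l" for x l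
  have fibs: "AE x in tor. \<forall>r. \<Gamma> (e r) x \<in> sqi cnt"
    using Gamma_fiber_sqi[OF es] by (simp add: AE_all_countable)
  note hfib = Gamma_fiber_sqi[OF hs]
  have ul: "(\<lambda>x. u x l) \<in> borel_measurable tor" for l
  proof -
    have "(\<lambda>x. w x l) \<in> borel_measurable tor" using wm unc_measurable by blast
    then show ?thesis
      unfolding u_def by (intro borel_measurable_times \<nu>c)
  qed
  have u: "unc u \<in> sqi fib"
  proof (rule bounded_fiber_sqi[where C=1, OF ul])
    show "AE x in tor. u x \<in> sqi cnt \<and> nrm cnt (u x) \<le> 1"
      using fibs hfib
    proof eventually_elim
      case (elim x)
      have "w x \<in> sqi cnt" unfolding w_def using elim by (intro sqi_diff sqi_sum sqi_scale) auto
      then have "u x \<in> sqi cnt" unfolding u_def by (rule sqi_scale)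
      moreover have "nrm cnt (u x) \<le> 1" unfolding u_def nrm_scale \<nu>n by (simp add: norm_divide)
      ultimately show ?case ..
    qed
  qed
  define hh where "hh r = (if r < N then e r else h)" for r
  define cc where "cc r x = (if r < N then - (complex_of_real (1 / \<nu> x) * a r x) else complex_of_real (1 / \<nu> x))" for r x
  have "\<exists>g\<in>W. AE x in tor. \<Gamma> g x = u x"
  proof (rule Gamma_synthesis[OF W, where I="{..N}" and h=hh and c=cc, OF _ _ _ u])
    show "hh r \<in> W" for r using e h by (simp add: hh_def)
    show "cc r \<in> borel_measurable tor" for r
    proof (cases "r < N")
      case True
      have "(\<lambda>x. - (complex_of_real (1 / \<nu> x) * a r x)) \<in> borel_measurable tor"
        by (intro borel_measurable_uminus borel_measurable_times \<nu>c am)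
      then show ?thesis using True by (simp add: cc_def[abs_def])
    next
      case False
      then show ?thesis using \<nu>c by (simp add: cc_def[abs_def])
    qed
    show "AE x in tor. u x = (\<lambda>l. \<Sum>r\<le>N. cc r x * \<Gamma> (hh r) x l)"
    proof (intro AE_I2 ext)
      fix x :: "real ^ 'k" and l :: "int ^ 'k"
      have "(\<Sum>r\<le>N. cc r x * \<Gamma> (hh r) x l) = (\<Sum>r<N. - (complex_of_real (1 / \<nu> x) * a r x) * \<Gamma> (e r) x l) + complex_of_real (1 / \<nu> x) * \<Gamma> h x l"
        by (simp add: cc_def hh_def flip: lessThan_Suc_atMost)
      also have "\<dots> = u x l"
        by (simp add: u_def w_def sum_distrib_left sum_negf right_diff_distrib mult.assoc)
      finally show "u x l = (\<Sum>r\<le>N. cc r x * \<Gamma> (hh r) x l)" by simp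
    qed
  qed simp
  then obtain g where g: "g \<in> W" "AE x in tor. \<Gamma> g x = u x" by blast
  \<comment> \<open>The squared norms of the current fiber vectors are 1 at positions below
    \<open>D x\<close> and 0 afterwards, so their sum counts \<open>D x\<close>. Thus
    \<open>t r\<close> is the indicator of \<open>D x = r\<close>, in a form visibly
    measurable.\<close>
  define t where "t r x = complex_of_real (of_bool ((\<Sum>s<N. cmod (inn cnt (\<Gamma> (e s) x) (\<Gamma> (e s) x))) = real r))" for r x
  have tm: "t r \<in> borel_measurable tor" for r
  proof -
    have "(\<lambda>x. inn cnt (\<Gamma> (e s) x) (\<Gamma> (e s) x)) \<in> borel_measurable tor" for s by (rule fiber_inn_measurable[OF em em])
    then have [measurable]: "(\<lambda>x. \<Sum>s<N. cmod (inn cnt (\<Gamma> (e s) x) (\<Gamma> (e s) x))) \<in> borel_measurable tor" by simp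
    show ?thesis unfolding t_def[abs_def] of_bool_def by measurable
  qed
  have "\<exists>f\<in>W. AE x in tor. \<Gamma> f x = (\<lambda>l. \<Gamma> (e r) x l + t r x * \<Gamma> g x l)" for r
  proof (rule Gamma_synthesis[OF W, where I="{0, 1::nat}" and h="\<lambda>i. if i = 0 then e r else g" and c="\<lambda>i. if i = 0 then (\<lambda>_. 1) else t r"])
    have gs: "unc (\<Gamma> g) \<in> sqi fib" using g(1) W by (intro Gamma_sqi shift_invariant_sqi)
    have "unc (\<lambda>x l. t r x * \<Gamma> g x l) \<in> sqi fib"
    proof (rule sqi_bound[OF gs, where C=1])
      show "unc (\<lambda>x l. t r x * \<Gamma> g x l) \<in> borel_measurable fib"
      proof -
        have "(\<lambda>x. \<Gamma> g x l) \<in> borel_measurable tor" for l using sqiD(1)[OF gs] unc_measurable by blast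
        then have "(\<lambda>x. t r x * \<Gamma> g x l) \<in> borel_measurable tor" for l by (intro borel_measurable_times tm)
        then show ?thesis using unc_measurable[of "\<lambda>x l. t r x * \<Gamma> g x l"] by simp
      qed
    qed (auto simp: norm_mult t_def)
    then show "unc (\<lambda>x l. \<Gamma> (e r) x l + t r x * \<Gamma> g x l) \<in> sqi fib"
      by (rule sqi_add[OF Gamma_sqi[OF es]])
  qed (use e g tm in auto)
  then have "\<forall>r. \<exists>f. f \<in> W \<and> (AE x in tor. \<Gamma> f x = (\<lambda>l. \<Gamma> (e r) x l + t r x * \<Gamma> g x l))" by blast
  from choice[OF this] obtain e' where e': "\<forall>r. e' r \<in> W \<and> (AE x in tor. \<Gamma> (e' r) x = (\<lambda>l. \<Gamma> (e r) x l + t r x * \<Gamma> g x l))" ..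
  then have e'ae: "AE x in tor. \<forall>r. \<Gamma> (e' r) x = (\<lambda>l. \<Gamma> (e r) x l + t r x * \<Gamma> g x l)"
    by (simp add: AE_all_countable)
  have "AE x in tor. \<exists>D\<le>card (insert h A).
      (\<forall>r<D. \<forall>s<D. inn cnt (\<Gamma> (e' r) x) (\<Gamma> (e' s) x) = of_bool (r = s)) \<and>
      (\<forall>r\<ge>D. \<Gamma> (e' r) x = (\<lambda>_. 0)) \<and>
      cfun.span ((\<lambda>r. \<Gamma> (e' r) x) ` {..<D}) = cfun.span ((\<lambda>h. \<Gamma> h x) ` insert h A)"
    using ae e'ae g(2) fibs hfib
  proof eventually_elim
    case (elim x)
    define E where "E r = \<Gamma> (e r) x" for r
    define E' where "E' r = \<Gamma> (e' r) x" for r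
    obtain D where D: "D \<le> N" "\<And>r s. r < D \<Longrightarrow> s < D \<Longrightarrow> inn cnt (E r) (E s) = of_bool (r = s)"
      "\<And>r. r \<ge> D \<Longrightarrow> E r = (\<lambda>_. 0)" "cfun.span (E ` {..<D}) = cfun.span ((\<lambda>h. \<Gamma> h x) ` A)"
      using elim(1) unfolding E_def N_def by blast
    have Es: "E r \<in> sqi cnt" for r using elim(4) by (simp add: E_def)
    have ws: "w x \<in> sqi cnt" unfolding w_def using elim by (intro sqi_diff sqi_sum sqi_scale) auto
    have "(\<Sum>s<N. cmod (inn cnt (E s) (E s))) = (\<Sum>s<D. cmod (inn cnt (E s) (E s)))"
      using D by (intro sum.mono_neutral_right) auto
    also have "\<dots> = real D" using D by simp
    finally have t: "t r x = of_bool (r = D)" for r by (auto simp: t_def E_def)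
    have E': "E' r = (\<lambda>l. E r l + of_bool (r = D) * u x l)" for r
      using elim(2,3) by (simp add: E_def E'_def t)
    define p where "p = (\<lambda>l. \<Sum>r<D. a r x * E r l)"
    have wp: "w x = (\<lambda>l. \<Gamma> h x l - p l)"
    proof
      fix l
      have "(\<Sum>r<N. a r x * E r l) = (\<Sum>r<D. a r x * E r l)"
        using D by (intro sum.mono_neutral_right) auto
      then show "w x l = \<Gamma> h x l - p l" by (simp add: w_def p_def E_def)
    qed
    have ps: "p \<in> cfun.span (E ` {..<D})"
      unfolding p_def by (intro cfun_span_sum cfun.span_base imageI)
    let ?B = "(\<lambda>h. \<Gamma> h x) ` A"
    have sp: "p \<in> cfun.span ?B" using ps D(4) by simp
    have mono1: "cfun.span ?B \<subseteq> cfun.span (insert (\<Gamma> h x) ?B)" by (rule cfun.span_mono) auto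
    have hw: "\<Gamma> h x = w x + p" by (simp add: wp fun_eq_iff)
    show ?case
    \<comment> \<open>If \<open>w x\<close> vanishes, \<open>\<Gamma> h x\<close> already lies in
      the span and \<open>D\<close> is kept; otherwise the unit vector occupies position
      \<open>D\<close> and the count increases by one.\<close>
    proof (cases "\<nu> x = 0")
      case True
      then have w0: "w x = (\<lambda>l. 0)" using sqi_cnt_eq_zero[OF ws] by (simp add: \<nu>n)
      then have "E' r = E r" for r unfolding E' by (simp add: u_def)
      then have EE: "E' = E" by (rule ext)
      have "\<Gamma> h x = p" using hw w0 by (simp add: fun_eq_iff)
      then have "cfun.span (insert (\<Gamma> h x) ?B) = cfun.span ?B"
        using sp cfun.span_redundant by simp
      then show ?thesis
        using D EE insert.hyps unfolding E'_def[symmetric] by (intro exI[of _ D]) (auto simp: N_def)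
    next
      case False
      have us: "u x \<in> sqi cnt" unfolding u_def by (rule sqi_scale[OF ws])
      have uu: "inn cnt (u x) (u x) = 1"
      proof -
        have "nrm cnt (u x) = 1" unfolding u_def nrm_scale using False by (simp add: \<nu>n norm_divide)
        then show ?thesis by (simp add: inn_self)
      qed
      have ue: "inn cnt (u x) (E s) = 0" if s: "s < D" for s
      proof -
        have "inn cnt p (E s) = (\<Sum>r<D. a r x * inn cnt (E r) (E s))"
          unfolding p_def by (rule inn_sum_left[OF Es Es])
        also have "\<dots> = (\<Sum>r<D. if r = s then a r x else 0)"
          by (intro sum.cong refl) (use D s in auto)
        also have "\<dots> = a s x" using s by simp
        finally have "inn cnt (w x) (E s) = 0"
          unfolding wp using elim Es by (subst inn_diff_left) (auto simp: a_def E_def p_def intro!: sqi_sum sqi_scale)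
        then show ?thesis unfolding u_def inn_scale_left by simp
      qed
      have eu: "inn cnt (E s) (u x) = 0" if "s < D" for s using ue[OF that] inn_cnj[of cnt "u x" "E s"] by simp
      have E'lt: "E' r = E r" if "r < D" for r using that unfolding E' by simp
      have E'D: "E' D = u x" unfolding E' using D(3)[of D] by simp
      have E'gt: "E' r = (\<lambda>_. 0)" if "r > D" for r using that D(3)[of r] unfolding E' by simp
      have on: "inn cnt (E' r) (E' s) = of_bool (r = s)" if "r < Suc D" "s < Suc D" for r s
        using that D(2) uu ue eu by (cases "r = D"; cases "s = D") (auto simp: E'lt E'D less_Suc_eq)
      have img: "E' ` {..<Suc D} = insert (u x) (E ` {..<D})"
        by (auto simp: lessThan_Suc E'D E'lt image_iff)
      have "cfun.span (insert (u x) (E ` {..<D})) = cfun.span (insert (\<Gamma> h x) ?B)"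
      proof (intro equalityI cfun.span_minimal cfun.subspace_span insert_subsetI)
        have "(\<lambda>l. complex_of_real (1 / \<nu> x) * (\<Gamma> h x - p) l) \<in> cfun.span (insert (\<Gamma> h x) ?B)"
          by (intro cfun.span_scale cfun.span_diff) (use sp mono1 in \<open>auto intro: cfun.span_base\<close>)
        then show "u x \<in> cfun.span (insert (\<Gamma> h x) ?B)" unfolding u_def wp by simp
        show "E ` {..<D} \<subseteq> cfun.span (insert (\<Gamma> h x) ?B)"
          using cfun.span_superset[of "E ` {..<D}"] D(4) mono1 by auto
        have mono2: "cfun.span (E ` {..<D}) \<subseteq> cfun.span (insert (u x) (E ` {..<D}))" by (rule cfun.span_mono) auto
        have "w x = (\<lambda>l. complex_of_real (\<nu> x) * u x l)" unfolding u_def using False by simp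
        then have "w x \<in> cfun.span (insert (u x) (E ` {..<D}))"
          using cfun.span_scale[OF cfun.span_base[of "u x" "insert (u x) (E ` {..<D})"]] by simp
        then show "\<Gamma> h x \<in> cfun.span (insert (u x) (E ` {..<D}))"
          unfolding hw using ps mono2 by (intro cfun.span_add) auto
        show "?B \<subseteq> cfun.span (insert (u x) (E ` {..<D}))"
          using cfun.span_superset[of ?B] D(4) mono2 by auto
      qed
      then have "cfun.span (E' ` {..<Suc D}) = cfun.span ((\<lambda>h. \<Gamma> h x) ` insert h A)"
        unfolding img by simp
      then show ?thesis
        using D(1) insert.hyps on E'gt unfolding E'_def[symmetric]
        by (intro exI[of _ "Suc D"]) (auto simp: N_def Suc_le_eq)
    qed
  qed
  then show ?case using e' by (intro exI[of _ e']) blast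
qed

end

section \<open>Eigensteps\<close>

lemma orthonormal_columns_mult:
  assumes U: "orthonormal_columns n U" and Q: "orthonormal_columns n Q"
  shows "orthonormal_columns n (\<lambda>p l. \<Sum>q<n. U p q * Q q l)"
  unfolding orthonormal_columns_def
proof (intro allI impI)
  fix l m assume lm: "l < n" "m < n"
  have "(\<Sum>p<n. (\<Sum>q<n. U p q * Q q l) * (\<Sum>s<n. U p s * Q s m))
     = (\<Sum>p<n. \<Sum>q<n. \<Sum>s<n. (Q q l * Q s m) * (U p q * U p s))"
    by (simp add: sum_product mult_ac)
  also have "\<dots> = (\<Sum>q<n. \<Sum>p<n. \<Sum>s<n. (Q q l * Q s m) * (U p q * U p s))"
    by (rule sum.swap)
  also have "\<dots> = (\<Sum>q<n. \<Sum>s<n. \<Sum>p<n. (Q q l * Q s m) * (U p q * U p s))"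
    by (intro sum.cong refl sum.swap)
  also have "\<dots> = (\<Sum>q<n. \<Sum>s<n. of_bool (q = s) * (Q q l * Q s m))"
    using U by (intro sum.cong refl) (simp add: orthonormal_columns_def flip: sum_distrib_left)
  also have "\<dots> = (\<Sum>q<n. Q q l * Q q m)"
    by (intro sum.cong refl) (simp add: sum_of_bool_mult(1))
  also have "\<dots> = of_bool (l = m)" using Q lm by (simp add: orthonormal_columns_def)
  finally show "(\<Sum>p<n. (\<Sum>q<n. U p q * Q q l) * (\<Sum>s<n. U p s * Q s m)) = of_bool (l = m)" .
qed

lemma orthonormal_columns_transpose: "orthonormal_columns n U \<Longrightarrow> orthonormal_columns n (\<lambda>r p. U p r)"
  using orthogonal_rows[of n U] by (simp add: orthonormal_columns_def)

text \<open>Evaluates a bilinear form with matrix \<open>U diag(L) U^T\<close> in the eigenbasis.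
  The scalars are general because it is applied to real coefficient matrices and again to complex
  expansions on the fibers.\<close>

lemma conjugate_sum:
  fixes X Y :: "nat \<Rightarrow> 'a::comm_semiring_1"
  assumes "\<And>p q. p < n \<Longrightarrow> q < n \<Longrightarrow> S p q = (\<Sum>l<n. U p l * L l * U q l)"
  shows "(\<Sum>p<n. \<Sum>q<n. X p * S p q * Y q) = (\<Sum>l<n. (\<Sum>p<n. X p * U p l) * L l * (\<Sum>q<n. Y q * U q l))"
proof -
  have "(\<Sum>p<n. \<Sum>q<n. X p * S p q * Y q) = (\<Sum>p<n. \<Sum>q<n. \<Sum>l<n. (X p * U p l) * L l * (Y q * U q l))"
    by (intro sum.cong refl) (simp add: assms sum_distrib_left sum_distrib_right mult_ac)
  also have "\<dots> = (\<Sum>p<n. \<Sum>l<n. \<Sum>q<n. (X p * U p l) * L l * (Y q * U q l))"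
    by (intro sum.cong refl sum.swap)
  also have "\<dots> = (\<Sum>l<n. \<Sum>p<n. \<Sum>q<n. (X p * U p l) * L l * (Y q * U q l))"
    by (rule sum.swap)
  also have "\<dots> = (\<Sum>l<n. (\<Sum>p<n. X p * U p l) * L l * (\<Sum>q<n. Y q * U q l))"
    by (simp add: sum_distrib_left sum_distrib_right mult_ac)
  finally show ?thesis .
qed

text \<open>A sum of products of two linear forms is one bilinear form with matrix the sum of the
  outer products of the \<open>b i\<close>. Applied in reverse roles to matrices and to frame
  operators.\<close>

lemma rank_one_sum_swap:
  fixes X Y :: "nat \<Rightarrow> 'a::comm_semiring_1"
  shows "(\<Sum>i\<in>I. (\<Sum>r<n. b i r * X r) * (\<Sum>s<n. b i s * Y s)) = (\<Sum>r<n. \<Sum>s<n. X r * (\<Sum>i\<in>I. b i r * b i s) * Y s)"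
proof -
  have "(\<Sum>i\<in>I. (\<Sum>r<n. b i r * X r) * (\<Sum>s<n. b i s * Y s)) = (\<Sum>i\<in>I. \<Sum>r<n. \<Sum>s<n. X r * (b i r * b i s) * Y s)"
    by (simp add: sum_product mult_ac)
  also have "\<dots> = (\<Sum>r<n. \<Sum>i\<in>I. \<Sum>s<n. X r * (b i r * b i s) * Y s)" by (rule sum.swap)
  also have "\<dots> = (\<Sum>r<n. \<Sum>s<n. \<Sum>i\<in>I. X r * (b i r * b i s) * Y s)"
    by (intro sum.cong refl sum.swap)
  finally show ?thesis by (simp add: sum_distrib_left sum_distrib_right)
qed

text \<open>The product of \<open>Q 0\<close> up to \<open>Q (j - 1)\<close>. For the updates
  considered here its columns are eigenvectors, in the initial coordinates, of the sum of the first
  \<open>j\<close> outer products.\<close>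

primrec step_basis :: "nat \<Rightarrow> (nat \<Rightarrow> nat \<Rightarrow> nat \<Rightarrow> real) \<Rightarrow> nat \<Rightarrow> nat \<Rightarrow> nat \<Rightarrow> real" where
  "step_basis n Q 0 = (\<lambda>p l. of_bool (p = l))"
| "step_basis n Q (Suc j) = (\<lambda>p l. \<Sum>q<n. step_basis n Q j p q * Q j q l)"

text \<open>The update vector \<open>c i\<close> is given in the eigenbasis reached after
  \<open>i\<close> steps. The inner sum returns it to the initial coordinates, the outer one rotates
  it into the final eigenbasis.\<close>

definition step_vector :: "nat \<Rightarrow> (nat \<Rightarrow> nat \<Rightarrow> real) \<Rightarrow> (nat \<Rightarrow> nat \<Rightarrow> nat \<Rightarrow> real) \<Rightarrow> nat \<Rightarrow> nat \<Rightarrow> real" where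
  "step_vector n c Q i r = (\<Sum>p<n. step_basis n Q n p r * (\<Sum>q<n. step_basis n Q i p q * c i q))"

text \<open>The eigenvectors after \<open>j\<close> steps, written in the eigenbasis of the last
  step.\<close>

definition final_basis :: "nat \<Rightarrow> (nat \<Rightarrow> nat \<Rightarrow> nat \<Rightarrow> real) \<Rightarrow> nat \<Rightarrow> nat \<Rightarrow> nat \<Rightarrow> real" where
  "final_basis n Q j r l = (\<Sum>p<n. step_basis n Q n p r * step_basis n Q j p l)"

text \<open>The vectors are expressed in the eigenbasis of the last frame operator, so that coordinates
  with vanishing final eigenvalue vanish.\<close>

lemma step_vectors:
  assumes u: "\<And>j. j < n \<Longrightarrow> rank_one_update n (L j) (L (Suc j)) (c j) (Q j)"
    and L0: "\<And>r. r < n \<Longrightarrow> L 0 r = 0"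
  shows "j \<le> n \<Longrightarrow> orthonormal_columns n (final_basis n Q j)"
    and "j \<le> n \<Longrightarrow> r < n \<Longrightarrow> s < n \<Longrightarrow>
      (\<Sum>i<j. step_vector n c Q i r * step_vector n c Q i s) = (\<Sum>l<n. final_basis n Q j r l * L j l * final_basis n Q j s l)"
    and "r < n \<Longrightarrow> s < n \<Longrightarrow> (\<Sum>i<n. step_vector n c Q i r * step_vector n c Q i s) = of_bool (r = s) * L n r"
proof -
  define U where "U = step_basis n Q"
  define a where "a i p = (\<Sum>q<n. U i p q * c i q)" for i p
  have U: "orthonormal_columns n (U j)" if "j \<le> n" for j
    using that
  proof (induction j)
    case 0
    have "(\<Sum>i<n. of_bool (i = l) * of_bool (i = m)) = (of_bool (l = m) :: real)" if "l < n" for l m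
    proof -
      have "(\<Sum>i<n. of_bool (i = l) * of_bool (i = m)) = (\<Sum>i<n. of_bool (l = i) * (of_bool (i = m) :: real))"
        by (intro sum.cong refl) auto
      then show ?thesis using sum_of_bool_mult(1)[OF that, of "\<lambda>i. of_bool (i = m)"] by simp
    qed
    then show ?case by (simp add: U_def orthonormal_columns_def)
  next
    case (Suc j)
    then have "orthonormal_columns n (U j)" "orthonormal_columns n (Q j)" using u[of j] by (auto simp: rank_one_update_def)
    from orthonormal_columns_mult[OF this] show ?case by (simp add: U_def)
  qed
  \<comment> \<open>The invariant: the first \<open>j\<close> outer products sum to
    \<open>U j diag(L j) (U j)^T\<close>. Conjugating the update identity by \<open>U j\<close> adds
    exactly the outer product of \<open>a j\<close> with itself.\<close>
  have T: "(\<Sum>i<j. a i p * a i q) = (\<Sum>l<n. U j p l * L j l * U j q l)" if "j \<le> n" "p < n" "q < n" for j p q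
    using that
  proof (induction j)
    case 0
    then show ?case by (simp add: L0)
  next
    case (Suc j)
    have uj: "of_bool (i = k) * L j i + c j i * c j k = (\<Sum>l<n. Q j i l * L (Suc j) l * Q j k l)" if "i < n" "k < n" for i k
      using u[of j] Suc.prems that by (auto simp: rank_one_update_def)
    have "(\<Sum>l<n. U (Suc j) p l * L (Suc j) l * U (Suc j) q l)
        = (\<Sum>i<n. \<Sum>k<n. U j p i * (of_bool (i = k) * L j i + c j i * c j k) * U j q k)"
      using conjugate_sum[of n "\<lambda>i k. of_bool (i = k) * L j i + c j i * c j k" "Q j" "L (Suc j)" "U j p" "U j q", OF uj]
      by (simp add: U_def)
    also have "\<dots> = (\<Sum>i<n. \<Sum>k<n. of_bool (i = k) * (U j p i * L j i * U j q k)) + (\<Sum>i<n. \<Sum>k<n. (U j p i * c j i) * (U j q k * c j k))"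
      by (simp add: sum.distrib[symmetric] algebra_simps)
    also have "(\<Sum>i<n. \<Sum>k<n. of_bool (i = k) * (U j p i * L j i * U j q k)) = (\<Sum>i<n. U j p i * L j i * U j q i)"
      by (intro sum.cong refl) (simp add: sum_of_bool_mult(1))
    also have "(\<Sum>i<n. \<Sum>k<n. (U j p i * c j i) * (U j q k * c j k)) = a j p * a j q"
      by (simp add: a_def sum_product)
    finally show ?case using Suc by simp
  qed
  have fb: "final_basis n Q j = (\<lambda>r l. \<Sum>p<n. U n p r * U j p l)" for j
    by (simp add: fun_eq_iff final_basis_def U_def)
  have sv: "step_vector n c Q i r = (\<Sum>p<n. U n p r * a i p)" for i r
    by (simp add: step_vector_def U_def a_def)
  show "orthonormal_columns n (final_basis n Q j)" if "j \<le> n" for j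
    unfolding fb using orthonormal_columns_mult[OF orthonormal_columns_transpose[OF U[of n]] U[OF that]] by simp
  show B: "(\<Sum>i<j. step_vector n c Q i r * step_vector n c Q i s) = (\<Sum>l<n. final_basis n Q j r l * L j l * final_basis n Q j s l)"
    if j: "j \<le> n" and rs: "r < n" "s < n" for j r s
  proof -
    have "(\<Sum>i<j. step_vector n c Q i r * step_vector n c Q i s) = (\<Sum>p<n. \<Sum>q<n. U n p r * (\<Sum>i<j. a i p * a i q) * U n q s)"
      unfolding sv using rank_one_sum_swap[where n=n and b=a and X="\<lambda>p. U n p r" and Y="\<lambda>p. U n p s" and I="{..<j}"] by (simp add: mult.commute)
    also have "\<dots> = (\<Sum>l<n. (\<Sum>p<n. U n p r * U j p l) * L j l * (\<Sum>q<n. U n q s * U j q l))"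
      by (rule conjugate_sum) (rule T[OF j])
    finally show ?thesis by (simp add: fb)
  qed
  show "(\<Sum>i<n. step_vector n c Q i r * step_vector n c Q i s) = of_bool (r = s) * L n r" if rs: "r < n" "s < n" for r s
  proof -
    \<comment> \<open>At \<open>j = n\<close> the change of basis is the identity, so the sum of all
      outer products is diagonal in these coordinates.\<close>
    have I: "final_basis n Q n r l = of_bool (r = l)" if "r < n" "l < n" for r l
      using U[of n] that by (simp add: fb orthonormal_columns_def)
    have "(\<Sum>l<n. final_basis n Q n r l * L n l * final_basis n Q n s l) = (\<Sum>l<n. of_bool (r = l) * (L n l * of_bool (s = l)))"
      by (intro sum.cong refl) (simp add: I rs)
    also have "\<dots> = L n r * of_bool (s = r)" by (rule sum_of_bool_mult(1)[OF rs(1)])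
    finally show ?thesis using B[of n r s] rs by (cases "r = s") simp_all
  qed
qed

section \<open>The spectrum of a partial frame operator on one fiber\<close>

lemma nonincreasing_positive_prefix:
  fixes L :: "nat \<Rightarrow> real"
  assumes dec: "\<And>r s. r \<le> s \<Longrightarrow> s < n \<Longrightarrow> L s \<le> L r" and nonneg: "\<And>r. r < n \<Longrightarrow> 0 \<le> L r"
  obtains m where "m \<le> n" "\<And>r. r < m \<Longrightarrow> L r > 0" "\<And>r. m \<le> r \<Longrightarrow> r < n \<Longrightarrow> L r = 0"
proof -
  define m where "m = (LEAST r. n \<le> r \<or> L r = 0)"
  have P: "n \<le> m \<or> L m = 0" unfolding m_def by (rule LeastI[of _ n]) simp
  have mn: "m \<le> n" unfolding m_def by (rule Least_le) simp
  have "L r > 0" if "r < m" for r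
    using not_less_Least[of r "\<lambda>r. n \<le> r \<or> L r = 0"] that nonneg[of r] mn unfolding m_def[symmetric] by auto
  moreover have "L r = 0" if "m \<le> r" "r < n" for r
    using P dec[OF that] nonneg[OF that(2)] that by auto
  ultimately show ?thesis using mn that by blast
qed

text \<open>Expanding the frame vectors in \<open>E\<close> and diagonalizing their coefficient
  matrix by \<open>V\<close> gives a diagonal form in the vectors \<open>w l\<close>, the columns of
  \<open>V\<close> transplanted along \<open>E\<close>. As \<open>E\<close> is orthonormal only
  below \<open>D\<close>, orthonormality of the \<open>w l\<close> is available just for positive
  eigenvalues \<open>L l\<close>, and those are the ones that \<open>eigval_orthonormal\<close> asks
  for.\<close>

lemma eigval_frame:
  fixes E :: "nat \<Rightarrow> int ^ 'k \<Rightarrow> complex" and b V :: "nat \<Rightarrow> nat \<Rightarrow> real" and L :: "nat \<Rightarrow> real"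
  assumes E: "\<And>r. E r \<in> sqi cnt" and on: "\<And>r s. r < D \<Longrightarrow> s < D \<Longrightarrow> inn cnt (E r) (E s) = of_bool (r = s)"
    and E0: "\<And>r. D \<le> r \<Longrightarrow> E r = (\<lambda>_. 0)"
    and V: "orthonormal_columns n V"
    and bb: "\<And>r s. r < n \<Longrightarrow> s < n \<Longrightarrow> (\<Sum>i<j. b i r * b i s) = (\<Sum>l<n. V r l * L l * V s l)"
    and b0: "\<And>i r. i < j \<Longrightarrow> D \<le> r \<Longrightarrow> r < n \<Longrightarrow> b i r = 0"
    and dec: "\<And>r s. r \<le> s \<Longrightarrow> s < n \<Longrightarrow> L s \<le> L r" and nonneg: "\<And>r. r < n \<Longrightarrow> 0 \<le> L r"
    and T: "\<And>\<xi>. \<xi> \<in> sqi cnt \<Longrightarrow> T \<xi> = (\<lambda>l. \<Sum>i<j. inn cnt \<xi> (\<lambda>l. \<Sum>r<n. complex_of_real (b i r) * E r l) * (\<Sum>r<n. complex_of_real (b i r) * E r l))"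
    and q: "1 \<le> q" "q \<le> n"
  shows "eigval q T = L (q - 1)"
proof -
  obtain m where m: "m \<le> n" "\<And>r. r < m \<Longrightarrow> L r > 0" "\<And>r. m \<le> r \<Longrightarrow> r < n \<Longrightarrow> L r = 0"
    using nonincreasing_positive_prefix[of n L] dec nonneg by blast
  \<comment> \<open>For \<open>r\<close> beyond \<open>D\<close> the diagonal entry of the
    coefficient matrix is a sum of squares of vanishing coordinates. It also equals the sum of
    \<open>L l * (V r l)\<^sup>2\<close>, so columns with positive eigenvalue have no entry in row
    \<open>r\<close>.\<close>
  have V0: "V r l = 0" if "D \<le> r" "r < n" "l < m" for r l
  proof -
    have "(\<Sum>l<n. V r l * L l * V r l) = (\<Sum>i<j. b i r * b i r)" using bb[OF that(2) that(2)] by simp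
    also have "\<dots> = 0" using b0 that by simp
    finally have "(\<Sum>l<n. L l * (V r l)\<^sup>2) = 0" by (simp add: power2_eq_square mult_ac)
    then have "L l * (V r l)\<^sup>2 = 0"
      using that m(1) nonneg by (subst (asm) sum_nonneg_eq_0_iff) auto
    then show ?thesis using m(2)[OF that(3)] by simp
  qed
  define w where "w l = (\<lambda>x. \<Sum>r<n. complex_of_real (V r l) * E r x)" for l
  have ws: "w l \<in> sqi cnt" for l unfolding w_def by (intro sqi_sum sqi_scale E)
  have EE: "inn cnt (E r) (E s) = of_bool (r = s \<and> r < D)" for r s
  proof (cases "r < D \<and> s < D")
    case True
    then show ?thesis using on by simp
  next
    case False
    then have "inn cnt (E r) (E s) = 0"
    proof (cases "r < D")
      case True
      then have "E s = (\<lambda>_. 0)" using False E0 by simp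
      then show ?thesis by (simp add: inn_def)
    next
      case F: False
      then show ?thesis using E0[of r] by simp
    qed
    then show ?thesis using False by auto
  qed
  have wE: "inn cnt (w l) (E s) = complex_of_real (V s l) * of_bool (s < D)" if "s < n" for l s
  proof -
    have "inn cnt (w l) (E s) = (\<Sum>r<n. complex_of_real (V r l) * inn cnt (E r) (E s))"
      unfolding w_def by (rule inn_sum_left[OF E E])
    also have "\<dots> = (\<Sum>r<n. if r = s then complex_of_real (V r l) * of_bool (s < D) else 0)"
      by (intro sum.cong refl) (simp add: EE)
    finally show ?thesis using that by simp
  qed
  have on_w: "inn cnt (w l) (w l') = of_bool (l = l')" if "l < m" "l' < m" for l l'
  proof -
    have "inn cnt (w l) (w l') = (\<Sum>s<n. cnj (complex_of_real (V s l')) * inn cnt (w l) (E s))"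
      unfolding w_def[of l'] by (rule inn_sum_right[OF E ws])
    also have "\<dots> = (\<Sum>s<n. complex_of_real (V s l * V s l'))"
    proof (intro sum.cong refl)
      fix s assume s: "s \<in> {..<n}"
      then show "cnj (complex_of_real (V s l')) * inn cnt (w l) (E s) = complex_of_real (V s l * V s l')"
        using V0[of s l] that by (cases "s < D") (auto simp: wE)
    qed
    also have "\<dots> = complex_of_real (\<Sum>s<n. V s l * V s l')" by simp
    also have "(\<Sum>s<n. V s l * V s l') = of_bool (l = l')" using V that m(1) by (simp add: orthonormal_columns_def)
    finally show ?thesis by simp
  qed
  have "eigval q T = (if q \<le> m then L (q - 1) else 0)"
  proof (rule eigval_orthonormal[OF ws on_w m(2) _ _ q(1)])
    show "L s \<le> L r" if "r \<le> s" "s < m" for r s using dec that m(1) by simp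
    fix \<xi> :: "int ^ 'k \<Rightarrow> complex" assume \<xi>: "\<xi> \<in> sqi cnt"
    show "T \<xi> = (\<lambda>x. \<Sum>l<m. complex_of_real (L l) * inn cnt \<xi> (w l) * w l x)"
    proof
      fix x
      have bbc: "(\<Sum>i<j. complex_of_real (b i r) * complex_of_real (b i s)) = (\<Sum>l<n. complex_of_real (V r l) * complex_of_real (L l) * complex_of_real (V s l))"
        if "r < n" "s < n" for r s
        using arg_cong[OF bb[OF that], of complex_of_real] by simp
      have "T \<xi> x = (\<Sum>i<j. (\<Sum>r<n. complex_of_real (b i r) * inn cnt \<xi> (E r)) * (\<Sum>s<n. complex_of_real (b i s) * E s x))"
        unfolding T[OF \<xi>] by (intro sum.cong refl) (simp add: inn_sum_right[OF E \<xi>])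
      also have "\<dots> = (\<Sum>r<n. \<Sum>s<n. inn cnt \<xi> (E r) * (\<Sum>i<j. complex_of_real (b i r) * complex_of_real (b i s)) * E s x)"
        by (rule rank_one_sum_swap)
      also have "\<dots> = (\<Sum>l<n. (\<Sum>r<n. inn cnt \<xi> (E r) * complex_of_real (V r l)) * complex_of_real (L l) * (\<Sum>s<n. E s x * complex_of_real (V s l)))"
        by (rule conjugate_sum[OF bbc])
      also have "\<dots> = (\<Sum>l<n. complex_of_real (L l) * inn cnt \<xi> (w l) * w l x)"
      proof (intro sum.cong refl)
        fix l assume "l \<in> {..<n}"
        have "inn cnt \<xi> (w l) = (\<Sum>r<n. inn cnt \<xi> (E r) * complex_of_real (V r l))"
          unfolding w_def inn_sum_right[OF E \<xi>] by (simp add: mult.commute)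
        moreover have "w l x = (\<Sum>s<n. E s x * complex_of_real (V s l))"
          unfolding w_def by (simp only: mult.commute)
        ultimately show "(\<Sum>r<n. inn cnt \<xi> (E r) * complex_of_real (V r l)) * complex_of_real (L l) * (\<Sum>s<n. E s x * complex_of_real (V s l))
          = complex_of_real (L l) * inn cnt \<xi> (w l) * w l x" by (simp only: mult_ac)
      qed
      also have "\<dots> = (\<Sum>l<m. complex_of_real (L l) * inn cnt \<xi> (w l) * w l x)"
        using m by (intro sum.mono_neutral_right) auto
      finally show "T \<xi> x = (\<Sum>l<m. complex_of_real (L l) * inn cnt \<xi> (w l) * w l x)" .
    qed
  qed
  then show ?thesis using m(3)[of "q - 1"] q by auto
qed

lemma nrm_sum_le:
  assumes "\<And>i. i \<in> I \<Longrightarrow> f i \<in> sqi M"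
  shows "nrm M (\<lambda>x. \<Sum>i\<in>I. c i * f i x) \<le> (\<Sum>i\<in>I. cmod (c i) * nrm M (f i))"
  using assms
proof (induction I rule: infinite_finite_induct)
  case (insert i I)
  have "nrm M (\<lambda>x. c i * f i x + (\<Sum>i\<in>I. c i * f i x)) \<le> nrm M (\<lambda>x. c i * f i x) + nrm M (\<lambda>x. \<Sum>i\<in>I. c i * f i x)"
    using insert.prems by (intro nrm_triangle sqi_sum sqi_scale) auto
  moreover have "nrm M (\<lambda>x. \<Sum>i\<in>I. c i * f i x) \<le> (\<Sum>i\<in>I. cmod (c i) * nrm M (f i))"
    using insert by simp
  ultimately show ?case using insert.hyps by (simp add: nrm_scale)
qed auto

lemma finite_generators_subset:
  assumes "finite_generators A W"
  shows "finite A" "A \<subseteq> W"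
proof -
  show "finite A" using assms by (simp add: finite_generators_def)
  show "A \<subseteq> W"
  proof
    fix h assume h: "h \<in> A"
    have "int_vec 0 = (0 :: real ^ 'a)" by (simp add: int_vec_def vec_eq_iff)
    then have "h = translation (int_vec 0) h" by (simp add: translation_def)
    then have "h \<in> {translation (int_vec l) f | l f. f \<in> A}" using h by blast
    then have "h \<in> cfun.span {translation (int_vec l) f | l f. f \<in> A}" by (rule cfun.span_base)
    moreover have "h \<in> L2" using assms h by (auto simp: finite_generators_def)
    moreover have "L2_tendsto (\<lambda>m. h) h" by (simp add: L2_tendsto_def L2_norm_def)
    ultimately have "h \<in> L2_closure (cfun.span {translation (int_vec l) f | l f. f \<in> A})"
      unfolding L2_closure_def by (intro CollectI conjI exI[of _ "\<lambda>_. h"] allI)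
    then show "h \<in> W" using assms by (simp add: finite_generators_def)
  qed
qed

section \<open>Assembly of the generators from the eigensteps\<close>

theorem theorem3p14:
  fixes W :: "(real ^ 'k \<Rightarrow> complex) set"
    and J :: "real ^ 'k \<Rightarrow> (int ^ 'k \<Rightarrow> complex) set"
    and d :: "real ^ 'k \<Rightarrow> nat"
    and n :: nat
    and lam \<alpha> :: "nat \<Rightarrow> real ^ 'k \<Rightarrow> real"
    and \<Lambda> :: "nat \<Rightarrow> nat \<Rightarrow> real ^ 'k \<Rightarrow> real"
  assumes "FSI W"
    and "is_range_function W J"
    and "\<forall>x\<in>torus. d x = cfun.dim (J x)"
    and "1 \<le> n"
    and "\<forall>i\<in>{1..n}. measurable_nonneg (lam i) \<and> measurable_nonneg (\<alpha> i)"
    and "admissible n d lam \<alpha>"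
    and ess_bounded: "\<exists>B. \<forall>i\<in>{1..n}. AE x in lebesgue_on torus. lam i x \<le> B"
    and "eigensteps n lam \<alpha> \<Lambda>"
  shows "\<exists>F. (\<forall>i\<in>{1..n}. F i \<in> W) \<and> bessel n F \<and>
             (\<forall>j\<in>{1..n}. \<forall>i\<in>{1..j}. AE x in lebesgue_on torus.
                \<Lambda> i j x = eigval i (frame_fiber j F x))"
proof -
  have W: "shift_invariant W" using assms(1) by (simp add: FSI_def)
  obtain A where A: "finite_generators A W" "AE x in tor. J x = cfun.span ((\<lambda>h. \<Gamma> h x) ` A)"
    using assms(2) by (auto simp: is_range_function_def)
  from orthonormal_generators[OF W finite_generators_subset[OF A(1)]] obtain e where
    e: "\<forall>r. e r \<in> W" and e_ae: "AE x in tor. \<exists>D\<le>card A.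
      (\<forall>r<D. \<forall>s<D. inn cnt (\<Gamma> (e r) x) (\<Gamma> (e s) x) = of_bool (r = s)) \<and>
      (\<forall>r\<ge>D. \<Gamma> (e r) x = (\<lambda>_. 0)) \<and>
      cfun.span ((\<lambda>r. \<Gamma> (e r) x) ` {..<D}) = cfun.span ((\<lambda>h. \<Gamma> h x) ` A)"
    by (elim exE conjE)
  have es: "e r \<in> sqi lebesgue" for r using e W shift_invariant_sqi by blast
  have e_fib: "AE x in tor. \<forall>r. \<Gamma> (e r) x \<in> sqi cnt"
    using Gamma_fiber_sqi[OF es] by (simp add: AE_all_countable)
  obtain B0 where B0: "\<forall>i\<in>{1..n}. AE x in tor. lam i x \<le> B0" using ess_bounded by blast
  \<comment> \<open>Made nonnegative so that \<open>sqrt B\<close>, and with it the fiber bound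
    \<open>C\<close>, is nonnegative.\<close>
  define B where "B = max B0 0"
  \<comment> \<open>Indices are shifted to start at 0 and each list is padded with zeros; in
    particular \<open>L 0\<close> is the spectrum of the zero operator, from which the iteration
    starts.\<close>
  define L where "L j r x = (if r < j then \<Lambda> (Suc r) j x else 0)" for j r x
  have \<Lambda>m: "\<Lambda> i j \<in> borel_measurable tor" "x \<in> torus \<Longrightarrow> 0 \<le> \<Lambda> i j x" if "j \<in> {1..n}" "i \<in> {1..j}" for i j x
    using assms(8) that by (auto simp: eigensteps_def measurable_nonneg_def)
  have Lm: "L j r \<in> borel_measurable tor" if "j \<le> n" for j r
    using \<Lambda>m(1)[of j "Suc r"] that by (cases "r < j") (auto simp: L_def[abs_def])
  have L_nonneg: "0 \<le> L j r x" if "j \<le> n" "x \<in> torus" for j r x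
    using \<Lambda>m(2)[of j "Suc r" x] that by (auto simp: L_def)
  have step_ae: "AE x in tor. \<forall>j\<in>{1..<n}. \<forall>i\<in>{1..j}. \<Lambda> i (j+1) x \<ge> \<Lambda> i j x \<and> \<Lambda> i j x \<ge> \<Lambda> (i+1) (j+1) x"
    using assms(8) unfolding eigensteps_def by (intro AE_finite_allI) auto
  have top_ae: "AE x in tor. \<forall>i\<in>{1..n}. \<Lambda> i n x = lam i x \<and> lam i x \<le> B0"
    using assms(8) B0 unfolding eigensteps_def by (intro AE_finite_allI AE_conjI) auto
  have d_ae: "AE x in tor. \<forall>i\<in>{1..n}. min n (d x) + 1 \<le> i \<longrightarrow> lam i x = 0"
    using assms(6) by (simp add: admissible_def)
  obtain cs Qs where cs: "\<And>i. cs i \<in> borel_measurable borel" and Qs: "\<And>i l. Qs i l \<in> borel_measurable borel"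
    and sel: "\<And>x y. interlaced n B x y \<Longrightarrow> rank_one_update n x y (\<lambda>i. cs i (x, y)) (\<lambda>i l. Qs i l (x, y))"
    by (rule rank_one_measurable[of n B]) blast
  define P where "P j x = ((\<lambda>r. L j r x), (\<lambda>r. L (Suc j) r x))" for j x
  define c where "c x = (\<lambda>j i. cs i (P j x))" for x
  define Q where "Q x = (\<lambda>j i l. Qs i l (P j x))" for x
  define b where "b i r x = step_vector n (c x) (Q x) i r" for i r x
  have Pm: "P j \<in> borel_measurable tor" if "j < n" for j
    unfolding P_def using that
    by (intro borel_measurable_Pair measurable_coordinatewise_then_product Lm) auto
  have cm: "(\<lambda>x. c x j i) \<in> borel_measurable tor" and Qm: "(\<lambda>x. Q x j i l) \<in> borel_measurable tor" if "j < n" for j i l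
    unfolding c_def Q_def by (rule measurable_compose[OF Pm[OF that]], rule cs Qs)+
  have Um: "(\<lambda>x. step_basis n (Q x) j p l) \<in> borel_measurable tor" if "j \<le> n" for j p l
    using that
  proof (induction j arbitrary: l)
    case (Suc j)
    then show ?case by (auto intro!: borel_measurable_sum borel_measurable_times Qm)
  qed simp
  have bm: "(\<lambda>x. b i r x) \<in> borel_measurable tor" if "i < n" for i r
    unfolding b_def step_vector_def using that
    by (intro borel_measurable_sum borel_measurable_times Um cm) auto
  \<comment> \<open>Collects all almost everywhere conditions used at a single point. The witness
    \<open>D\<close> turns out to be \<open>d x\<close>; its last clause is the form in which (Ad.1)
    enters.\<close>
  define good where "good x \<longleftrightarrow> x \<in> torus \<and> (\<forall>r. \<Gamma> (e r) x \<in> sqi cnt) \<and>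
      (\<forall>j<n. interlaced n B (\<lambda>r. L j r x) (\<lambda>r. L (Suc j) r x)) \<and>
      (\<exists>D. (\<forall>r<D. \<forall>s<D. inn cnt (\<Gamma> (e r) x) (\<Gamma> (e s) x) = of_bool (r = s)) \<and>
        (\<forall>r\<ge>D. \<Gamma> (e r) x = (\<lambda>_. 0)) \<and> (\<forall>r<n. D \<le> r \<longrightarrow> L n r x = 0))" for x
  have good: "AE x in tor. good x"
    using e_ae e_fib step_ae top_ae d_ae A(2) AE_space
  proof eventually_elim
    case (elim x)
    then have x: "x \<in> torus" by simp
    \<comment> \<open>On padded positions the inequality is nonnegativity of the next list.\<close>
    have mono: "L j r x \<le> L (Suc j) r x" if "j < n" for j r
    proof (cases "r < j")
      case True
      then have "\<Lambda> (Suc r) j x \<le> \<Lambda> (Suc r) (Suc j) x" using elim(3) that by force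
      then show ?thesis using True by (simp add: L_def)
    next
      case False
      then show ?thesis using L_nonneg[of "Suc j" x r] that x by (simp add: L_def[of j])
    qed
    have shift: "L (Suc j) (Suc r) x \<le> L j r x" if "j < n" for j r
    proof (cases "r < j")
      case True
      then have "\<Lambda> (Suc (Suc r)) (Suc j) x \<le> \<Lambda> (Suc r) j x" using elim(3) that by force
      then show ?thesis using True by (simp add: L_def)
    qed (simp add: L_def)
    have le_top: "L j r x \<le> L n r x" if "j \<le> n" for j r
      using that by (induction rule: inc_induct) (auto intro: order_trans mono)
    have top: "L n r x = lam (Suc r) x" "L n r x \<le> B" if "r < n" for r
    proof -
      have "Suc r \<in> {1..n}" using that by simp
      with elim(4) have "\<Lambda> (Suc r) n x = lam (Suc r) x" "lam (Suc r) x \<le> B0" by blast+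
      then show "L n r x = lam (Suc r) x" "L n r x \<le> B" using that by (simp_all add: L_def B_def)
    qed
    have "interlaced n B (\<lambda>r. L j r x) (\<lambda>r. L (Suc j) r x)" if "j < n" for j
    proof -
      have "L (Suc j) r x \<le> B" if "r < n" for r
        using le_top[of "Suc j" r] top(2)[OF that] \<open>j < n\<close> by simp
      then show ?thesis
        unfolding interlaced_def using mono[OF that] shift[OF that] L_nonneg[of j x] that x by simp
    qed
    moreover obtain D where D: "\<forall>r<D. \<forall>s<D. inn cnt (\<Gamma> (e r) x) (\<Gamma> (e s) x) = of_bool (r = s)"
      "\<forall>r\<ge>D. \<Gamma> (e r) x = (\<lambda>_. 0)" "cfun.span ((\<lambda>r. \<Gamma> (e r) x) ` {..<D}) = cfun.span ((\<lambda>h. \<Gamma> h x) ` A)"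
      using elim(1) by blast
    moreover have "d x = D"
    proof -
      have on: "inj_on (\<lambda>r. \<Gamma> (e r) x) {..<D}" "cfun.independent ((\<lambda>r. \<Gamma> (e r) x) ` {..<D})"
        using orthonormal_independent[of "{..<D}" "\<lambda>r. \<Gamma> (e r) x" cnt] elim(2) D(1) by auto
      have "d x = cfun.dim (cfun.span ((\<lambda>r. \<Gamma> (e r) x) ` {..<D}))"
        using assms(3) x elim(6) D(3) by simp
      also have "\<dots> = D"
        unfolding cfun.dim_span_eq_card_independent[OF on(2)] card_image[OF on(1)] by simp
      finally show ?thesis .
    qed
    \<comment> \<open>Position \<open>r\<close> corresponds to eigenvalue number
      \<open>r + 1\<close>, so \<open>D \<le> r\<close> is exactly the range
      \<open>min n (d x) + 1 \<le> i\<close> of (Ad.1).\<close>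
    then have "\<forall>r<n. D \<le> r \<longrightarrow> L n r x = 0"
      using elim(5) top(1) by auto
    ultimately show ?case
      unfolding good_def using x elim(2) by blast
  qed
  have point: "rank_one_update n (\<lambda>r. L j r x) (\<lambda>r. L (Suc j) r x) (c x j) (Q x j)" if "good x" "j < n" for x j
    using sel[of "\<lambda>r. L j r x" "\<lambda>r. L (Suc j) r x"] that by (simp add: good_def c_def Q_def P_def)
  have L0: "L 0 r x = 0" for r x by (simp add: L_def)
  have b_sq: "(\<Sum>i<n. b i r x * b i s x) = of_bool (r = s) * L n r x" if "good x" "r < n" "s < n" for x r s
    unfolding b_def by (rule step_vectors(3)[of n "\<lambda>j r. L j r x"]) (use point L0 that in auto)
  have top_B: "L n r x \<le> B" if "good x" "r < n" for x r
  proof -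
    have n': "n - 1 < n" "Suc (n - 1) = n" using assms(4) by auto
    have "\<forall>j<n. interlaced n B (\<lambda>r. L j r x) (\<lambda>r. L (Suc j) r x)" using that by (simp add: good_def)
    from this[rule_format, OF n'(1)] show ?thesis unfolding n'(2) using that by (simp add: interlaced_def)
  qed
  \<comment> \<open>A single term of the sum of squares in \<open>b_sq\<close>. It has two uses: it
    bounds all coordinates, and it makes coordinate \<open>r\<close> vanish where the
    \<open>r\<close>-th final eigenvalue is zero.\<close>
  have b_le: "(b i r x)\<^sup>2 \<le> L n r x" if "good x" "i < n" "r < n" for x i r
    using member_le_sum[of i "{..<n}" "\<lambda>i. b i r x * b i r x"] b_sq[OF that(1,3,3)] that
    by (simp add: power2_eq_square)
  define V where "V i x l = (\<Sum>r<n. complex_of_real (b i r x) * \<Gamma> (e r) x l)" for i x l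
  \<comment> \<open>There are \<open>n\<close> coordinates, each at most \<open>sqrt B\<close> in
    size, multiplying fiber vectors of norm at most 1.\<close>
  define C where "C = real n * sqrt B"
  have V_bound: "V i x \<in> sqi cnt \<and> nrm cnt (V i x) \<le> C" if g: "good x" and i: "i < n" for x i
  proof
    have E: "\<Gamma> (e r) x \<in> sqi cnt" for r using g by (simp add: good_def)
    then show "V i x \<in> sqi cnt" unfolding V_def by (intro sqi_sum sqi_scale)
    have n1: "nrm cnt (\<Gamma> (e r) x) \<le> 1" for r
    proof -
      obtain D where D: "\<forall>r<D. \<forall>s<D. inn cnt (\<Gamma> (e r) x) (\<Gamma> (e s) x) = of_bool (r = s)" "\<forall>r\<ge>D. \<Gamma> (e r) x = (\<lambda>_. 0)"
        using g unfolding good_def by blast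
      show ?thesis
      proof (cases "r < D")
        case True
        then have "complex_of_real ((nrm cnt (\<Gamma> (e r) x))\<^sup>2) = complex_of_real 1" using D(1) inn_self[of cnt "\<Gamma> (e r) x"] by simp
        then have "(nrm cnt (\<Gamma> (e r) x))\<^sup>2 = 1" by (simp only: of_real_eq_iff)
        then show ?thesis by (simp add: power2_eq_1_iff) (auto simp: power2_eq_1_iff)
      next
        case False
        then show ?thesis using D(2) by simp
      qed
    qed
    have "nrm cnt (V i x) \<le> (\<Sum>r<n. cmod (complex_of_real (b i r x)) * nrm cnt (\<Gamma> (e r) x))"
      unfolding V_def by (rule nrm_sum_le) (rule E)
    also have "\<dots> \<le> (\<Sum>r<n. sqrt B * 1)"
    proof (intro sum_mono mult_mono n1)
      fix r assume "r \<in> {..<n}"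
      then have "(b i r x)\<^sup>2 \<le> B" using b_le[OF g i, of r] top_B[OF g, of r] by simp
      then show "cmod (complex_of_real (b i r x)) \<le> sqrt B" using real_le_rsqrt[of "\<bar>b i r x\<bar>" B] by simp
    qed (auto simp: B_def)
    finally show "nrm cnt (V i x) \<le> C" by (simp add: C_def)
  qed
  have "\<exists>f. f \<in> W \<and> (AE x in tor. \<Gamma> f x = V i x)" if i: "i < n" for i
  proof -
    have bc: "(\<lambda>x. complex_of_real (b i r x)) \<in> borel_measurable tor" for r
      using bm[OF i, of r] by measurable
    have "(\<lambda>x. V i x l) \<in> borel_measurable tor" for l
    proof -
      have "(\<lambda>x. \<Gamma> (e r) x l) \<in> borel_measurable tor" for r
        using sqiD(1)[OF Gamma_sqi[OF es]] unc_measurable by blast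
      then show ?thesis unfolding V_def by (intro borel_measurable_sum borel_measurable_times bc)
    qed
    then have "unc (V i) \<in> sqi fib"
      by (rule bounded_fiber_sqi) (use good V_bound[OF _ i] in \<open>auto elim: eventually_mono\<close>)
    then have "\<exists>f\<in>W. AE x in tor. \<Gamma> f x = V i x"
      by (rule Gamma_synthesis[OF W, where I="{..<n}" and h=e and c="\<lambda>r x. complex_of_real (b i r x)", rotated 3])
         (use e bc in \<open>auto simp: V_def fun_eq_iff\<close>)
    then show ?thesis by blast
  qed
  then have "\<forall>i. \<exists>f. i < n \<longrightarrow> f \<in> W \<and> (AE x in tor. \<Gamma> f x = V i x)" by blast
  from choice[OF this] obtain f where f: "\<forall>i. i < n \<longrightarrow> f i \<in> W \<and> (AE x in tor. \<Gamma> (f i) x = V i x)" ..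
  \<comment> \<open>The matrix computations count vectors from 0, the family in the conclusion from
    1.\<close>
  define F where "F i = f (i - 1)" for i
  have FW: "F i \<in> W" "AE x in tor. \<Gamma> (F i) x = V (i - 1) x" if "i \<in> {1..n}" for i
    using f that by (auto simp: F_def)
  have bes: "bessel n F"
  proof (rule bessel_bounded_fibers)
    show "F i \<in> sqi lebesgue" if "i \<in> {1..n}" for i using FW(1)[OF that] W shift_invariant_sqi by blast
    show "0 \<le> C" by (simp add: C_def B_def)
    show "AE x in tor. nrm cnt (\<Gamma> (F i) x) \<le> C" if i: "i \<in> {1..n}" for i
      using FW(2)[OF i] good
    proof eventually_elim
      case (elim x)
      then show ?case using V_bound[of x "i - 1"] i by auto
    qed
  qed
  have F_ae: "AE x in tor. \<forall>i\<in>{1..n}. \<Gamma> (F i) x = V (i - 1) x"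
    using FW(2) by (intro AE_finite_allI) auto
  have eig: "AE x in tor. \<Lambda> i j x = eigval i (frame_fiber j F x)" if j: "j \<in> {1..n}" and i: "i \<in> {1..j}" for i j
    using F_ae good
  proof eventually_elim
    case (elim x)
    note g = elim(2)
    obtain D where D: "\<forall>r<D. \<forall>s<D. inn cnt (\<Gamma> (e r) x) (\<Gamma> (e s) x) = of_bool (r = s)"
      "\<forall>r\<ge>D. \<Gamma> (e r) x = (\<lambda>_. 0)" "\<forall>r<n. D \<le> r \<longrightarrow> L n r x = 0"
      using g unfolding good_def by blast
    have E: "\<Gamma> (e r) x \<in> sqi cnt" for r using g by (simp add: good_def)
    have inter: "interlaced n B (\<lambda>r. L (j - 1) r x) (\<lambda>r. L j r x)"
    proof -
      have j': "j - 1 < n" "Suc (j - 1) = j" using j by auto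
      have "\<forall>j<n. interlaced n B (\<lambda>r. L j r x) (\<lambda>r. L (Suc j) r x)" using g by (simp add: good_def)
      from this[rule_format, OF j'(1)] show ?thesis unfolding j'(2) .
    qed
    have "eigval i (frame_fiber j F x) = L j (i - 1) x"
    proof (rule eigval_frame[where E="\<lambda>r. \<Gamma> (e r) x" and D=D and n=n and j=j and b="\<lambda>i r. b i r x"
          and V="final_basis n (Q x) j" and L="\<lambda>r. L j r x"])
      show "orthonormal_columns n (final_basis n (Q x) j)"
        by (rule step_vectors(1)[of n "\<lambda>j r. L j r x" "c x"]) (use point[OF g] L0 j in auto)
      show "(\<Sum>i<j. b i r x * b i s x) = (\<Sum>l<n. final_basis n (Q x) j r l * L j l x * final_basis n (Q x) j s l)"
        if "r < n" "s < n" for r s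
        unfolding b_def by (rule step_vectors(2)[of n "\<lambda>j r. L j r x" "c x"]) (use point[OF g] L0 j that in auto)
      show "b i r x = 0" if "i < j" "D \<le> r" "r < n" for i r
        using b_le[OF g, of i r] D(3) that j by simp
      \<comment> \<open>The order within one list comes from interlacing with the preceding one:
        entry \<open>s + 1\<close> of step \<open>j\<close> is at most entry \<open>s\<close> of
        step \<open>j - 1\<close>, which is at most entry \<open>s\<close> of step
        \<open>j\<close>.\<close>
      show "L j s x \<le> L j r x" if "r \<le> s" "s < n" for r s
        using that
      proof (induction s rule: dec_induct)
        case (step s)
        have "L j (Suc s) x \<le> L (j - 1) s x" "L (j - 1) s x \<le> L j s x"
          using inter step.prems by (auto simp: interlaced_def)
        then show ?case using step by simp
      qed simp
      show "0 \<le> L j r x" if "r < n" for r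
        using g j by (intro L_nonneg) (auto simp: good_def)
      show "frame_fiber j F x \<xi> = (\<lambda>l. \<Sum>i<j. inn cnt \<xi> (\<lambda>l. \<Sum>r<n. complex_of_real (b i r x) * \<Gamma> (e r) x l) * (\<Sum>r<n. complex_of_real (b i r x) * \<Gamma> (e r) x l))"
        if \<xi>: "\<xi> \<in> sqi cnt" for \<xi>
      proof
        fix l
        have "frame_fiber j F x \<xi> l = (\<Sum>i\<in>Suc ` {..<j}. ell2_inner \<xi> (\<Gamma> (F i) x) * \<Gamma> (F i) x l)"
          by (simp add: frame_fiber_def image_Suc_lessThan)
        also have "\<dots> = (\<Sum>i<j. ell2_inner \<xi> (\<Gamma> (F (Suc i)) x) * \<Gamma> (F (Suc i)) x l)"
          by (subst sum.reindex) auto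
        also have "\<dots> = (\<Sum>i<j. inn cnt \<xi> (V i x) * V i x l)"
        proof (intro sum.cong refl)
          fix i assume i: "i \<in> {..<j}"
          then have "\<Gamma> (F (Suc i)) x = V i x" using elim(1) j by force
          moreover have "V i x \<in> sqi cnt" using V_bound[OF g, of i] i j by simp
          ultimately show "ell2_inner \<xi> (\<Gamma> (F (Suc i)) x) * \<Gamma> (F (Suc i)) x l = inn cnt \<xi> (V i x) * V i x l"
            using ell2_inner_inn[OF \<xi>] by simp
        qed
        finally show "frame_fiber j F x \<xi> l = (\<Sum>i<j. inn cnt \<xi> (\<lambda>l. \<Sum>r<n. complex_of_real (b i r x) * \<Gamma> (e r) x l) * (\<Sum>r<n. complex_of_real (b i r x) * \<Gamma> (e r) x l))"
          by (simp only: V_def[abs_def])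
      qed
    qed (use E D i j in auto)
    moreover have "i - 1 < j" "Suc (i - 1) = i" using i by auto
    ultimately show ?case by (simp add: L_def)
  qed
  show ?thesis
    using FW(1) bes eig by blast
qed

end
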